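(* There exists a universal positive constant $C$ such that for all $1<p<\infty$ and all integers $d\ge1$, $$\big(\mathsf{L}^{\widetilde\Delta}_{c,p,1}\big)^d\le \mathsf{L}^{\widetilde\Delta}_{c,p,d}\le \big(C\,\mathsf{L}^{\widetilde\Delta}_{c,p,1}\big)^d\quad\text{and}\quad \big(\mathsf{L}^{\widetilde\Delta}_{t,p,1}\big)^d\le \mathsf{L}^{\widetilde\Delta}_{t,p,d}\le \big(C\,\mathsf{L}^{\widetilde\Delta}_{t,p,1}\big)^d,$$ where $\mathsf{L}^{\widetilde\Delta}_{t,p,d}$ and $\mathsf{L}^{\widetilde\Delta}_{c,p,d}$ are the best constants in $$\big(\mathsf{L}^{\widetilde\Delta}_{t,p,d}\big)^{-1}\|f\|_{p}\le \|S^{\widetilde\Delta}(f)\|_{p}\le \mathsf{L}^{\widetilde\Delta}_{c,p,d}\|f\|_{p},\quad f\in L_p(\mathbb{T}^d).$$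
   Context: $\mathbb{T}^d$ is the $d$-torus with normalized Haar measure. $\widetilde\Delta$ is the dyadic partition of $\mathbb{Z}^d$ consisting of all $d$-fold products of the sets $\{0\}$, $[2^{k-1},2^k)\cap\mathbb{Z}$ and $(-2^k,-2^{k-1}]\cap\mathbb{Z}$, $k\ge1$. For $R\in\widetilde\Delta$, $S_R$ is the partial sum operator $\widehat{S_R(f)}=\mathbf{1}_R\widehat f$ (Fourier coefficients on $\mathbb{Z}^d$), and $S^{\widetilde\Delta}(f)=\big(\sum_{R\in\widetilde\Delta}|S_R(f)|^2\big)^{1/2}$ for $f\in L_p(\mathbb{T}^d)$. Best constants means the smallest constants for which the inequalities hold for all $f\in L_p(\mathbb{T}^d)$. *)

theory Defs
  imports "HOL-Analysis.Analysis"
begin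

text \<open>
  The torus of dimension \<open>d\<close> is the \<open>d\<close>-fold product of the unit circle of \<open>\<complex>\<close>, with coordinates
  indexed by \<open>{..<d}\<close>; the dimension is a natural number, so that it can be quantified inside a
  formula. The normalized Haar measure of the circle is the image of Lebesgue measure on
  \<open>[0, 1)\<close> under \<open>t \<mapsto> exp (2 \<pi> i t)\<close>.
\<close>

definition circle_haar :: "complex measure" where
  "circle_haar =
     distr (restrict_space lborel {0..<1}) (restrict_space borel (sphere 0 1))
       (\<lambda>t::real. cis (2 * pi * t))"

definition torus :: "nat \<Rightarrow> (nat \<Rightarrow> complex) measure" where
  "torus d = PiM {..<d} (\<lambda>_. circle_haar)"

text \<open>Power of an extended nonnegative number, used for exponents \<open>a > 0\<close> only.\<close>

definition ennpow :: "ennreal \<Rightarrow> real \<Rightarrow> ennreal" where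
  "ennpow x a = (if x = \<infinity> then \<infinity> else ennreal (enn2real x powr a))"

definition Lp_norm :: "'a measure \<Rightarrow> real \<Rightarrow> ('a \<Rightarrow> ennreal) \<Rightarrow> ennreal" where
  "Lp_norm M p g = ennpow (\<integral>\<^sup>+ x. ennpow (g x) p \<partial>M) (1 / p)"

definition Lp_space :: "'a measure \<Rightarrow> real \<Rightarrow> ('a \<Rightarrow> complex) set" where
  "Lp_space M p = {f \<in> borel_measurable M. Lp_norm M p (\<lambda>x. ennreal (norm (f x))) < \<infinity>}"

definition character :: "nat \<Rightarrow> (nat \<Rightarrow> int) \<Rightarrow> (nat \<Rightarrow> complex) \<Rightarrow> complex" where
  "character d n z = (\<Prod>i<d. z i powi n i)"

definition fourier_coeff ::
  "nat \<Rightarrow> ((nat \<Rightarrow> complex) \<Rightarrow> complex) \<Rightarrow> (nat \<Rightarrow> int) \<Rightarrow> complex" where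
  "fourier_coeff d f n = (\<integral>z. f z * cnj (character d n z) \<partial>torus d)"

definition dyadic_intervals :: "int set set" where
  "dyadic_intervals =
     {{0}} \<union> {{2 ^ (k - 1)..<2 ^ k} | k::nat. k \<ge> 1}
           \<union> {{- (2 ^ k)<..- (2 ^ (k - 1))} | k::nat. k \<ge> 1}"

text \<open>The lattice \<open>\<int>\<^sup>d\<close> is \<open>{..<d} \<rightarrow>\<^sub>E UNIV\<close>.\<close>

definition dyadic_partition :: "nat \<Rightarrow> (nat \<Rightarrow> int) set set" where
  "dyadic_partition d = {PiE {..<d} I | I. \<forall>i<d. I i \<in> dyadic_intervals}"

text \<open>
  Every \<open>R\<close> in the dyadic partition is finite, so the function with Fourier coefficients
  \<open>1\<^sub>R \<cdot> fourier_coeff d f\<close> is the following trigonometric polynomial.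
\<close>

definition partial_sum ::
  "nat \<Rightarrow> (nat \<Rightarrow> int) set \<Rightarrow> ((nat \<Rightarrow> complex) \<Rightarrow> complex) \<Rightarrow> (nat \<Rightarrow> complex) \<Rightarrow> complex" where
  "partial_sum d R f z = (\<Sum>n\<in>R. fourier_coeff d f n * character d n z)"

definition square_function ::
  "nat \<Rightarrow> ((nat \<Rightarrow> complex) \<Rightarrow> complex) \<Rightarrow> (nat \<Rightarrow> complex) \<Rightarrow> ennreal" where
  "square_function d f z =
     ennpow (\<Sum>\<^sub>\<infinity>R\<in>dyadic_partition d. ennreal ((norm (partial_sum d R f z))\<^sup>2)) (1 / 2)"

text \<open>
  The best constants are formed in \<open>[0, \<infinity>]\<close>, where the infimum is attained; the
  convention is \<open>\<infinity>\<close> if no finite constant is admissible.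
\<close>

definition best_c :: "real \<Rightarrow> nat \<Rightarrow> ennreal" where
  "best_c p d =
     Inf {L. \<forall>f\<in>Lp_space (torus d) p.
       Lp_norm (torus d) p (square_function d f)
         \<le> L * Lp_norm (torus d) p (\<lambda>z. ennreal (norm (f z)))}"

definition best_t :: "real \<Rightarrow> nat \<Rightarrow> ennreal" where
  "best_t p d =
     Inf {L. \<forall>f\<in>Lp_space (torus d) p.
       inverse L * Lp_norm (torus d) p (\<lambda>z. ennreal (norm (f z)))
         \<le> Lp_norm (torus d) p (square_function d f)}"

end

theory Submission
  imports Defs "HOL-Probability.Probability"
begin

text \<open>
  The lower bounds come from tensor powers. For a function \<open>h\<close> on the circle, both sides of the
  inequality for \<open>z \<mapsto> h (z 0) \<cdots> h (z (d - 1))\<close> are the \<open>d\<close>-th powers of the corresponding sides for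
  \<open>h\<close>. So if \<open>L\<close> is an admissible constant in dimension \<open>d\<close>, then \<open>L\<^sup>1\<^sup>/\<^sup>d\<close> is admissible in dimension
  one (\<open>admissible_c_root\<close>, \<open>admissible_t_root\<close>).

  For the upper bounds the one-dimensional inequality is applied in one variable after the other.
  After the first variable, one has to deal with the family of all its dyadic pieces at once, that is,
  with functions with values in \<open>\<ell>\<^sub>2\<close> (\<open>torus_extension\<close>, \<open>torus_reverse_extension\<close>). The point is
  therefore that the scalar inequality on the circle extends to families of functions with a loss of a
  factor that is independent of \<open>p\<close>. This holds for every sequence of linear operators \<open>P k\<close> on an
  \<open>L\<^sub>p\<close>-space (\<open>countable_extension\<close>, \<open>countable_reverse_extension\<close>).

  For \<open>p \<le> 2\<close> the extension follows by averaging the scalar inequality for \<open>\<Sum>j. \<plusminus> f j\<close> over all signs,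
  since the \<open>p\<close>-th moments of such sums are equivalent to the \<open>\<ell>\<^sub>2\<close>-norm uniformly in \<open>1 \<le> p \<le> 2\<close>, also
  for coefficients in \<open>\<ell>\<^sub>2\<close>. For \<open>p \<ge> 2\<close> this would lose a factor of order \<open>\<surd>p\<close>, and the two
  inequalities require different arguments.

  The reverse inequality \<open>\<parallel>f\<parallel> \<le> L \<parallel>S f\<parallel>\<close> is averaged over Gaussian sums. The \<open>p\<close>-th moment \<open>\<gamma>\<close> of a
  Gaussian variable enters on the left as an equality, up to a factor for real and imaginary parts, and
  on the right, by Minkowski's inequality, as an upper bound. It is the same \<open>\<gamma>\<close> on both sides and
  cancels (\<open>finite_reverse_extension_ge_2\<close>).

  The direct inequality \<open>\<parallel>S f\<parallel> \<le> L \<parallel>f\<parallel>\<close> is treated as in the proof of Grothendieck's inequality by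
  truncation (\<open>truncation_step\<close>). The random sum \<open>\<Sum>j. \<plusminus> f j x\<close> is cut at a fixed multiple of
  \<open>(\<Sum>j. \<bar>f j x\<bar>\<^sup>2)\<^sup>1\<^sup>/\<^sup>2\<close>. The bounded part satisfies the scalar inequality for each choice of signs, and
  costs only the level of the truncation. The other part is small in \<open>L\<^sub>2\<close> over the signs, hence a family
  with a small \<open>\<ell>\<^sub>2\<close>-norm, to which the extended inequality itself applies. So a constant for the extended
  inequality can be replaced by about half of it, plus a multiple of the scalar constant. Starting
  from any finite constant, here the one with a loss of the Gaussian moment, and iterating, only that
  multiple remains.
\<close>


section \<open>Powers of extended nonnegative numbers\<close>

lemma ennpow_top [simp]: "ennpow top a = top"
  by (simp add: ennpow_def)

lemma ennpow_ennreal: "0 \<le> x \<Longrightarrow> ennpow (ennreal x) a = ennreal (x powr a)"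
  by (simp add: ennpow_def)

lemma ennpow_zero [simp]: "ennpow 0 a = 0"
  by (simp add: ennpow_def)

lemma ennpow_one [simp]: "ennpow 1 a = 1"
  by (simp add: ennpow_def)

lemma ennpow_mono: "x \<le> y \<Longrightarrow> 0 \<le> a \<Longrightarrow> ennpow x a \<le> ennpow y a"
  by (cases x; cases y) (auto simp: ennpow_ennreal powr_mono2 top_unique)

lemma ennpow_mult: "0 < a \<Longrightarrow> ennpow (x * y) a = ennpow x a * ennpow y a"
  by (cases x; cases y)
     (auto simp: ennpow_ennreal powr_mult ennreal_mult_top ennreal_top_mult simp flip: ennreal_mult)

lemma ennpow_ennpow: "ennpow (ennpow x a) b = ennpow x (a * b)"
  by (cases x) (auto simp: ennpow_ennreal powr_powr)

lemma ennpow_1 [simp]: "ennpow x 1 = x"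
  by (cases x) (auto simp: ennpow_ennreal)

lemma ennpow_of_nat: "0 < n \<Longrightarrow> ennpow x (real n) = x ^ n"
  by (cases x) (auto simp: ennpow_ennreal powr_realpow' ennreal_power power_eq_top_ennreal)

lemma ennpow_inverse: "0 < a \<Longrightarrow> ennpow (inverse x) a = inverse (ennpow x a)"
proof (cases x)
  case (real r)
  then show "0 < a \<Longrightarrow> ennpow (inverse x) a = inverse (ennpow x a)"
    by (cases "r = 0") (auto simp: ennpow_ennreal inverse_ennreal powr_minus inverse_powr)
qed auto

lemma ennpow_le_top_iff: "ennpow x a < top \<longleftrightarrow> x < top"
  by (cases x) (auto simp: ennpow_ennreal)

text \<open>
  For \<open>a > 0\<close> the power functions with exponents \<open>a\<close> and \<open>1 / a\<close> form a Galois connection; this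
  gives continuity along suprema without any limit argument.
\<close>

lemma ennpow_le_iff: "0 < a \<Longrightarrow> ennpow x a \<le> y \<longleftrightarrow> x \<le> ennpow y (1 / a)"
  using ennpow_mono[of "ennpow x a" y "1 / a"] ennpow_mono[of x "ennpow y (1 / a)" a]
  by (auto simp: ennpow_ennpow)

lemma ennpow_mono_iff: "0 < a \<Longrightarrow> ennpow x a \<le> ennpow y a \<longleftrightarrow> x \<le> y"
  by (simp add: ennpow_le_iff ennpow_ennpow)

lemma ennpow_SUP: "0 < a \<Longrightarrow> ennpow (SUP i\<in>I. f i) a = (SUP i\<in>I. ennpow (f i) a)"
proof (rule antisym)
  assume "0 < a"
  have "f i \<le> ennpow (SUP i\<in>I. ennpow (f i) a) (1 / a)" if "i \<in> I" for i
    using that \<open>0 < a\<close> by (subst ennpow_le_iff[symmetric]) (auto intro: SUP_upper)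
  then show "ennpow (SUP i\<in>I. f i) a \<le> (SUP i\<in>I. ennpow (f i) a)"
    using \<open>0 < a\<close> by (subst ennpow_le_iff) (auto intro: SUP_least)
next
  assume "0 < a"
  then show "(SUP i\<in>I. ennpow (f i) a) \<le> ennpow (SUP i\<in>I. f i) a"
    by (intro SUP_least ennpow_mono SUP_upper) auto
qed

lemma borel_measurable_ennpow [measurable (raw)]:
  "f \<in> borel_measurable M \<Longrightarrow> (\<lambda>x. ennpow (f x) a) \<in> borel_measurable M"
  unfolding ennpow_def by simp

text \<open>
  The tangent at \<open>m\<close> to the graph of the convex function \<open>x \<mapsto> x\<^sup>r\<close>. For \<open>m = 1\<close> this is Young's
  inequality, and the general case follows by homogeneity.
\<close>

lemma powr_tangent:
  fixes x m r :: real
  assumes "0 \<le> x" "0 < m" "1 \<le> r"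
  shows "r * m powr (r - 1) * x \<le> x powr r + (r - 1) * m powr r"
proof (cases "r = 1 \<or> x = 0")
  case True
  then show ?thesis using assms by auto
next
  case False
  define u where "u = x / m"
  have u: "0 < u" "x = u * m" using assms False by (auto simp: u_def)
  have "((u powr r) powr (1 / r)) * (1 powr (1 - 1 / r)) \<le> (1 / r) * u powr r + (1 - 1 / r) * 1"
    using assms Youngs_inequality_0[of "1 / r" "1 - 1 / r" "u powr r" 1] u by simp
  then have "r * (u * (1 / r + (1 - 1 / r))) \<le> r * ((1 / r) * u powr r + (1 - 1 / r) * 1)"
    using assms u by (intro mult_left_mono) (auto simp: powr_powr)
  then have "r * u \<le> u powr r + (r - 1)"
    using assms by (simp add: distrib_left right_diff_distrib)
  then have "(r * u) * m powr r \<le> (u powr r + (r - 1)) * m powr r"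
    by (intro mult_right_mono) auto
  moreover have "m powr (r - 1) * m = m powr r"
    using assms by (simp add: powr_diff)
  ultimately show ?thesis
    using u assms by (simp add: powr_mult algebra_simps) (metis mult.assoc mult.commute)
qed

text \<open>Jensen's inequality: integrate the tangent at the mean.\<close>

lemma (in prob_space) jensen_ennpow:
  assumes [measurable]: "g \<in> borel_measurable M" and r: "1 \<le> r"
  shows "ennpow (\<integral>\<^sup>+x. g x \<partial>M) r \<le> (\<integral>\<^sup>+x. ennpow (g x) r \<partial>M)"
proof -
  have tangent: "ennreal (r * m powr (r - 1)) * (\<integral>\<^sup>+x. g x \<partial>M)
      \<le> (\<integral>\<^sup>+x. ennpow (g x) r \<partial>M) + ennreal ((r - 1) * m powr r)" if "0 < m" for m
  proof -
    have "ennreal (r * m powr (r - 1)) * g x \<le> ennpow (g x) r + ennreal ((r - 1) * m powr r)" for x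
      using r that powr_tangent[OF _ that r]
      by (cases "g x") (auto simp: ennpow_ennreal simp flip: ennreal_mult ennreal_plus)
    then have "(\<integral>\<^sup>+x. ennreal (r * m powr (r - 1)) * g x \<partial>M)
        \<le> (\<integral>\<^sup>+x. (ennpow (g x) r + ennreal ((r - 1) * m powr r)) \<partial>M)"
      by (intro nn_integral_mono)
    then show ?thesis
      by (simp add: nn_integral_cmult nn_integral_add emeasure_space_1)
  qed
  show ?thesis
  proof (cases "(\<integral>\<^sup>+x. ennpow (g x) r \<partial>M)")
    case (real B)
    \<comment> \<open>The tangent at \<open>1\<close> bounds the mean, so that the tangent at the mean is available.\<close>
    have "(\<integral>\<^sup>+x. g x \<partial>M) < top"
      using tangent[of 1] r real
      by (cases "\<integral>\<^sup>+x. g x \<partial>M") (auto simp: ennreal_mult_top top_unique simp flip: ennreal_plus)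
    then obtain m where m: "(\<integral>\<^sup>+x. g x \<partial>M) = ennreal m" "0 \<le> m"
      by (cases "\<integral>\<^sup>+x. g x \<partial>M") auto
    show ?thesis
    proof (cases "m = 0")
      case False
      then have "0 < m" using m by simp
      then have "r * m powr (r - 1) * m \<le> B + (r - 1) * m powr r"
        using tangent[of m] m real r by (simp flip: ennreal_plus ennreal_mult)
      moreover have "m powr (r - 1) * m = m powr r"
        using \<open>0 < m\<close> by (simp add: powr_diff)
      ultimately have "m powr r \<le> B"
        by (simp add: left_diff_distrib mult.assoc)
      then show ?thesis
        using m real by (simp add: ennpow_ennreal)
    qed (use m in auto)
  qed auto
qed

text \<open>Weighted means are expectations over discrete probability spaces.\<close>

lemma jensen_sum:
  fixes w g :: "'i \<Rightarrow> ennreal"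
  assumes "finite S" "(\<Sum>i\<in>S. w i) = 1" "1 \<le> r"
  shows "ennpow (\<Sum>i\<in>S. w i * g i) r \<le> (\<Sum>i\<in>S. w i * ennpow (g i) r)"
proof -
  interpret prob_space "point_measure S w"
    using assms by (intro prob_spaceI) (simp add: space_point_measure emeasure_point_measure_finite)
  show ?thesis
    using jensen_ennpow[of g r] assms by (simp add: nn_integral_point_measure_finite)
qed

text \<open>The concave case is the convex one for \<open>g\<^sup>\<theta>\<close> and the exponent \<open>1 / \<theta>\<close>.\<close>

lemma jensen_sum_concave:
  fixes w g :: "'i \<Rightarrow> ennreal"
  assumes "finite S" "(\<Sum>i\<in>S. w i) = 1" "0 < \<theta>" "\<theta> \<le> 1"
  shows "(\<Sum>i\<in>S. w i * ennpow (g i) \<theta>) \<le> ennpow (\<Sum>i\<in>S. w i * g i) \<theta>"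
  using jensen_sum[of S w "1 / \<theta>" "\<lambda>i. ennpow (g i) \<theta>"] assms
  by (simp add: ennpow_ennpow ennpow_le_iff)

lemma jensen_suminf:
  fixes w g :: "nat \<Rightarrow> ennreal"
  assumes "(\<Sum>i. w i) = 1" "1 \<le> r"
  shows "ennpow (\<Sum>i. w i * g i) r \<le> (\<Sum>i. w i * ennpow (g i) r)"
proof -
  interpret prob_space "density (count_space UNIV) w"
    using assms by (intro prob_spaceI) (simp add: emeasure_density nn_integral_count_space_nat)
  show ?thesis
    using jensen_ennpow[of g r] assms by (simp add: nn_integral_density nn_integral_count_space_nat)
qed

lemma ennpow_add_le:
  assumes "1 \<le> r"
  shows "ennpow (x + y) r \<le> ennreal (2 powr (r - 1)) * (ennpow x r + ennpow y r)"
proof -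
  define h where "h = ennreal (1 / 2)"
  have half: "h + h = 1"
    unfolding h_def by (subst ennreal_plus[symmetric]) simp_all
  then have two: "2 * h = 1"
    by (simp only: mult_2)
  have "ennreal (2 powr (r - 1)) = ennreal (2 powr r * (1 / 2))"
    by (simp add: powr_diff)
  also have "\<dots> = ennpow 2 r * h"
    using ennpow_ennreal[of 2 r] by (subst ennreal_mult) (simp_all add: h_def)
  finally have const: "ennreal (2 powr (r - 1)) = ennpow 2 r * h" .
  have "ennpow (h * (x + y)) r \<le> h * (ennpow x r + ennpow y r)"
    using jensen_sum[of "{True, False}" "\<lambda>_. h" r "\<lambda>b. if b then x else y"] assms half two
    by (simp add: distrib_left)
  then have "ennpow 2 r * ennpow (h * (x + y)) r \<le> ennpow 2 r * (h * (ennpow x r + ennpow y r))"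
    by (intro mult_left_mono) auto
  also have "ennpow 2 r * ennpow (h * (x + y)) r = ennpow (x + y) r"
    using assms two by (simp flip: ennpow_mult mult.assoc)
  finally show ?thesis
    by (simp add: const mult.assoc)
qed

section \<open>Rademacher sums\<close>

text \<open>
  The sign vectors on a finite set \<open>J\<close> are indexed by \<open>Pow J\<close>, so that expectations over random
  signs are finite sums divided by \<open>2 ^ card J\<close>.
\<close>

definition rademacher_sum :: "'j set \<Rightarrow> 'j set \<Rightarrow> ('j \<Rightarrow> complex) \<Rightarrow> complex" where
  "rademacher_sum J A v = (\<Sum>j\<in>J. (if j \<in> A then 1 else - 1) * v j)"

lemma sum_Pow_insert:
  assumes "finite J" "j \<notin> J"
  shows "(\<Sum>A\<in>Pow (insert j J). \<phi> A) = (\<Sum>A\<in>Pow J. \<phi> A + \<phi> (insert j A))"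
proof -
  have "inj_on (insert j) (Pow J)" "Pow J \<inter> insert j ` Pow J = {}"
    using assms by (auto simp: inj_on_def)
  then show ?thesis
    using assms by (simp add: Pow_insert sum.union_disjoint sum.reindex sum.distrib)
qed

lemma rademacher_sum_insert:
  assumes "finite J" "j \<notin> J" "A \<subseteq> J"
  shows "rademacher_sum (insert j J) A v = rademacher_sum J A v - v j"
    and "rademacher_sum (insert j J) (insert j A) v = rademacher_sum J A v + v j"
proof -
  have "(\<Sum>i\<in>J. (if i = j \<or> i \<in> A then 1 else - 1) * v i) = (\<Sum>i\<in>J. (if i \<in> A then 1 else - 1) * v i)"
    using assms by (intro sum.cong) auto
  then show "rademacher_sum (insert j J) A v = rademacher_sum J A v - v j"
    and "rademacher_sum (insert j J) (insert j A) v = rademacher_sum J A v + v j"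
    using assms by (auto simp: rademacher_sum_def)
qed

lemma norm_add_diff_squares:
  fixes x a :: complex
  shows "(norm (x - a))\<^sup>2 + (norm (x + a))\<^sup>2 = 2 * ((norm x)\<^sup>2 + (norm a)\<^sup>2)"
  unfolding cmod_power2 by (simp add: power2_eq_square algebra_simps)

lemma rademacher_second_moment:
  assumes "finite J"
  shows "(\<Sum>A\<in>Pow J. (norm (rademacher_sum J A v))\<^sup>2) = 2 ^ card J * (\<Sum>j\<in>J. (norm (v j))\<^sup>2)"
  using assms
proof induction
  case empty
  then show ?case by (simp add: rademacher_sum_def)
next
  case (insert j J)
  have "(\<Sum>A\<in>Pow (insert j J). (norm (rademacher_sum (insert j J) A v))\<^sup>2)
      = (\<Sum>A\<in>Pow J. (norm (rademacher_sum J A v - v j))\<^sup>2 + (norm (rademacher_sum J A v + v j))\<^sup>2)"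
    unfolding sum_Pow_insert[OF insert.hyps]
    by (intro sum.cong refl) (simp add: rademacher_sum_insert insert.hyps)
  also have "\<dots> = 2 * (\<Sum>A\<in>Pow J. (norm (rademacher_sum J A v))\<^sup>2) + 2 * 2 ^ card J * (norm (v j))\<^sup>2"
    unfolding norm_add_diff_squares using insert.hyps
    by (simp add: sum.distrib sum_distrib_left card_Pow algebra_simps)
  finally show ?case
    using insert by (simp add: algebra_simps)
qed

text \<open>
  The parallelogram identity together with the Cauchy-Schwarz inequality for the cross term.
\<close>

lemma sum_squares_pow4_step:
  fixes x a :: "'k \<Rightarrow> complex" and K :: "'k set"
  defines "q \<equiv> \<lambda>y. \<Sum>k\<in>K. (norm (y k))\<^sup>2"
  shows "(q (\<lambda>k. x k - a k))\<^sup>2 + (q (\<lambda>k. x k + a k))\<^sup>2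
    \<le> 2 * (q x)\<^sup>2 + 12 * q x * q a + 2 * (q a)\<^sup>2"
proof -
  define b where "b = (\<Sum>k\<in>K. Re (x k * cnj (a k)))"
  have plus: "q (\<lambda>k. x k + a k) = q x + q a + 2 * b"
    unfolding q_def b_def cmod_power2
    by (simp add: sum.distrib sum_distrib_left power2_eq_square algebra_simps)
  have minus: "q (\<lambda>k. x k - a k) = q x + q a - 2 * b"
    unfolding q_def b_def cmod_power2
    by (simp add: sum.distrib sum_subtractf sum_distrib_left power2_eq_square algebra_simps)
  have "\<bar>b\<bar> \<le> (\<Sum>k\<in>K. norm (x k) * norm (a k))"
    unfolding b_def
    by (rule order_trans[OF sum_abs sum_mono]) (metis abs_Re_le_cmod norm_mult complex_mod_cnj)
  then have "b\<^sup>2 \<le> (\<Sum>k\<in>K. norm (x k) * norm (a k))\<^sup>2"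
    by (rule abs_le_square_iff[THEN iffD1, OF order_trans]) auto
  also have "\<dots> \<le> q x * q a"
    unfolding q_def by (rule Cauchy_Schwarz_ineq_sum)
  finally show ?thesis
    unfolding plus minus by (simp add: power2_eq_square algebra_simps)
qed

text \<open>
  The constant \<open>3\<close> is the one that is reproduced by the induction over \<open>J\<close>: in the mean, the step adds a cross
  term with coefficient \<open>6 = 2 * 3\<close>.
\<close>

lemma rademacher_fourth_moment:
  assumes "finite J"
  shows "(\<Sum>A\<in>Pow J. (\<Sum>k\<in>K. (norm (rademacher_sum J A (\<lambda>j. v j k)))\<^sup>2)\<^sup>2)
    \<le> 3 * 2 ^ card J * (\<Sum>j\<in>J. \<Sum>k\<in>K. (norm (v j k))\<^sup>2)\<^sup>2"
  using assms
proof induction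
  case empty
  then show ?case by (simp add: rademacher_sum_def)
next
  case (insert j J)
  define X where "X A k = rademacher_sum J A (\<lambda>j. v j k)" for A k
  define q :: "_ \<Rightarrow> real" where "q y = (\<Sum>k\<in>K. (norm (y k))\<^sup>2)" for y :: "_ \<Rightarrow> complex"
  define s where "s = (\<Sum>j\<in>J. q (v j))"
  have nonneg: "0 \<le> q y" for y
    by (simp add: q_def sum_nonneg)
  have "(\<Sum>A\<in>Pow (insert j J). (q (\<lambda>k. rademacher_sum (insert j J) A (\<lambda>j. v j k)))\<^sup>2)
      = (\<Sum>A\<in>Pow J. (q (\<lambda>k. X A k - v j k))\<^sup>2 + (q (\<lambda>k. X A k + v j k))\<^sup>2)"
    unfolding sum_Pow_insert[OF insert.hyps] X_def
    by (intro sum.cong refl) (simp add: rademacher_sum_insert insert.hyps)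
  also have "\<dots> \<le> (\<Sum>A\<in>Pow J. 2 * (q (X A))\<^sup>2 + 12 * q (X A) * q (v j) + 2 * (q (v j))\<^sup>2)"
    unfolding q_def by (intro sum_mono sum_squares_pow4_step)
  also have "\<dots> = 2 * (\<Sum>A\<in>Pow J. (q (X A))\<^sup>2) + 12 * q (v j) * (\<Sum>A\<in>Pow J. q (X A))
      + 2 * 2 ^ card J * (q (v j))\<^sup>2"
    using insert.hyps by (simp add: sum.distrib sum_distrib_left card_Pow algebra_simps)
  also have "(\<Sum>A\<in>Pow J. q (X A)) = 2 ^ card J * s"
    unfolding q_def X_def s_def using insert.hyps
    by (subst sum.swap) (simp add: rademacher_second_moment flip: sum_distrib_left, subst sum.swap, simp)
  also have "2 * (\<Sum>A\<in>Pow J. (q (X A))\<^sup>2) + 12 * q (v j) * (2 ^ card J * s) + 2 * 2 ^ card J * (q (v j))\<^sup>2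
      \<le> 2 * (3 * 2 ^ card J * s\<^sup>2) + 12 * q (v j) * (2 ^ card J * s) + 6 * 2 ^ card J * (q (v j))\<^sup>2"
    using insert.IH by (intro add_mono) (auto simp: q_def X_def s_def)
  also have "\<dots> = 3 * 2 ^ card (insert j J) * (\<Sum>i\<in>insert j J. q (v i))\<^sup>2"
    using insert.hyps by (simp add: s_def power2_eq_square algebra_simps)
  finally show ?case
    by (simp add: q_def)
qed

text \<open>
  For \<open>1 \<le> p \<le> 2\<close> the moment of order \<open>p\<close> is controlled from below by the second and the fourth
  one: \<open>u\<^sup>p\<^sup>/\<^sup>2\<close> dominates \<open>u / A - u\<^sup>2 / A\<^sup>3\<close> for \<open>A = \<surd>6\<close>, and the
  value of \<open>A\<close> makes the second term at most half of the first one in the mean.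
\<close>

lemma powr_ge_quadratic:
  fixes u p :: real
  assumes "0 \<le> u" "1 \<le> p" "p \<le> 2"
  shows "u / sqrt 6 - u\<^sup>2 / (6 * sqrt 6) \<le> u powr (p / 2)"
proof (cases "u = 0 \<or> 6 < u")
  case True
  have "u / sqrt 6 - u\<^sup>2 / (6 * sqrt 6) = u / sqrt 6 * (1 - u / 6)"
    by (simp add: power2_eq_square field_simps)
  also have "\<dots> \<le> 0"
  proof (cases "u = 0")
    case False
    then show ?thesis using True assms by (intro mult_nonneg_nonpos divide_nonneg_nonneg) auto
  qed simp
  finally show ?thesis
    by (rule order_trans) simp
next
  case False
  then have u: "0 < u" "u \<le> 6" using assms by auto
  have "6 powr (- 1 / 2) \<le> (6::real) powr (p / 2 - 1)"
    using assms by (intro powr_mono) auto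
  also have "\<dots> \<le> u powr (p / 2 - 1)"
    using u assms by (intro powr_mono2') auto
  finally have "u * 6 powr (- 1 / 2) \<le> u * u powr (p / 2 - 1)"
    using u by (intro mult_left_mono) auto
  moreover have "(6::real) powr (- 1 / 2) = 1 / sqrt 6"
    by (simp add: powr_minus_divide powr_half_sqrt)
  moreover have "u * u powr (p / 2 - 1) = u powr (p / 2)"
    using u by (simp add: powr_diff)
  moreover have "0 \<le> u\<^sup>2 / (6 * sqrt 6)"
    by (rule divide_nonneg_nonneg) simp_all
  ultimately show ?thesis
    by (simp only: mult_1_right times_divide_eq_right)
qed

lemma rademacher_lower_bound:
  fixes v :: "'j \<Rightarrow> 'k \<Rightarrow> complex"
  assumes "finite J" "1 \<le> p" "p \<le> 2"
  shows "2 ^ card J * (\<Sum>j\<in>J. \<Sum>k\<in>K. (norm (v j k))\<^sup>2) powr (p / 2)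
    \<le> 5 * (\<Sum>A\<in>Pow J. (\<Sum>k\<in>K. (norm (rademacher_sum J A (\<lambda>j. v j k)))\<^sup>2) powr (p / 2))"
proof -
  define q where "q A = (\<Sum>k\<in>K. (norm (rademacher_sum J A (\<lambda>j. v j k)))\<^sup>2)" for A
  define s where "s = (\<Sum>j\<in>J. \<Sum>k\<in>K. (norm (v j k))\<^sup>2)"
  have q: "0 \<le> q A" for A by (simp add: q_def sum_nonneg)
  have "0 \<le> s" by (simp add: s_def sum_nonneg)
  have second: "(\<Sum>A\<in>Pow J. q A) = 2 ^ card J * s"
    unfolding q_def s_def using assms
    by (subst sum.swap) (simp add: rademacher_second_moment flip: sum_distrib_left, subst sum.swap, simp)
  have fourth: "(\<Sum>A\<in>Pow J. (q A)\<^sup>2) \<le> 3 * 2 ^ card J * s\<^sup>2"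
    unfolding q_def s_def by (rule rademacher_fourth_moment) fact
  show ?thesis
  proof (cases "s = 0")
    case False
    then have "0 < s" using \<open>0 \<le> s\<close> by simp
    have "2 * sqrt 6 \<le> sqrt (5\<^sup>2)"
      by (rule real_le_rsqrt) (simp add: power_mult_distrib)
    then have root: "2 * sqrt 6 \<le> (5::real)" by simp
    have "2 ^ card J / (2 * sqrt 6) = (2 ^ card J * s / s) / sqrt 6 - 3 * 2 ^ card J * s\<^sup>2 / s\<^sup>2 / (6 * sqrt 6)"
      using \<open>0 < s\<close> by (simp add: field_simps)
    also have "\<dots> \<le> (\<Sum>A\<in>Pow J. q A) / s / sqrt 6 - (\<Sum>A\<in>Pow J. (q A)\<^sup>2) / s\<^sup>2 / (6 * sqrt 6)"
      using \<open>0 < s\<close> fourth second by (intro diff_mono divide_right_mono) auto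
    also have "\<dots> = (\<Sum>A\<in>Pow J. (q A / s) / sqrt 6 - (q A / s)\<^sup>2 / (6 * sqrt 6))"
      by (simp add: sum_subtractf power_divide flip: sum_divide_distrib)
    also have "\<dots> \<le> (\<Sum>A\<in>Pow J. (q A / s) powr (p / 2))"
      using assms q \<open>0 < s\<close> by (intro sum_mono powr_ge_quadratic) auto
    also have "\<dots> = (\<Sum>A\<in>Pow J. q A powr (p / 2)) / s powr (p / 2)"
      using q \<open>0 < s\<close> by (simp add: powr_divide sum_divide_distrib)
    finally have "2 ^ card J * s powr (p / 2) \<le> 2 * sqrt 6 * (\<Sum>A\<in>Pow J. q A powr (p / 2))"
      using \<open>0 < s\<close> by (simp add: field_simps)
    also have "\<dots> \<le> 5 * (\<Sum>A\<in>Pow J. q A powr (p / 2))"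
      using root by (intro mult_right_mono sum_nonneg) auto
    finally show ?thesis
      by (simp add: q_def s_def)
  qed (auto simp: s_def intro!: sum_nonneg)
qed

text \<open>Chebyshev's inequality with the fourth moment: the part of a random sum above a large level is
  small in the mean square.\<close>

lemma rademacher_tail:
  fixes a :: "'j \<Rightarrow> complex"
  assumes "finite J" "0 < T"
  defines "s \<equiv> \<Sum>j\<in>J. (norm (a j))\<^sup>2"
  shows "(\<Sum>A\<in>Pow J. if (norm (rademacher_sum J A a))\<^sup>2 \<le> T * s then 0 else (norm (rademacher_sum J A a))\<^sup>2)
    \<le> 2 ^ card J * (3 / T * s)"
proof (cases "s = 0")
  case True
  then have "\<forall>j\<in>J. a j = 0"
    using assms by (simp add: sum_nonneg_eq_0_iff)
  then have "rademacher_sum J A a = 0" for A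
    by (simp add: rademacher_sum_def)
  then show ?thesis using True by simp
next
  case False
  then have "0 < s"
    by (simp add: s_def sum_nonneg order_less_le)
  define x where "x A = (norm (rademacher_sum J A a))\<^sup>2" for A
  have "(if x A \<le> T * s then 0 else x A) \<le> (x A)\<^sup>2 / (T * s)" for A
  proof (cases "x A \<le> T * s")
    case False
    then have "x A * (T * s) \<le> x A * x A"
      by (intro mult_left_mono) (auto simp: x_def)
    then show ?thesis
      using False \<open>0 < s\<close> \<open>0 < T\<close> by (simp add: pos_le_divide_eq power2_eq_square)
  qed (use \<open>0 < s\<close> \<open>0 < T\<close> in simp)
  then have "(\<Sum>A\<in>Pow J. if x A \<le> T * s then 0 else x A) \<le> (\<Sum>A\<in>Pow J. (x A)\<^sup>2) / (T * s)"
    unfolding sum_divide_distrib by (rule sum_mono)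
  also have "\<dots> \<le> 3 * 2 ^ card J * s\<^sup>2 / (T * s)"
    using rademacher_fourth_moment[OF assms(1), where K = "{()}" and v = "\<lambda>j _. a j"] \<open>0 < s\<close> \<open>0 < T\<close>
    by (intro divide_right_mono) (auto simp: x_def s_def)
  also have "\<dots> = 2 ^ card J * (3 / T * s)"
    using \<open>0 < s\<close> by (simp add: field_simps power2_eq_square)
  finally show ?thesis
    unfolding x_def .
qed

section \<open>Gaussian sums\<close>

abbreviation std_normal :: "real measure" where
  "std_normal \<equiv> density lborel (\<lambda>x. ennreal (std_normal_density x))"

definition gaussian :: "nat \<Rightarrow> (nat \<Rightarrow> real) measure" where
  "gaussian n = PiM {..<n} (\<lambda>_. std_normal)"

definition gaussian_moment :: "real \<Rightarrow> ennreal" where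
  "gaussian_moment r = (\<integral>\<^sup>+x. ennreal (\<bar>x\<bar> powr r) \<partial>std_normal)"

lemma prob_space_std_normal: "prob_space std_normal"
  by (rule prob_space_normal_density) simp

lemma prob_space_gaussian: "prob_space (gaussian n)"
  unfolding gaussian_def by (intro prob_space_PiM prob_space_std_normal)

lemma measurable_gaussian_component:
  "j < n \<Longrightarrow> (\<lambda>\<omega>. \<omega> j) \<in> borel_measurable (gaussian n)"
proof -
  assume "j < n"
  then have "(\<lambda>\<omega>. \<omega> j) \<in> measurable (gaussian n) std_normal"
    unfolding gaussian_def by (intro measurable_component_singleton) auto
  then show ?thesis by simp
qed

lemma distributed_gaussian_component:
  assumes "j < n"
  shows "distributed (gaussian n) lborel (\<lambda>\<omega>. \<omega> j) std_normal_density"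
proof -
  have "distr (gaussian n) lborel (\<lambda>\<omega>. \<omega> j) = distr (gaussian n) std_normal (\<lambda>\<omega>. \<omega> j)"
    by (rule distr_cong) auto
  also have "\<dots> = std_normal"
    unfolding gaussian_def
    by (rule distr_PiM_component) (use assms prob_space_std_normal in auto)
  finally show ?thesis
    using assms by (simp add: distributed_def measurable_gaussian_component)
qed

lemma measurable_gaussian_sum [measurable]:
  fixes a :: "nat \<Rightarrow> 'b::{real_normed_field, second_countable_topology}"
  shows "(\<lambda>\<omega>. \<Sum>j<n. of_real (\<omega> j) * a j) \<in> borel_measurable (gaussian n)"
proof (rule borel_measurable_sum)
  fix j assume "j \<in> {..<n}"
  then have [measurable]: "(\<lambda>\<omega>. \<omega> j) \<in> borel_measurable (gaussian n)"
    by (intro measurable_gaussian_component) simp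
  show "(\<lambda>\<omega>. of_real (\<omega> j) * a j) \<in> borel_measurable (gaussian n)"
    by measurable
qed

lemma indep_vars_gaussian:
  assumes "0 < n"
  shows "prob_space.indep_vars (gaussian n) (\<lambda>_. borel) (\<lambda>j \<omega>. \<omega> j) {..<n}"
proof -
  interpret prob_space "gaussian n" by (rule prob_space_gaussian)
  have "distr (gaussian n) (PiM {..<n} (\<lambda>_. borel)) (\<lambda>\<omega>. \<lambda>j\<in>{..<n}. \<omega> j)
      = distr (gaussian n) (gaussian n) (\<lambda>\<omega>. \<omega>)"
  proof (rule distr_cong)
    show "sets (PiM {..<n} (\<lambda>_. borel)) = sets (gaussian n)"
      unfolding gaussian_def by (rule sets_PiM_cong) auto
    show "(\<lambda>j\<in>{..<n}. \<omega> j) = \<omega>" if "\<omega> \<in> space (gaussian n)" for \<omega>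
      using that by (auto simp: gaussian_def space_PiM PiE_def extensional_restrict)
  qed simp
  also have "\<dots> = gaussian n" by (rule distr_id)
  also have "\<dots> = PiM {..<n} (\<lambda>j. distr (gaussian n) borel (\<lambda>\<omega>. \<omega> j))"
    unfolding gaussian_def[of n]
  proof (rule PiM_cong, simp)
    fix j assume "j \<in> {..<n}"
    then have "distr (gaussian n) lborel (\<lambda>\<omega>. \<omega> j) = std_normal"
      using distributed_gaussian_component[of j n] by (simp add: distributed_def)
    moreover have "distr (gaussian n) borel (\<lambda>\<omega>. \<omega> j) = distr (gaussian n) lborel (\<lambda>\<omega>. \<omega> j)"
      by (rule distr_cong) auto
    ultimately show "std_normal = distr (PiM {..<n} (\<lambda>_. std_normal)) borel (\<lambda>\<omega>. \<omega> j)"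
      by (simp add: gaussian_def)
  qed
  finally show ?thesis
    using assms by (subst indep_vars_iff_distr_eq_PiM') (auto intro: measurable_gaussian_component)
qed

text \<open>
  By rotation invariance all moments of a Gaussian sum depend on its coefficients only through
  their Euclidean norm. Unlike for random signs, the constant is the same in both directions.
\<close>

lemma gaussian_sum_moment:
  fixes b :: "nat \<Rightarrow> real"
  assumes "0 < r"
  shows "(\<integral>\<^sup>+\<omega>. ennreal (\<bar>\<Sum>j<n. \<omega> j * b j\<bar> powr r) \<partial>gaussian n)
    = gaussian_moment r * ennreal ((\<Sum>j<n. (b j)\<^sup>2) powr (r / 2))"
proof -
  interpret prob_space "gaussian n" by (rule prob_space_gaussian)
  define I where "I = {j\<in>{..<n}. b j \<noteq> 0}"
  have sum_I: "(\<Sum>j<n. \<omega> j * b j) = (\<Sum>j\<in>I. b j * \<omega> j)" for \<omega> :: "nat \<Rightarrow> real"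
    unfolding I_def by (rule sum.mono_neutral_cong_right) auto
  have sum_I2: "(\<Sum>j<n. (b j)\<^sup>2) = (\<Sum>j\<in>I. \<bar>b j\<bar>\<^sup>2)"
    unfolding I_def by (rule sum.mono_neutral_cong_right) auto
  show ?thesis
  proof (cases "I = {}")
    case True
    then show ?thesis
      using sum_I2 by (simp add: sum_I)
  next
    case False
    then have "0 < n" by (auto simp: I_def)
    define \<sigma> where "\<sigma> = sqrt (\<Sum>j\<in>I. \<bar>b j\<bar>\<^sup>2)"
    have "0 < (\<Sum>j\<in>I. \<bar>b j\<bar>\<^sup>2)"
      using False by (intro sum_pos) (auto simp: I_def)
    then have "0 < \<sigma>" by (simp add: \<sigma>_def)
    have "indep_vars (\<lambda>_. borel) (\<lambda>j \<omega>. \<omega> j) I"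
      using indep_vars_gaussian[OF \<open>0 < n\<close>] by (rule indep_vars_subset) (auto simp: I_def)
    then have "indep_vars (\<lambda>_. borel) (\<lambda>j \<omega>. b j * \<omega> j) I"
      by (rule indep_vars_compose2[where Y = "\<lambda>j x. b j * x"]) simp
    moreover have "distributed (gaussian n) lborel (\<lambda>\<omega>. b j * \<omega> j) (normal_density 0 \<bar>b j\<bar>)"
      if "j \<in> I" for j
      using that normal_density_affine[OF distributed_gaussian_component[of j n], of "b j" 0]
      by (simp add: I_def)
    ultimately have "distributed (gaussian n) lborel (\<lambda>\<omega>. \<Sum>j\<in>I. b j * \<omega> j)
        (normal_density (\<Sum>j\<in>I. 0) \<sigma>)"
      unfolding \<sigma>_def using False by (intro sum_indep_normal) (auto simp: I_def)
    then have "distributed (gaussian n) lborel (\<lambda>\<omega>. ((\<Sum>j\<in>I. b j * \<omega> j) - 0) / \<sigma>) std_normal_density"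
      using \<open>0 < \<sigma>\<close> by (subst (asm) normal_standard_normal_convert) auto
    then have "(\<integral>\<^sup>+x. ennreal (std_normal_density x) * ennreal (\<bar>x\<bar> powr r) \<partial>lborel)
        = (\<integral>\<^sup>+\<omega>. ennreal (\<bar>((\<Sum>j\<in>I. b j * \<omega> j) - 0) / \<sigma>\<bar> powr r) \<partial>gaussian n)"
      by (rule distributed_nn_integral) simp
    then have "gaussian_moment r = (\<integral>\<^sup>+\<omega>. ennreal (\<bar>(\<Sum>j\<in>I. b j * \<omega> j) / \<sigma>\<bar> powr r) \<partial>gaussian n)"
      by (simp add: gaussian_moment_def nn_integral_density)
    then have "gaussian_moment r * ennreal (\<sigma> powr r)
        = (\<integral>\<^sup>+\<omega>. ennreal (\<bar>(\<Sum>j\<in>I. b j * \<omega> j) / \<sigma>\<bar> powr r) * ennreal (\<sigma> powr r) \<partial>gaussian n)"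
      using measurable_gaussian_sum[where n = n and a = b] by (subst nn_integral_multc) (simp_all flip: sum_I)
    also have "\<dots> = (\<integral>\<^sup>+\<omega>. ennreal (\<bar>\<Sum>j\<in>I. b j * \<omega> j\<bar> powr r) \<partial>gaussian n)"
      using \<open>0 < \<sigma>\<close> by (simp add: powr_divide flip: ennreal_mult)
    also have "\<sigma> powr r = (\<Sum>j\<in>I. \<bar>b j\<bar>\<^sup>2) powr (r / 2)"
      by (simp add: \<sigma>_def powr_half_sqrt[symmetric] sum_nonneg powr_powr)
    finally show ?thesis
      by (simp add: sum_I sum_I2)
  qed
qed

lemma gaussian_moment_finite:
  assumes "0 < r"
  shows "gaussian_moment r < top"
proof -
  define m where "m = nat \<lceil>r\<rceil>"
  have "\<bar>x\<bar> powr r \<le> 1 + \<bar>x\<bar> ^ m" for x :: real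
  proof (cases "\<bar>x\<bar> \<le> 1")
    case True
    then have "\<bar>x\<bar> powr r \<le> 1" using assms by (auto intro: powr_le1)
    then show ?thesis by (simp add: add_increasing2)
  next
    case False
    have "r \<le> real m" unfolding m_def by linarith
    then have "\<bar>x\<bar> powr r \<le> \<bar>x\<bar> powr real m" using False by (intro powr_mono) auto
    then show ?thesis using False by (simp add: powr_realpow)
  qed
  then have "ennreal (std_normal_density x) * ennreal (\<bar>x\<bar> powr r)
      \<le> ennreal (std_normal_density x * \<bar>x\<bar> ^ 0 + std_normal_density x * \<bar>x\<bar> ^ m)" for x
    using mult_left_mono[of "\<bar>x\<bar> powr r" "1 + \<bar>x\<bar> ^ m" "std_normal_density x"]
    by (subst ennreal_mult[symmetric]) (auto intro!: ennreal_leI simp: distrib_left simp del: ennreal_plus)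
  then have "gaussian_moment r
      \<le> (\<integral>\<^sup>+x. ennreal (std_normal_density x * \<bar>x\<bar> ^ 0 + std_normal_density x * \<bar>x\<bar> ^ m) \<partial>lborel)"
    unfolding gaussian_moment_def by (subst nn_integral_density) (auto intro: nn_integral_mono)
  also have "\<dots> < top"
    using Bochner_Integration.integrable_add[OF integrable_std_normal_moment_abs[of 0] integrable_std_normal_moment_abs[of m]]
    by (subst nn_integral_eq_integral) auto
  finally show ?thesis .
qed

lemma gaussian_moment_2: "gaussian_moment 2 = 1"
proof -
  have "gaussian_moment 2 = (\<integral>\<^sup>+x. ennreal (std_normal_density x * x ^ (2 * 1)) \<partial>lborel)"
    unfolding gaussian_moment_def
    by (subst nn_integral_density) (auto simp flip: ennreal_mult intro!: nn_integral_cong)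
  also have "\<dots> = ennreal 1"
    using has_bochner_integral_integral_eq[OF std_normal_moment_even[of 1]] integrable_std_normal_moment[of 2]
    by (subst nn_integral_eq_integral) auto
  finally show ?thesis by simp
qed

lemma gaussian_moment_ge_1:
  assumes "2 \<le> r"
  shows "1 \<le> gaussian_moment r"
proof -
  interpret prob_space std_normal by (rule prob_space_std_normal)
  have "ennpow (\<integral>\<^sup>+x. ennreal (\<bar>x\<bar> powr 2) \<partial>std_normal) (r / 2)
      \<le> (\<integral>\<^sup>+x. ennpow (ennreal (\<bar>x\<bar> powr 2)) (r / 2) \<partial>std_normal)"
    using assms by (intro jensen_ennpow) auto
  then show ?thesis
    using gaussian_moment_2 by (simp add: gaussian_moment_def ennpow_ennreal powr_powr del: powr_numeral)
qed

text \<open>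
  Minkowski's inequality in \<open>L\<^sub>r\<close>, \<open>r \<ge> 1\<close>, for functions with norms at most \<open>\<gamma>\<^bsup>1/r\<^esup> s i\<close>:
  this is Jensen's inequality for the weights \<open>s i / \<Sum>s\<close>.
\<close>

lemma minkowski_suminf:
  fixes u :: "nat \<Rightarrow> 'a \<Rightarrow> ennreal" and s :: "nat \<Rightarrow> ennreal"
  assumes [measurable]: "\<And>i. u i \<in> borel_measurable M"
    and bound: "\<And>i. (\<integral>\<^sup>+x. ennpow (u i x) r \<partial>M) \<le> \<gamma> * ennpow (s i) r"
    and "1 \<le> r" "\<gamma> \<noteq> 0"
  shows "(\<integral>\<^sup>+x. ennpow (\<Sum>i. u i x) r \<partial>M) \<le> \<gamma> * ennpow (\<Sum>i. s i) r"
proof (cases "(\<Sum>i. s i) = top")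
  case True
  then show ?thesis using \<open>\<gamma> \<noteq> 0\<close> by (simp add: ennreal_mult_top)
next
  case False
  define S where "S = (\<Sum>i. s i)"
  have s_le: "s i \<le> S" for i
    using sum_le_suminf[of s "{i}"] by (simp add: S_def)
  then have s_top: "s i < top" for i
    using False by (metis S_def le_less_trans less_top)
  have "AE x in M. u i x = 0" if "s i = 0" for i
  proof -
    have "(\<integral>\<^sup>+x. ennpow (u i x) r \<partial>M) = 0"
      using bound[of i] that by simp
    then have "AE x in M. ennpow (u i x) r = 0"
      by (subst (asm) nn_integral_0_iff_AE) auto
    moreover have "y = 0" if "ennpow y r = 0" for y
      using that ennpow_le_iff[of r y 0] \<open>1 \<le> r\<close> by simp
    ultimately show ?thesis by auto
  qed
  then have zero: "AE x in M. \<forall>i. s i = 0 \<longrightarrow> u i x = 0"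
    by (simp add: AE_all_countable)
  show ?thesis
  proof (cases "S = 0")
    case True
    then have "s i = 0" for i using s_le[of i] by simp
    then have "(\<integral>\<^sup>+x. ennpow (\<Sum>i. u i x) r \<partial>M) = (\<integral>\<^sup>+x. 0 \<partial>M)"
      using zero by (intro nn_integral_cong_AE) auto
    then show ?thesis by simp
  next
    case S0: False
    have inv: "inverse S * S = 1"
      using ennreal_divide_self[of S] S0 False
      by (simp add: S_def[symmetric] less_top divide_ennreal_def mult.commute)
    have "ennpow (\<Sum>i. u i x) r \<le> (\<Sum>i. s i * inverse S * ennpow (u i x * S * inverse (s i)) r)"
      if "\<forall>i. s i = 0 \<longrightarrow> u i x = 0" for x
    proof -
      have "u i x = s i * inverse S * (u i x * S * inverse (s i))" for i
      proof (cases "s i = 0")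
        case False
        then have "s i * inverse (s i) = 1"
          using s_top[of i] ennreal_divide_self[of "s i"] by (simp add: divide_ennreal_def)
        then show ?thesis
          using inv by (simp add: ac_simps) (metis mult.assoc mult.commute mult_1)
      qed (use that in simp)
      then have "(\<Sum>i. u i x) = (\<Sum>i. s i * inverse S * (u i x * S * inverse (s i)))"
        by (intro suminf_cong) 
      moreover have "(\<Sum>i. s i * inverse S) = 1"
        using inv by (simp add: S_def[symmetric] mult.commute)
      ultimately show ?thesis
        using jensen_suminf[of "\<lambda>i. s i * inverse S" r "\<lambda>i. u i x * S * inverse (s i)"] \<open>1 \<le> r\<close>
        by simp
    qed
    then have "(\<integral>\<^sup>+x. ennpow (\<Sum>i. u i x) r \<partial>M)
        \<le> (\<integral>\<^sup>+x. (\<Sum>i. s i * inverse S * ennpow (u i x * S * inverse (s i)) r) \<partial>M)"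
      using zero by (intro nn_integral_mono_AE) auto
    also have "\<dots> = (\<Sum>i. s i * inverse S * ((\<integral>\<^sup>+x. ennpow (u i x) r \<partial>M) * ennpow S r * ennpow (inverse (s i)) r))"
      using \<open>1 \<le> r\<close> by (simp add: nn_integral_suminf nn_integral_cmult nn_integral_multc ennpow_mult)
    also have "\<dots> \<le> (\<Sum>i. s i * inverse S * (\<gamma> * ennpow S r))"
    proof (intro suminf_le summableI)
      fix i
      show "s i * inverse S * ((\<integral>\<^sup>+x. ennpow (u i x) r \<partial>M) * ennpow S r * ennpow (inverse (s i)) r)
          \<le> s i * inverse S * (\<gamma> * ennpow S r)"
      proof (cases "s i = 0")
        case False
        have "(\<integral>\<^sup>+x. ennpow (u i x) r \<partial>M) * ennpow S r * ennpow (inverse (s i)) r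
            \<le> \<gamma> * ennpow (s i) r * ennpow S r * ennpow (inverse (s i)) r"
          by (intro mult_right_mono bound) auto
        also have "\<dots> = \<gamma> * ennpow S r * ennpow (s i * inverse (s i)) r"
          using \<open>1 \<le> r\<close> by (simp add: ennpow_mult ac_simps)
        also have "s i * inverse (s i) = 1"
          using False s_top[of i] ennreal_divide_self[of "s i"] by (simp add: divide_ennreal_def)
        finally show ?thesis
          by (intro mult_left_mono) auto
      qed simp
    qed
    also have "\<dots> = \<gamma> * ennpow S r"
      using inv by (simp add: S_def[symmetric] mult.commute)
    finally show ?thesis
      by (simp add: S_def)
  qed
qed

text \<open>
  Real Gaussian variables with complex coefficients. The upper bound is Minkowski's inequality in
  \<open>L\<^bsub>p/2\<^esub>\<close> for the squares of the real and the imaginary part. For the lower bound, the larger one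
  of the two parts suffices: it carries at least half of \<open>s\<close>, whence the factor \<open>2\<^bsup>p/2\<^esup>\<close>.
\<close>

lemma gaussian_complex_moments:
  fixes a :: "nat \<Rightarrow> complex" and n :: nat
  assumes "2 \<le> p"
  defines "X \<equiv> \<lambda>\<omega>. \<Sum>j<n. of_real (\<omega> j) * a j"
    and "s \<equiv> \<Sum>j<n. ennreal ((norm (a j))\<^sup>2)"
  shows "(\<integral>\<^sup>+\<omega>. ennpow (ennreal ((norm (X \<omega>))\<^sup>2)) (p / 2) \<partial>gaussian n)
      \<le> gaussian_moment p * ennpow s (p / 2)" (is ?upper)
    and "gaussian_moment p * ennpow s (p / 2)
      \<le> ennreal (2 powr (p / 2)) * (\<integral>\<^sup>+\<omega>. ennpow (ennreal ((norm (X \<omega>))\<^sup>2)) (p / 2) \<partial>gaussian n)" (is ?lower)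
    and "(\<integral>\<^sup>+\<omega>. ennreal ((norm (X \<omega>))\<^sup>2) \<partial>gaussian n) = s" (is ?second)
proof -
  define re where "re = (\<Sum>j<n. (Re (a j))\<^sup>2)"
  define im where "im = (\<Sum>j<n. (Im (a j))\<^sup>2)"
  have nonneg: "0 \<le> re" "0 \<le> im"
    by (simp_all add: re_def im_def sum_nonneg)
  have s: "s = ennreal re + ennreal im"
    unfolding s_def re_def im_def cmod_power2
    by (simp add: sum_nonneg sum.distrib)
  have ReX: "Re (X \<omega>) = (\<Sum>j<n. \<omega> j * Re (a j))" and ImX: "Im (X \<omega>) = (\<Sum>j<n. \<omega> j * Im (a j))" for \<omega>
    by (simp_all add: X_def)
  have normX: "ennreal ((norm (X \<omega>))\<^sup>2) = ennreal ((Re (X \<omega>))\<^sup>2) + ennreal ((Im (X \<omega>))\<^sup>2)" for \<omega>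
    unfolding cmod_power2 by (rule ennreal_plus) simp_all
  have pow: "ennpow (ennreal (x\<^sup>2)) (r / 2) = ennreal (\<bar>x\<bar> powr r)" for x r :: real
  proof -
    have "(x\<^sup>2) powr (r / 2) = (\<bar>x\<bar> powr 2) powr (r / 2)"
      by simp
    also have "\<dots> = \<bar>x\<bar> powr r"
      unfolding powr_powr by simp
    finally show ?thesis
      by (simp add: ennpow_ennreal)
  qed
  have [measurable]: "(\<lambda>\<omega>. Re (X \<omega>)) \<in> borel_measurable (gaussian n)"
    "(\<lambda>\<omega>. Im (X \<omega>)) \<in> borel_measurable (gaussian n)"
    unfolding X_def by measurable
  have Re_moment: "(\<integral>\<^sup>+\<omega>. ennpow (ennreal ((Re (X \<omega>))\<^sup>2)) (r / 2) \<partial>gaussian n)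
      = gaussian_moment r * ennpow (ennreal re) (r / 2)" if "0 < r" for r
    using gaussian_sum_moment[OF that, where b = "\<lambda>j. Re (a j)" and n = n] nonneg
    unfolding pow ReX re_def[symmetric] by (simp only: ennpow_ennreal)
  have Im_moment: "(\<integral>\<^sup>+\<omega>. ennpow (ennreal ((Im (X \<omega>))\<^sup>2)) (r / 2) \<partial>gaussian n)
      = gaussian_moment r * ennpow (ennreal im) (r / 2)" if "0 < r" for r
    using gaussian_sum_moment[OF that, where b = "\<lambda>j. Im (a j)" and n = n] nonneg
    unfolding pow ImX im_def[symmetric] by (simp only: ennpow_ennreal)
  show ?second
    using Re_moment[of 2] Im_moment[of 2]
    by (simp add: normX nn_integral_add s gaussian_moment_2)
  show ?upper
  proof -
    define u where "u i \<omega> = (if i = 0 then ennreal ((Re (X \<omega>))\<^sup>2) else if i = Suc 0 then ennreal ((Im (X \<omega>))\<^sup>2) else 0)"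
      for i :: nat and \<omega>
    define t where "t i = (if i = 0 then ennreal re else if i = Suc 0 then ennreal im else 0)" for i :: nat
    have "(\<integral>\<^sup>+\<omega>. ennpow (\<Sum>i. u i \<omega>) (p / 2) \<partial>gaussian n) \<le> gaussian_moment p * ennpow (\<Sum>i. t i) (p / 2)"
    proof (rule minkowski_suminf)
      show "u i \<in> borel_measurable (gaussian n)" for i
        unfolding u_def by (cases "i = 0"; cases "i = Suc 0") simp_all
      show "(\<integral>\<^sup>+\<omega>. ennpow (u i \<omega>) (p / 2) \<partial>gaussian n) \<le> gaussian_moment p * ennpow (t i) (p / 2)" for i
        unfolding u_def t_def using Re_moment[of p] Im_moment[of p] assms by simp
      show "gaussian_moment p \<noteq> 0"
        using gaussian_moment_ge_1[OF assms(1)] by auto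
    qed (use assms in simp)
    moreover have "(\<Sum>i. u i \<omega>) = ennreal ((norm (X \<omega>))\<^sup>2)" for \<omega>
      using suminf_finite[of "{0, Suc 0}" "\<lambda>i. u i \<omega>"] by (simp add: u_def normX)
    moreover have "(\<Sum>i. t i) = s"
    proof -
      have "suminf t = sum t {0, Suc 0}"
        by (rule suminf_finite) (auto simp: t_def)
      also have "\<dots> = s"
        by (simp add: t_def s)
      finally show ?thesis .
    qed
    ultimately show ?thesis by simp
  qed
  show ?lower
  proof -
    have part: "gaussian_moment p * ennpow (max (ennreal re) (ennreal im)) (p / 2)
        \<le> (\<integral>\<^sup>+\<omega>. ennpow (ennreal ((norm (X \<omega>))\<^sup>2)) (p / 2) \<partial>gaussian n)"
    proof (cases "re \<le> im")
      case True
      then have "gaussian_moment p * ennpow (max (ennreal re) (ennreal im)) (p / 2)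
          = (\<integral>\<^sup>+\<omega>. ennpow (ennreal ((Im (X \<omega>))\<^sup>2)) (p / 2) \<partial>gaussian n)"
        using Im_moment[of p] assms(1) nonneg by (simp add: max_def)
      also have "\<dots> \<le> (\<integral>\<^sup>+\<omega>. ennpow (ennreal ((norm (X \<omega>))\<^sup>2)) (p / 2) \<partial>gaussian n)"
        unfolding normX using assms(1) by (intro nn_integral_mono ennpow_mono) simp_all
      finally show ?thesis .
    next
      case False
      then have "gaussian_moment p * ennpow (max (ennreal re) (ennreal im)) (p / 2)
          = (\<integral>\<^sup>+\<omega>. ennpow (ennreal ((Re (X \<omega>))\<^sup>2)) (p / 2) \<partial>gaussian n)"
        using Re_moment[of p] assms(1) nonneg by (simp add: max_def)
      also have "\<dots> \<le> (\<integral>\<^sup>+\<omega>. ennpow (ennreal ((norm (X \<omega>))\<^sup>2)) (p / 2) \<partial>gaussian n)"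
        unfolding normX using assms(1) by (intro nn_integral_mono ennpow_mono) simp_all
      finally show ?thesis .
    qed
    have split: "ennpow s (p / 2) \<le> ennreal (2 powr (p / 2)) * ennpow (max (ennreal re) (ennreal im)) (p / 2)"
    proof -
      have "s \<le> ennreal 2 * max (ennreal re) (ennreal im)"
        unfolding s by (simp add: mult_2 add_mono)
      then have "ennpow s (p / 2) \<le> ennpow (ennreal 2 * max (ennreal re) (ennreal im)) (p / 2)"
        using assms(1) by (intro ennpow_mono) auto
      then show ?thesis
        using assms(1) ennpow_ennreal[of 2 "p / 2"] by (simp add: ennpow_mult)
    qed
    have "gaussian_moment p * ennpow s (p / 2)
        \<le> gaussian_moment p * (ennreal (2 powr (p / 2)) * ennpow (max (ennreal re) (ennreal im)) (p / 2))"
      by (rule mult_left_mono[OF split]) simp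
    also have "\<dots> = ennreal (2 powr (p / 2)) * (gaussian_moment p * ennpow (max (ennreal re) (ennreal im)) (p / 2))"
      by (rule mult.left_commute)
    also have "\<dots> \<le> ennreal (2 powr (p / 2)) * (\<integral>\<^sup>+\<omega>. ennpow (ennreal ((norm (X \<omega>))\<^sup>2)) (p / 2) \<partial>gaussian n)"
      by (rule mult_left_mono[OF part]) simp
    finally show ?thesis .
  qed
qed

lemma gaussian_square_function_upper:
  fixes v :: "nat \<Rightarrow> nat \<Rightarrow> complex"
  assumes "2 \<le> p"
  shows "(\<integral>\<^sup>+\<omega>. ennpow (\<Sum>k. ennreal ((norm (\<Sum>j<n. of_real (\<omega> j) * v j k))\<^sup>2)) (p / 2) \<partial>gaussian n)
    \<le> gaussian_moment p * ennpow (\<Sum>j<n. \<Sum>k. ennreal ((norm (v j k))\<^sup>2)) (p / 2)"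
proof -
  have "(\<integral>\<^sup>+\<omega>. ennpow (\<Sum>k. ennreal ((norm (\<Sum>j<n. of_real (\<omega> j) * v j k))\<^sup>2)) (p / 2) \<partial>gaussian n)
    \<le> gaussian_moment p * ennpow (\<Sum>k. \<Sum>j<n. ennreal ((norm (v j k))\<^sup>2)) (p / 2)"
  proof (rule minkowski_suminf)
    show "gaussian_moment p \<noteq> 0"
      using gaussian_moment_ge_1[OF assms] by auto
    show "(\<lambda>\<omega>. ennreal ((norm (\<Sum>j<n. of_real (\<omega> j) * v j k))\<^sup>2)) \<in> borel_measurable (gaussian n)" for k
      by measurable
    show "(\<integral>\<^sup>+\<omega>. ennpow (ennreal ((norm (\<Sum>j<n. of_real (\<omega> j) * v j k))\<^sup>2)) (p / 2) \<partial>gaussian n)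
        \<le> gaussian_moment p * ennpow (\<Sum>j<n. ennreal ((norm (v j k))\<^sup>2)) (p / 2)" for k
      by (rule gaussian_complex_moments(1)[OF assms])
  qed (use assms in simp)
  also have "(\<Sum>k. \<Sum>j<n. ennreal ((norm (v j k))\<^sup>2)) = (\<Sum>j<n. \<Sum>k. ennreal ((norm (v j k))\<^sup>2))"
    by (rule suminf_sum) simp
  finally show ?thesis .
qed

lemma gaussian_square_function_lower:
  fixes v :: "nat \<Rightarrow> nat \<Rightarrow> complex"
  assumes "2 \<le> p"
  shows "ennpow (\<Sum>j<n. \<Sum>k. ennreal ((norm (v j k))\<^sup>2)) (p / 2)
    \<le> (\<integral>\<^sup>+\<omega>. ennpow (\<Sum>k. ennreal ((norm (\<Sum>j<n. of_real (\<omega> j) * v j k))\<^sup>2)) (p / 2) \<partial>gaussian n)"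
proof -
  interpret prob_space "gaussian n" by (rule prob_space_gaussian)
  have "(\<Sum>j<n. \<Sum>k. ennreal ((norm (v j k))\<^sup>2)) = (\<Sum>k. \<Sum>j<n. ennreal ((norm (v j k))\<^sup>2))"
    by (rule suminf_sum[symmetric]) simp
  also have "\<dots> = (\<integral>\<^sup>+\<omega>. (\<Sum>k. ennreal ((norm (\<Sum>j<n. of_real (\<omega> j) * v j k))\<^sup>2)) \<partial>gaussian n)"
    by (subst nn_integral_suminf, measurable) (simp only: gaussian_complex_moments(3)[OF order_refl])
  finally show ?thesis
    using assms by (simp only:) (rule jensen_ennpow; measurable; simp)
qed

section \<open>Hilbert space valued extensions of square function inequalities\<close>

abbreviation sq :: "complex \<Rightarrow> ennreal" where
  "sq z \<equiv> ennreal ((norm z)\<^sup>2)"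

lemma sq_mult: "sq (a * b) = sq a * sq b"
  by (simp add: norm_mult power_mult_distrib ennreal_mult)

lemma ennpow_sq: "ennpow (sq z) (p / 2) = ennpow (ennreal (norm z)) p"
proof -
  have "(norm z)\<^sup>2 powr (p / 2) = (norm z powr 2) powr (p / 2)"
    by simp
  also have "\<dots> = norm z powr p"
    unfolding powr_powr by simp
  finally show ?thesis
    by (simp add: ennpow_ennreal)
qed

lemma sq_add_le: "sq (a + b) \<le> 2 * sq a + 2 * sq b"
proof -
  have "(norm (a + b))\<^sup>2 \<le> (norm (a - b))\<^sup>2 + (norm (a + b))\<^sup>2"
    by simp
  also have "\<dots> = 2 * (norm a)\<^sup>2 + 2 * (norm b)\<^sup>2"
    unfolding norm_add_diff_squares by (rule distrib_left)
  finally have "(norm (a + b))\<^sup>2 \<le> 2 * (norm a)\<^sup>2 + 2 * (norm b)\<^sup>2" .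
  then have "sq (a + b) \<le> ennreal (2 * (norm a)\<^sup>2 + 2 * (norm b)\<^sup>2)"
    by (rule ennreal_leI)
  also have "\<dots> = 2 * sq a + 2 * sq b"
    by (simp add: ennreal_mult)
  finally show ?thesis .
qed

subsection \<open>The space \<open>L\<^sub>p\<close>\<close>

lemma Lp_space_iff:
  assumes "0 < p"
  shows "f \<in> Lp_space M p \<longleftrightarrow> f \<in> borel_measurable M \<and> (\<integral>\<^sup>+x. ennpow (sq (f x)) (p / 2) \<partial>M) < top"
  by (simp add: Lp_space_def Lp_norm_def ennpow_le_top_iff ennpow_sq)

lemma Lp_space_measurable: "f \<in> Lp_space M p \<Longrightarrow> f \<in> borel_measurable M"
  by (simp add: Lp_space_def)

lemma Lp_space_dominated:
  assumes "g \<in> borel_measurable M" "f \<in> Lp_space M p" "\<And>x. norm (g x) \<le> norm (f x)" "0 < p"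
  shows "g \<in> Lp_space M p"
proof -
  have "(\<integral>\<^sup>+x. ennpow (sq (g x)) (p / 2) \<partial>M) \<le> (\<integral>\<^sup>+x. ennpow (sq (f x)) (p / 2) \<partial>M)"
    using assms by (intro nn_integral_mono ennpow_mono ennreal_leI power_mono) auto
  also have "\<dots> < top"
    using assms by (simp add: Lp_space_iff)
  finally show ?thesis
    using assms by (simp add: Lp_space_iff)
qed

lemma Lp_space_cmult:
  assumes "f \<in> Lp_space M p" "0 < p"
  shows "(\<lambda>x. c * f x) \<in> Lp_space M p"
proof -
  have [measurable]: "f \<in> borel_measurable M"
    using assms by (simp add: Lp_space_def)
  have "(\<integral>\<^sup>+x. ennpow (sq (c * f x)) (p / 2) \<partial>M) = ennpow (sq c) (p / 2) * (\<integral>\<^sup>+x. ennpow (sq (f x)) (p / 2) \<partial>M)"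
    using assms by (simp add: sq_mult ennpow_mult nn_integral_cmult del: ennreal_power)
  also have "\<dots> < top"
    using assms by (simp add: Lp_space_iff ennreal_mult_less_top ennpow_le_top_iff)
  finally show ?thesis
    using assms by (simp add: Lp_space_iff)
qed

lemma Lp_space_add:
  assumes "f \<in> Lp_space M p" "g \<in> Lp_space M p" "1 \<le> p"
  shows "(\<lambda>x. f x + g x) \<in> Lp_space M p"
proof -
  have [measurable]: "f \<in> borel_measurable M" "g \<in> borel_measurable M"
    using assms by (simp_all add: Lp_space_def)
  have "(\<integral>\<^sup>+x. ennpow (sq (f x + g x)) (p / 2) \<partial>M)
      \<le> (\<integral>\<^sup>+x. ennreal (2 powr (p - 1)) * (ennpow (sq (f x)) (p / 2) + ennpow (sq (g x)) (p / 2)) \<partial>M)"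
  proof (rule nn_integral_mono)
    fix x
    have "ennpow (ennreal (norm (f x + g x))) p \<le> ennpow (ennreal (norm (f x)) + ennreal (norm (g x))) p"
      using assms norm_triangle_ineq[of "f x" "g x"]
      by (intro ennpow_mono) (auto intro: ennreal_leI simp flip: ennreal_plus)
    also have "\<dots> \<le> ennreal (2 powr (p - 1)) * (ennpow (ennreal (norm (f x))) p + ennpow (ennreal (norm (g x))) p)"
      using assms by (intro ennpow_add_le)
    finally show "ennpow (sq (f x + g x)) (p / 2)
        \<le> ennreal (2 powr (p - 1)) * (ennpow (sq (f x)) (p / 2) + ennpow (sq (g x)) (p / 2))"
      by (simp only: ennpow_sq)
  qed
  also have "\<dots> = ennreal (2 powr (p - 1)) * ((\<integral>\<^sup>+x. ennpow (sq (f x)) (p / 2) \<partial>M) + (\<integral>\<^sup>+x. ennpow (sq (g x)) (p / 2) \<partial>M))"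
    by (simp add: nn_integral_cmult nn_integral_add)
  also have "\<dots> < top"
    using assms by (simp add: Lp_space_iff ennreal_mult_less_top)
  finally show ?thesis
    using assms by (simp add: Lp_space_iff)
qed

lemma Lp_space_zero: "0 < p \<Longrightarrow> (\<lambda>x. 0) \<in> Lp_space M p"
  by (simp add: Lp_space_iff)

lemma Lp_space_lincomb:
  assumes "finite J" "\<And>j. j \<in> J \<Longrightarrow> f j \<in> Lp_space M p" "1 \<le> p"
  shows "(\<lambda>x. \<Sum>j\<in>J. c j * f j x) \<in> Lp_space M p"
  using assms by (induction J rule: finite_induct) (simp_all add: Lp_space_zero Lp_space_cmult Lp_space_add)

lemma ennpow_suminf_SUP:
  assumes "0 < a"
  shows "ennpow (\<Sum>k. f k) a = (SUP m. ennpow (\<Sum>k<m. f k) a)"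
  using assms by (simp add: suminf_eq_SUP ennpow_SUP)

lemma nn_integral_ennpow_suminf:
  fixes a :: "nat \<Rightarrow> 'a \<Rightarrow> ennreal"
  assumes [measurable]: "\<And>j. a j \<in> borel_measurable M" and "0 < r"
  shows "(\<integral>\<^sup>+x. ennpow (\<Sum>j. a j x) r \<partial>M) = (SUP n. \<integral>\<^sup>+x. ennpow (\<Sum>j<n. a j x) r \<partial>M)"
  unfolding ennpow_suminf_SUP[OF \<open>0 < r\<close>]
proof (rule nn_integral_monotone_convergence_SUP)
  show "incseq (\<lambda>n x. ennpow (\<Sum>j<n. a j x) r)"
    using \<open>0 < r\<close> by (auto simp: incseq_def le_fun_def intro!: ennpow_mono sum_mono2)
qed measurable

text \<open>An inequality for all finite families extends to countable ones by monotone convergence.\<close>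

lemma suminf_family_bound:
  fixes a b :: "nat \<Rightarrow> 'a \<Rightarrow> ennreal"
  assumes "\<And>j. a j \<in> borel_measurable M" "\<And>j. b j \<in> borel_measurable M" "0 < r"
    and "\<And>n. (\<integral>\<^sup>+x. ennpow (\<Sum>j<n. a j x) r \<partial>M) \<le> K * (\<integral>\<^sup>+x. ennpow (\<Sum>j<n. b j x) r \<partial>M)"
  shows "(\<integral>\<^sup>+x. ennpow (\<Sum>j. a j x) r \<partial>M) \<le> K * (\<integral>\<^sup>+x. ennpow (\<Sum>j. b j x) r \<partial>M)"
  unfolding nn_integral_ennpow_suminf[OF assms(1,3)] nn_integral_ennpow_suminf[OF assms(2,3)]
  by (rule SUP_least) (rule order_trans[OF assms(4) mult_left_mono], auto intro: SUP_upper)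

subsection \<open>Random signs in extended form\<close>

lemma sq_rademacher_mean:
  assumes "finite J"
  shows "(\<Sum>A\<in>Pow J. ennreal (1 / 2 ^ card J) * sq (rademacher_sum J A v)) = (\<Sum>j\<in>J. sq (v j))"
proof -
  have "(\<Sum>A\<in>Pow J. ennreal (1 / 2 ^ card J) * sq (rademacher_sum J A v))
      = ennreal (1 / 2 ^ card J * (\<Sum>A\<in>Pow J. (norm (rademacher_sum J A v))\<^sup>2))"
    by (simp add: sum_distrib_left sum_ennreal flip: ennreal_mult)
  also have "\<dots> = (\<Sum>j\<in>J. sq (v j))"
    using assms by (simp add: rademacher_second_moment)
  finally show ?thesis .
qed

lemma rademacher_weights:
  assumes "finite J"
  shows "(\<Sum>A\<in>Pow J. ennreal (1 / 2 ^ card J)) = 1"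
proof -
  have "(\<Sum>A\<in>Pow J. ennreal (1 / 2 ^ card J)) = ennreal (\<Sum>A\<in>Pow J. 1 / 2 ^ card J)"
    by (rule sum_ennreal) simp
  also have "\<dots> = 1"
    using assms by (simp add: card_Pow)
  finally show ?thesis .
qed

lemma rademacher_lower_bound_ennreal:
  fixes v :: "'j \<Rightarrow> 'k \<Rightarrow> complex"
  assumes "finite J" "1 \<le> p" "p \<le> 2"
  shows "ennpow (\<Sum>j\<in>J. \<Sum>k\<in>K. sq (v j k)) (p / 2)
    \<le> 5 * (\<Sum>A\<in>Pow J. ennreal (1 / 2 ^ card J) * ennpow (\<Sum>k\<in>K. sq (rademacher_sum J A (\<lambda>j. v j k))) (p / 2))"
proof -
  have "ennpow (\<Sum>j\<in>J. \<Sum>k\<in>K. sq (v j k)) (p / 2) = ennreal ((\<Sum>j\<in>J. \<Sum>k\<in>K. (norm (v j k))\<^sup>2) powr (p / 2))"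
    by (simp add: sum_nonneg ennpow_ennreal)
  also have "\<dots> \<le> ennreal (5 * (\<Sum>A\<in>Pow J. 1 / 2 ^ card J *
      (\<Sum>k\<in>K. (norm (rademacher_sum J A (\<lambda>j. v j k)))\<^sup>2) powr (p / 2)))"
    using rademacher_lower_bound[OF assms, where K = K and v = v]
    by (intro ennreal_leI) (simp add: field_simps flip: sum_divide_distrib)
  also have "\<dots> = 5 * (\<Sum>A\<in>Pow J. ennreal (1 / 2 ^ card J) * ennpow (\<Sum>k\<in>K. sq (rademacher_sum J A (\<lambda>j. v j k))) (p / 2))"
  proof -
    have "ennreal (1 / 2 ^ card J * (\<Sum>k\<in>K. (norm (rademacher_sum J A (\<lambda>j. v j k)))\<^sup>2) powr (p / 2))
        = ennreal (1 / 2 ^ card J) * ennpow (\<Sum>k\<in>K. sq (rademacher_sum J A (\<lambda>j. v j k))) (p / 2)" for A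
      by (subst ennreal_mult) (simp_all add: sum_nonneg ennpow_ennreal)
    then show ?thesis
      by (subst ennreal_mult) (simp_all add: sum_nonneg flip: sum_ennreal)
  qed
  finally show ?thesis .
qed

text \<open>
  The lower bound passes to series in \<open>k\<close> since its constant does not depend on the number of terms.
\<close>

lemma rademacher_square_function_lower:
  fixes v :: "'j \<Rightarrow> nat \<Rightarrow> complex"
  assumes "finite J" "1 \<le> p" "p \<le> 2"
  shows "ennpow (\<Sum>j\<in>J. \<Sum>k. sq (v j k)) (p / 2)
    \<le> 5 * (\<Sum>A\<in>Pow J. ennreal (1 / 2 ^ card J) * ennpow (\<Sum>k. sq (rademacher_sum J A (\<lambda>j. v j k))) (p / 2))"
    (is "_ \<le> ?R")
proof -
  have "(\<Sum>j\<in>J. \<Sum>k. sq (v j k)) = (\<Sum>k. \<Sum>j\<in>J. sq (v j k))"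
    by (rule suminf_sum[symmetric]) simp
  moreover have "ennpow (\<Sum>k<m. \<Sum>j\<in>J. sq (v j k)) (p / 2) \<le> ?R" for m
  proof -
    have "ennpow (\<Sum>k<m. \<Sum>j\<in>J. sq (v j k)) (p / 2)
        \<le> 5 * (\<Sum>A\<in>Pow J. ennreal (1 / 2 ^ card J) * ennpow (\<Sum>k<m. sq (rademacher_sum J A (\<lambda>j. v j k))) (p / 2))"
      using rademacher_lower_bound_ennreal[OF assms, where K = "{..<m}" and v = v] by (subst sum.swap)
    also have "\<dots> \<le> ?R"
      using assms by (intro mult_left_mono sum_mono ennpow_mono sum_le_suminf) auto
    finally show ?thesis .
  qed
  ultimately show ?thesis
    using assms by (simp add: ennpow_suminf_SUP SUP_least)
qed

lemma rademacher_square_function_upper: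
  fixes v :: "'j \<Rightarrow> nat \<Rightarrow> complex"
  assumes "finite J" "0 < p" "p \<le> 2"
  shows "(\<Sum>A\<in>Pow J. ennreal (1 / 2 ^ card J) * ennpow (\<Sum>k. sq (rademacher_sum J A (\<lambda>j. v j k))) (p / 2))
    \<le> ennpow (\<Sum>j\<in>J. \<Sum>k. sq (v j k)) (p / 2)"
proof -
  have "(\<Sum>A\<in>Pow J. ennreal (1 / 2 ^ card J) * (\<Sum>k. sq (rademacher_sum J A (\<lambda>j. v j k))))
      = (\<Sum>k. \<Sum>A\<in>Pow J. ennreal (1 / 2 ^ card J) * sq (rademacher_sum J A (\<lambda>j. v j k)))"
    by (simp add: suminf_sum flip: ennreal_suminf_cmult)
  also have "\<dots> = (\<Sum>j\<in>J. \<Sum>k. sq (v j k))"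
    unfolding sq_rademacher_mean[OF assms(1)] by (rule suminf_sum) simp
  finally have mean: "(\<Sum>A\<in>Pow J. ennreal (1 / 2 ^ card J) * (\<Sum>k. sq (rademacher_sum J A (\<lambda>j. v j k))))
      = (\<Sum>j\<in>J. \<Sum>k. sq (v j k))" .
  show ?thesis
    unfolding mean[symmetric]
    by (rule jensen_sum_concave[OF _ rademacher_weights]) (use assms in auto)
qed

subsection \<open>The extension theorem\<close>

text \<open>
  Linearity is required on \<open>L\<^sub>p\<close> only: the integral of a function that is not integrable is \<open>0\<close> by
  convention, so that Fourier coefficients are not linear on arbitrary functions.
\<close>

locale lp_operator_sequence =
  sigma_finite_measure M for M :: "'a measure" +
  fixes p :: real and P :: "nat \<Rightarrow> ('a \<Rightarrow> complex) \<Rightarrow> 'a \<Rightarrow> complex"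
  assumes p_gt_1: "1 < p"
    and operator_measurable [measurable]: "\<And>k f. f \<in> Lp_space M p \<Longrightarrow> P k f \<in> borel_measurable M"
    and operator_lincomb: "\<And>k J c f x. finite J \<Longrightarrow> (\<And>j::nat. j \<in> J \<Longrightarrow> f j \<in> Lp_space M p) \<Longrightarrow>
      P k (\<lambda>x. \<Sum>j\<in>J. c j * f j x) x = (\<Sum>j\<in>J. c j * P k (f j) x)"
begin

definition square_sum :: "('a \<Rightarrow> complex) \<Rightarrow> 'a \<Rightarrow> ennreal" where
  "square_sum f x = (\<Sum>k. sq (P k f x))"

lemma square_sum_measurable [measurable]:
  "f \<in> Lp_space M p \<Longrightarrow> square_sum f \<in> borel_measurable M"
  unfolding square_sum_def by measurable

lemma operator_rademacher_sum:
  fixes f :: "nat \<Rightarrow> 'a \<Rightarrow> complex"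
  assumes "\<And>j. f j \<in> Lp_space M p"
  shows "P k (\<lambda>x. rademacher_sum {..<n} A (\<lambda>j. f j x)) y = rademacher_sum {..<n} A (\<lambda>j. P k (f j) y)"
  unfolding rademacher_sum_def by (rule operator_lincomb) (use assms in auto)

lemma rademacher_sum_Lp:
  fixes f :: "nat \<Rightarrow> 'a \<Rightarrow> complex"
  assumes "\<And>j. f j \<in> Lp_space M p"
  shows "(\<lambda>x. rademacher_sum {..<n} A (\<lambda>j. f j x)) \<in> Lp_space M p"
  unfolding rademacher_sum_def by (rule Lp_space_lincomb) (use assms p_gt_1 in auto)

text \<open>
  For \<open>p \<le> 2\<close> random signs control the \<open>\<ell>\<^sub>2\<close>-norm in \<open>L\<^sub>p\<close> from both sides with absolute constants,
  also for vector valued coefficients, so that both inequalities extend in the same way.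
\<close>

lemma finite_extension_le_2:
  fixes f :: "nat \<Rightarrow> 'a \<Rightarrow> complex"
  assumes bound: "\<And>f. f \<in> Lp_space M p \<Longrightarrow>
      (\<integral>\<^sup>+x. ennpow (square_sum f x) (p / 2) \<partial>M) \<le> l * (\<integral>\<^sup>+x. ennpow (sq (f x)) (p / 2) \<partial>M)"
    and f: "\<And>j. f j \<in> Lp_space M p" and "p \<le> 2"
  shows "(\<integral>\<^sup>+x. ennpow (\<Sum>j<n. square_sum (f j) x) (p / 2) \<partial>M)
    \<le> 5 * l * (\<integral>\<^sup>+x. ennpow (\<Sum>j<n. sq (f j x)) (p / 2) \<partial>M)"
proof -
  define w where "w = ennreal (1 / 2 ^ card {..<n})"
  define F where "F A x = rademacher_sum {..<n} A (\<lambda>j. f j x)" for A x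
  have F: "F A \<in> Lp_space M p" for A
    unfolding F_def by (rule rademacher_sum_Lp[OF f])
  note [measurable] = Lp_space_measurable[OF F] Lp_space_measurable[OF f] square_sum_measurable[OF F]
  have "ennpow (\<Sum>j<n. square_sum (f j) x) (p / 2) \<le> 5 * (\<Sum>A\<in>Pow {..<n}. w * ennpow (square_sum (F A) x) (p / 2))" for x
    unfolding square_sum_def w_def F_def operator_rademacher_sum[OF f]
    by (rule rademacher_square_function_lower) (use p_gt_1 \<open>p \<le> 2\<close> in auto)
  then have "(\<integral>\<^sup>+x. ennpow (\<Sum>j<n. square_sum (f j) x) (p / 2) \<partial>M)
      \<le> (\<integral>\<^sup>+x. 5 * (\<Sum>A\<in>Pow {..<n}. w * ennpow (square_sum (F A) x) (p / 2)) \<partial>M)"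
    by (intro nn_integral_mono)
  also have "\<dots> = 5 * (\<Sum>A\<in>Pow {..<n}. w * (\<integral>\<^sup>+x. ennpow (square_sum (F A) x) (p / 2) \<partial>M))"
    by (simp add: nn_integral_cmult nn_integral_sum)
  also have "\<dots> \<le> 5 * (\<Sum>A\<in>Pow {..<n}. w * (l * (\<integral>\<^sup>+x. ennpow (sq (F A x)) (p / 2) \<partial>M)))"
    by (intro mult_left_mono sum_mono bound F) auto
  also have "\<dots> = 5 * l * (\<integral>\<^sup>+x. (\<Sum>A\<in>Pow {..<n}. w * ennpow (sq (F A x)) (p / 2)) \<partial>M)"
    by (simp add: nn_integral_cmult nn_integral_sum sum_distrib_left ac_simps)
  also have "\<dots> \<le> 5 * l * (\<integral>\<^sup>+x. ennpow (\<Sum>j<n. sq (f j x)) (p / 2) \<partial>M)"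
  proof (intro mult_left_mono nn_integral_mono)
    fix x
    have "(\<Sum>A\<in>Pow {..<n}. w * ennpow (sq (F A x)) (p / 2)) \<le> ennpow (\<Sum>A\<in>Pow {..<n}. w * sq (F A x)) (p / 2)"
      unfolding w_def
      by (rule jensen_sum_concave[OF _ rademacher_weights]) (use p_gt_1 \<open>p \<le> 2\<close> in auto)
    also have "(\<Sum>A\<in>Pow {..<n}. w * sq (F A x)) = (\<Sum>j<n. sq (f j x))"
      unfolding w_def F_def by (rule sq_rademacher_mean) simp
    finally show "(\<Sum>A\<in>Pow {..<n}. w * ennpow (sq (F A x)) (p / 2)) \<le> ennpow (\<Sum>j<n. sq (f j x)) (p / 2)" .
  qed simp
  finally show ?thesis .
qed

lemma finite_reverse_extension_le_2:
  fixes f :: "nat \<Rightarrow> 'a \<Rightarrow> complex"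
  assumes bound: "\<And>f. f \<in> Lp_space M p \<Longrightarrow>
      (\<integral>\<^sup>+x. ennpow (sq (f x)) (p / 2) \<partial>M) \<le> l * (\<integral>\<^sup>+x. ennpow (square_sum f x) (p / 2) \<partial>M)"
    and f: "\<And>j. f j \<in> Lp_space M p" and "p \<le> 2"
  shows "(\<integral>\<^sup>+x. ennpow (\<Sum>j<n. sq (f j x)) (p / 2) \<partial>M)
    \<le> 5 * l * (\<integral>\<^sup>+x. ennpow (\<Sum>j<n. square_sum (f j) x) (p / 2) \<partial>M)"
proof -
  define w where "w = ennreal (1 / 2 ^ card {..<n})"
  define F where "F A x = rademacher_sum {..<n} A (\<lambda>j. f j x)" for A x
  have F: "F A \<in> Lp_space M p" for A
    unfolding F_def by (rule rademacher_sum_Lp[OF f])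
  note [measurable] = Lp_space_measurable[OF F] Lp_space_measurable[OF f] square_sum_measurable[OF F]
  have "ennpow (\<Sum>j<n. sq (f j x)) (p / 2) \<le> 5 * (\<Sum>A\<in>Pow {..<n}. w * ennpow (sq (F A x)) (p / 2))" for x
    using rademacher_lower_bound_ennreal[where J = "{..<n}" and K = "{()}" and v = "\<lambda>j _. f j x" and p = p] p_gt_1 \<open>p \<le> 2\<close>
    unfolding w_def F_def by simp
  then have "(\<integral>\<^sup>+x. ennpow (\<Sum>j<n. sq (f j x)) (p / 2) \<partial>M)
      \<le> (\<integral>\<^sup>+x. 5 * (\<Sum>A\<in>Pow {..<n}. w * ennpow (sq (F A x)) (p / 2)) \<partial>M)"
    by (intro nn_integral_mono)
  also have "\<dots> = 5 * (\<Sum>A\<in>Pow {..<n}. w * (\<integral>\<^sup>+x. ennpow (sq (F A x)) (p / 2) \<partial>M))"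
    by (simp add: nn_integral_cmult nn_integral_sum)
  also have "\<dots> \<le> 5 * (\<Sum>A\<in>Pow {..<n}. w * (l * (\<integral>\<^sup>+x. ennpow (square_sum (F A) x) (p / 2) \<partial>M)))"
    by (intro mult_left_mono sum_mono bound F) auto
  also have "\<dots> = 5 * l * (\<integral>\<^sup>+x. (\<Sum>A\<in>Pow {..<n}. w * ennpow (square_sum (F A) x) (p / 2)) \<partial>M)"
    by (simp add: nn_integral_cmult nn_integral_sum sum_distrib_left ac_simps)
  also have "\<dots> \<le> 5 * l * (\<integral>\<^sup>+x. ennpow (\<Sum>j<n. square_sum (f j) x) (p / 2) \<partial>M)"
    unfolding square_sum_def w_def F_def operator_rademacher_sum[OF f]
    by (intro mult_left_mono nn_integral_mono rademacher_square_function_upper) (use p_gt_1 \<open>p \<le> 2\<close> in auto)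
  finally show ?thesis .
qed

lemma gaussian_sum_Lp:
  fixes f :: "nat \<Rightarrow> 'a \<Rightarrow> complex"
  assumes "\<And>j. f j \<in> Lp_space M p"
  shows "(\<lambda>x. \<Sum>j<n. of_real (\<omega> j) * f j x) \<in> Lp_space M p"
  by (rule Lp_space_lincomb) (use assms p_gt_1 in auto)

lemma operator_gaussian_sum:
  fixes f :: "nat \<Rightarrow> 'a \<Rightarrow> complex"
  assumes "\<And>j. f j \<in> Lp_space M p"
  shows "P k (\<lambda>x. \<Sum>j<n. of_real (\<omega> j) * f j x) y = (\<Sum>j<n. of_real (\<omega> j) * P k (f j) y)"
  by (rule operator_lincomb) (use assms in auto)

lemma measurable_gaussian_combination:
  fixes g :: "nat \<Rightarrow> 'a \<Rightarrow> complex"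
  assumes [measurable]: "\<And>j. g j \<in> borel_measurable M"
  shows "(\<lambda>(x, \<omega>). \<Sum>j<n. complex_of_real (\<omega> j) * g j x) \<in> borel_measurable (M \<Otimes>\<^sub>M gaussian n)"
  unfolding split_beta'
proof (rule borel_measurable_sum)
  fix j assume "j \<in> {..<n}"
  then have [measurable]: "(\<lambda>\<omega>. \<omega> j) \<in> borel_measurable (gaussian n)"
    by (intro measurable_gaussian_component) simp
  show "(\<lambda>z. complex_of_real (snd z j) * g j (fst z)) \<in> borel_measurable (M \<Otimes>\<^sub>M gaussian n)"
    by measurable
qed

lemma measurable_gaussian_combination':
  fixes g :: "nat \<Rightarrow> 'a \<Rightarrow> complex"
  assumes "\<And>j. g j \<in> borel_measurable M"
  shows "(\<lambda>(\<omega>, x). \<Sum>j<n. complex_of_real (\<omega> j) * g j x) \<in> borel_measurable (gaussian n \<Otimes>\<^sub>M M)"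
  using measurable_pair_swap[OF measurable_gaussian_combination[OF assms]] by simp

lemma gaussian_Fubini:
  fixes f :: "nat \<Rightarrow> 'a \<Rightarrow> complex"
  assumes f: "\<And>j. f j \<in> Lp_space M p"
  shows "(\<integral>\<^sup>+x. \<integral>\<^sup>+\<omega>. ennpow (sq (\<Sum>j<n. of_real (\<omega> j) * f j x)) (p / 2) \<partial>gaussian n \<partial>M)
      = (\<integral>\<^sup>+\<omega>. \<integral>\<^sup>+x. ennpow (sq (\<Sum>j<n. of_real (\<omega> j) * f j x)) (p / 2) \<partial>M \<partial>gaussian n)"
    and "(\<integral>\<^sup>+x. \<integral>\<^sup>+\<omega>. ennpow (\<Sum>k. sq (\<Sum>j<n. of_real (\<omega> j) * P k (f j) x)) (p / 2) \<partial>gaussian n \<partial>M)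
      = (\<integral>\<^sup>+\<omega>. \<integral>\<^sup>+x. ennpow (square_sum (\<lambda>x. \<Sum>j<n. of_real (\<omega> j) * f j x) x) (p / 2) \<partial>M \<partial>gaussian n)"
proof -
  interpret gaussian: prob_space "gaussian n" by (rule prob_space_gaussian)
  interpret pair_sigma_finite M "gaussian n" ..
  note [measurable] = measurable_gaussian_combination[OF Lp_space_measurable[OF f]]
    measurable_gaussian_combination[OF operator_measurable[OF f]]
  show "(\<integral>\<^sup>+x. \<integral>\<^sup>+\<omega>. ennpow (sq (\<Sum>j<n. of_real (\<omega> j) * f j x)) (p / 2) \<partial>gaussian n \<partial>M)
      = (\<integral>\<^sup>+\<omega>. \<integral>\<^sup>+x. ennpow (sq (\<Sum>j<n. of_real (\<omega> j) * f j x)) (p / 2) \<partial>M \<partial>gaussian n)"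
    by (rule Fubini'[symmetric]) measurable
  show "(\<integral>\<^sup>+x. \<integral>\<^sup>+\<omega>. ennpow (\<Sum>k. sq (\<Sum>j<n. of_real (\<omega> j) * P k (f j) x)) (p / 2) \<partial>gaussian n \<partial>M)
      = (\<integral>\<^sup>+\<omega>. \<integral>\<^sup>+x. ennpow (square_sum (\<lambda>x. \<Sum>j<n. of_real (\<omega> j) * f j x) x) (p / 2) \<partial>M \<partial>gaussian n)"
    unfolding square_sum_def operator_gaussian_sum[OF f]
    by (rule Fubini'[symmetric]) measurable
qed

text \<open>
  For \<open>p \<ge> 2\<close> the reverse inequality extends by Gaussian sums. The moment \<open>gaussian_moment p\<close> is
  unbounded in \<open>p\<close>, but it appears on both sides and cancels: on the left the functions are scalar
  valued and the moment is exact up to the factor \<open>2\<^bsup>p/2\<^esup>\<close>, on the right only the upper estimate is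
  required.
\<close>

lemma finite_reverse_extension_ge_2:
  fixes f :: "nat \<Rightarrow> 'a \<Rightarrow> complex"
  assumes bound: "\<And>f. f \<in> Lp_space M p \<Longrightarrow>
      (\<integral>\<^sup>+x. ennpow (sq (f x)) (p / 2) \<partial>M) \<le> l * (\<integral>\<^sup>+x. ennpow (square_sum f x) (p / 2) \<partial>M)"
    and f: "\<And>j. f j \<in> Lp_space M p" and "2 \<le> p"
  shows "(\<integral>\<^sup>+x. ennpow (\<Sum>j<n. sq (f j x)) (p / 2) \<partial>M)
    \<le> ennreal (2 powr (p / 2)) * l * (\<integral>\<^sup>+x. ennpow (\<Sum>j<n. square_sum (f j) x) (p / 2) \<partial>M)"
proof -
  interpret gaussian: prob_space "gaussian n" by (rule prob_space_gaussian)
  note [measurable] = measurable_gaussian_combination[OF Lp_space_measurable[OF f]]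
    measurable_gaussian_combination'[OF operator_measurable[OF f]]
    Lp_space_measurable[OF f] square_sum_measurable[OF f] operator_measurable[OF f]
  define \<gamma> where "\<gamma> = gaussian_moment p"
  define c where "c = ennreal (2 powr (p / 2))"
  have \<gamma>: "\<gamma> \<noteq> 0" "\<gamma> < top"
    using gaussian_moment_ge_1[OF \<open>2 \<le> p\<close>] gaussian_moment_finite[of p] p_gt_1 by (auto simp: \<gamma>_def)
  have "\<gamma> * (\<integral>\<^sup>+x. ennpow (\<Sum>j<n. sq (f j x)) (p / 2) \<partial>M)
      = (\<integral>\<^sup>+x. \<gamma> * ennpow (\<Sum>j<n. sq (f j x)) (p / 2) \<partial>M)"
    by (rule nn_integral_cmult[symmetric]) measurable
  also have "\<dots> \<le> (\<integral>\<^sup>+x. c * (\<integral>\<^sup>+\<omega>. ennpow (sq (\<Sum>j<n. of_real (\<omega> j) * f j x)) (p / 2) \<partial>gaussian n) \<partial>M)"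
    unfolding \<gamma>_def c_def by (intro nn_integral_mono gaussian_complex_moments(2) \<open>2 \<le> p\<close>)
  also have "\<dots> = c * (\<integral>\<^sup>+x. \<integral>\<^sup>+\<omega>. ennpow (sq (\<Sum>j<n. of_real (\<omega> j) * f j x)) (p / 2) \<partial>gaussian n \<partial>M)"
    by (rule nn_integral_cmult) measurable
  also have "\<dots> \<le> c * (\<integral>\<^sup>+\<omega>. l * (\<integral>\<^sup>+x. ennpow (square_sum (\<lambda>x. \<Sum>j<n. of_real (\<omega> j) * f j x) x) (p / 2) \<partial>M) \<partial>gaussian n)"
    unfolding gaussian_Fubini(1)[OF f] by (intro mult_left_mono nn_integral_mono bound gaussian_sum_Lp f) simp
  also have "\<dots> = c * (l * (\<integral>\<^sup>+\<omega>. \<integral>\<^sup>+x. ennpow (square_sum (\<lambda>x. \<Sum>j<n. of_real (\<omega> j) * f j x) x) (p / 2) \<partial>M \<partial>gaussian n))"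
    unfolding square_sum_def operator_gaussian_sum[OF f]
    by (intro arg_cong[where f = "(*) c"] nn_integral_cmult) measurable
  also have "\<dots> = c * (l * (\<integral>\<^sup>+x. \<integral>\<^sup>+\<omega>. ennpow (\<Sum>k. sq (\<Sum>j<n. of_real (\<omega> j) * P k (f j) x)) (p / 2) \<partial>gaussian n \<partial>M))"
    unfolding gaussian_Fubini(2)[OF f] ..
  also have "\<dots> \<le> c * (l * (\<integral>\<^sup>+x. \<gamma> * ennpow (\<Sum>j<n. square_sum (f j) x) (p / 2) \<partial>M))"
    unfolding \<gamma>_def square_sum_def
    by (intro mult_left_mono nn_integral_mono gaussian_square_function_upper \<open>2 \<le> p\<close>) auto
  also have "\<dots> = c * (l * (\<gamma> * (\<integral>\<^sup>+x. ennpow (\<Sum>j<n. square_sum (f j) x) (p / 2) \<partial>M)))"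
    by (subst nn_integral_cmult) (measurable, rule f, simp)
  also have "\<dots> = \<gamma> * (c * l * (\<integral>\<^sup>+x. ennpow (\<Sum>j<n. square_sum (f j) x) (p / 2) \<partial>M))"
    by (simp only: ac_simps)
  finally show ?thesis
    using \<gamma> ennreal_mult_le_mult_iff[of \<gamma>] by (simp add: c_def)
qed

text \<open>
  For the direct inequality with \<open>p \<ge> 2\<close> Gaussian sums lose their moment. This bound serves only as
  the starting point of an iteration that removes the dependence on \<open>p\<close>.
\<close>

lemma finite_extension_ge_2_crude:
  fixes f :: "nat \<Rightarrow> 'a \<Rightarrow> complex"
  assumes bound: "\<And>f. f \<in> Lp_space M p \<Longrightarrow>
      (\<integral>\<^sup>+x. ennpow (square_sum f x) (p / 2) \<partial>M) \<le> l * (\<integral>\<^sup>+x. ennpow (sq (f x)) (p / 2) \<partial>M)"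
    and f: "\<And>j. f j \<in> Lp_space M p" and "2 \<le> p"
  shows "(\<integral>\<^sup>+x. ennpow (\<Sum>j<n. square_sum (f j) x) (p / 2) \<partial>M)
    \<le> l * gaussian_moment p * (\<integral>\<^sup>+x. ennpow (\<Sum>j<n. sq (f j x)) (p / 2) \<partial>M)"
proof -
  interpret gaussian: prob_space "gaussian n" by (rule prob_space_gaussian)
  note [measurable] = measurable_gaussian_combination[OF Lp_space_measurable[OF f]]
    measurable_gaussian_combination[OF operator_measurable[OF f]]
    Lp_space_measurable[OF f] square_sum_measurable[OF f]
  have "(\<integral>\<^sup>+x. ennpow (\<Sum>j<n. square_sum (f j) x) (p / 2) \<partial>M)
      \<le> (\<integral>\<^sup>+x. \<integral>\<^sup>+\<omega>. ennpow (\<Sum>k. sq (\<Sum>j<n. of_real (\<omega> j) * P k (f j) x)) (p / 2) \<partial>gaussian n \<partial>M)"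
    unfolding square_sum_def by (intro nn_integral_mono gaussian_square_function_lower \<open>2 \<le> p\<close>)
  also have "\<dots> \<le> (\<integral>\<^sup>+\<omega>. l * (\<integral>\<^sup>+x. ennpow (sq (\<Sum>j<n. of_real (\<omega> j) * f j x)) (p / 2) \<partial>M) \<partial>gaussian n)"
    unfolding gaussian_Fubini(2)[OF f] by (intro nn_integral_mono bound gaussian_sum_Lp f)
  also have "\<dots> = l * (\<integral>\<^sup>+x. \<integral>\<^sup>+\<omega>. ennpow (sq (\<Sum>j<n. of_real (\<omega> j) * f j x)) (p / 2) \<partial>gaussian n \<partial>M)"
    unfolding gaussian_Fubini(1)[OF f] by (rule nn_integral_cmult) measurable
  also have "\<dots> \<le> l * (\<integral>\<^sup>+x. gaussian_moment p * ennpow (\<Sum>j<n. sq (f j x)) (p / 2) \<partial>M)"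
    by (intro mult_left_mono nn_integral_mono gaussian_complex_moments(1) \<open>2 \<le> p\<close>) auto
  also have "\<dots> = l * gaussian_moment p * (\<integral>\<^sup>+x. ennpow (\<Sum>j<n. sq (f j x)) (p / 2) \<partial>M)"
    by (subst nn_integral_cmult) (measurable, simp only: ac_simps)
  finally show ?thesis .
qed

end

context lp_operator_sequence
begin

text \<open>
  One step of the iteration. A random sum \<open>F\<close> of the functions is cut at the level \<open>\<surd>48\<close> times the
  \<open>\<ell>\<^sub>2\<close>-norm \<open>\<surd>s\<close> of the family. Below the level \<open>F\<close> is bounded by \<open>\<surd>48 \<surd>s\<close> for every choice
  of signs, so that the scalar inequality applies without any loss from moments. Above the level \<open>F\<close>
  is small in the mean square over the signs; it is again a (larger) finite family, to which the
  bound with constant \<open>\<kappa>\<close> applies. In terms of norms, the first part contributes \<open>2 \<surd>48 < 14\<close> times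
  the scalar constant. The second one has mean square at most \<open>s * 3 / 48 = s / 16\<close> and contributes
  \<open>2 / 4\<close> times the constant of the family.
\<close>

lemma truncation_step:
  fixes f :: "nat \<Rightarrow> 'a \<Rightarrow> complex"
  assumes bound: "\<And>f. f \<in> Lp_space M p \<Longrightarrow>
      (\<integral>\<^sup>+x. ennpow (square_sum f x) (p / 2) \<partial>M) \<le> l * (\<integral>\<^sup>+x. ennpow (sq (f x)) (p / 2) \<partial>M)"
    and family: "\<And>f :: nat \<Rightarrow> 'a \<Rightarrow> complex. \<And>n. (\<And>j. f j \<in> Lp_space M p) \<Longrightarrow>
      (\<integral>\<^sup>+x. ennpow (\<Sum>j<n. square_sum (f j) x) (p / 2) \<partial>M)
        \<le> \<kappa> * (\<integral>\<^sup>+x. ennpow (\<Sum>j<n. sq (f j x)) (p / 2) \<partial>M)"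
    and f: "\<And>j. f j \<in> Lp_space M p" and "2 \<le> p"
  shows "(\<integral>\<^sup>+x. ennpow (\<Sum>j<n. square_sum (f j) x) (p / 2) \<partial>M)
    \<le> (ennreal (14 powr p / 2) * l + ennreal (1 / 2) * \<kappa>) * (\<integral>\<^sup>+x. ennpow (\<Sum>j<n. sq (f j x)) (p / 2) \<partial>M)"
proof -
  define w where "w = ennreal (1 / 2 ^ card {..<n})"
  define s where "s x = (\<Sum>j<n. (norm (f j x))\<^sup>2)" for x
  define F where "F A x = rademacher_sum {..<n} A (\<lambda>j. f j x)" for A x
  define G where "G A x = (if (norm (F A x))\<^sup>2 \<le> 48 * s x then F A x else 0)" for A x
  define H where "H A x = (if (norm (F A x))\<^sup>2 \<le> 48 * s x then 0 else F A x)" for A x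
  define Y where "Y = (\<integral>\<^sup>+x. ennpow (ennreal (s x)) (p / 2) \<partial>M)"
  have s_nonneg: "0 \<le> s x" for x
    by (simp add: s_def sum_nonneg)
  have s_sq: "(\<Sum>j<n. sq (f j x)) = ennreal (s x)" for x
    by (simp add: s_def)
  have F: "F A \<in> Lp_space M p" for A
    unfolding F_def by (rule rademacher_sum_Lp[OF f])
  note [measurable] = Lp_space_measurable[OF F] Lp_space_measurable[OF f]
  have [measurable]: "s \<in> borel_measurable M"
    unfolding s_def by measurable
  have [measurable]: "G A \<in> borel_measurable M" "H A \<in> borel_measurable M" for A
    unfolding G_def H_def by measurable
  have G: "G A \<in> Lp_space M p" for A
    by (rule Lp_space_dominated[OF _ F[of A]]) (use p_gt_1 in \<open>simp_all add: G_def\<close>)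
  have H: "H A \<in> Lp_space M p" for A
    by (rule Lp_space_dominated[OF _ F[of A]]) (use p_gt_1 in \<open>simp_all add: H_def\<close>)
  note [measurable] = square_sum_measurable[OF G] square_sum_measurable[OF H]
  have "P k (F A) x = P k (G A) x + P k (H A) x" for k A x
  proof -
    \<comment> \<open>The decomposition is written as a linear combination of a family indexed by \<open>{0, 1}\<close>.\<close>
    have "F A = (\<lambda>x. \<Sum>j\<in>{0, 1::nat}. 1 * (if j = 0 then G A else H A) x)"
      by (auto simp: fun_eq_iff G_def H_def)
    then have "P k (F A) x = (\<Sum>j\<in>{0, 1::nat}. 1 * P k (if j = 0 then G A else H A) x)"
      by (simp only:) (rule operator_lincomb, use G H in auto)
    then show ?thesis by simp
  qed
  then have "sq (P k (F A) x) \<le> 2 * sq (P k (G A) x) + 2 * sq (P k (H A) x)" for k A x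
    using sq_add_le by metis
  then have split: "square_sum (F A) x \<le> 2 * square_sum (G A) x + 2 * square_sum (H A) x" for A x
    unfolding square_sum_def ennreal_suminf_cmult[symmetric]
    by (subst suminf_add) (auto intro!: suminf_le)
  define a where "a x = (\<Sum>A\<in>Pow {..<n}. w * square_sum (G A) x)" for x
  define b where "b x = (\<Sum>A\<in>Pow {..<n}. w * square_sum (H A) x)" for x
  have [measurable]: "a \<in> borel_measurable M" "b \<in> borel_measurable M"
    unfolding a_def b_def by measurable
  have pointwise: "ennpow (\<Sum>j<n. square_sum (f j) x) (p / 2)
      \<le> ennreal (2 powr (p - 1)) * (ennpow (a x) (p / 2) + ennpow (b x) (p / 2))" for x
  proof -
    have "(\<Sum>j<n. square_sum (f j) x) = (\<Sum>k. \<Sum>j<n. sq (P k (f j) x))"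
      unfolding square_sum_def by (rule suminf_sum[symmetric]) simp
    also have "\<dots> = (\<Sum>k. \<Sum>A\<in>Pow {..<n}. w * sq (P k (F A) x))"
      unfolding w_def F_def operator_rademacher_sum[OF f]
      by (subst sq_rademacher_mean) auto
    also have "\<dots> = (\<Sum>A\<in>Pow {..<n}. w * square_sum (F A) x)"
      unfolding square_sum_def ennreal_suminf_cmult[symmetric] by (rule suminf_sum) simp
    also have "\<dots> \<le> (\<Sum>A\<in>Pow {..<n}. w * (2 * square_sum (G A) x + 2 * square_sum (H A) x))"
      by (intro sum_mono mult_left_mono split) simp
    also have "\<dots> = 2 * (a x + b x)"
      unfolding a_def b_def sum_distrib_left sum.distrib[symmetric]
      by (rule sum.cong) (simp_all add: distrib_left ac_simps)
    finally have "ennpow (\<Sum>j<n. square_sum (f j) x) (p / 2) \<le> ennpow (2 * (a x + b x)) (p / 2)"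
      using \<open>2 \<le> p\<close> by (intro ennpow_mono) auto
    also have "\<dots> = ennreal (2 powr (p / 2)) * ennpow (a x + b x) (p / 2)"
      using \<open>2 \<le> p\<close> ennpow_ennreal[of 2 "p / 2"] by (simp add: ennpow_mult del: distrib_left_numeral)
    also have "\<dots> \<le> ennreal (2 powr (p / 2)) * (ennreal (2 powr (p / 2 - 1)) * (ennpow (a x) (p / 2) + ennpow (b x) (p / 2)))"
      using \<open>2 \<le> p\<close> by (intro mult_left_mono ennpow_add_le) auto
    also have "\<dots> = ennreal (2 powr (p / 2) * 2 powr (p / 2 - 1)) * (ennpow (a x) (p / 2) + ennpow (b x) (p / 2))"
      by (simp only: mult.assoc[symmetric]) (simp add: ennreal_mult)
    also have "(2::real) powr (p / 2) * 2 powr (p / 2 - 1) = 2 powr (p - 1)"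
      by (simp flip: powr_add)
    finally show ?thesis .
  qed
  have lower_part: "(\<integral>\<^sup>+x. ennpow (a x) (p / 2) \<partial>M) \<le> l * (ennreal (48 powr (p / 2)) * Y)"
  proof -
    have "(\<integral>\<^sup>+x. ennpow (a x) (p / 2) \<partial>M) \<le> (\<integral>\<^sup>+x. (\<Sum>A\<in>Pow {..<n}. w * ennpow (square_sum (G A) x) (p / 2)) \<partial>M)"
      unfolding a_def w_def
      by (intro nn_integral_mono jensen_sum rademacher_weights) (use \<open>2 \<le> p\<close> in auto)
    also have "\<dots> = (\<Sum>A\<in>Pow {..<n}. w * (\<integral>\<^sup>+x. ennpow (square_sum (G A) x) (p / 2) \<partial>M))"
      by (simp add: nn_integral_cmult nn_integral_sum)
    also have "\<dots> \<le> (\<Sum>A\<in>Pow {..<n}. w * (l * (\<integral>\<^sup>+x. ennpow (sq (G A x)) (p / 2) \<partial>M)))"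
      by (intro mult_left_mono sum_mono bound G) auto
    also have "\<dots> \<le> (\<Sum>A\<in>Pow {..<n}. w * (l * (\<integral>\<^sup>+x. ennpow (48 * ennreal (s x)) (p / 2) \<partial>M)))"
    proof (intro sum_mono mult_left_mono nn_integral_mono ennpow_mono)
      fix A x
      have "(norm (G A x))\<^sup>2 \<le> 48 * s x"
        using s_nonneg[of x] by (simp add: G_def)
      then have "sq (G A x) \<le> ennreal (48 * s x)"
        by (rule ennreal_leI)
      then show "sq (G A x) \<le> 48 * ennreal (s x)"
        using s_nonneg[of x] by (simp add: ennreal_mult)
    qed (use \<open>2 \<le> p\<close> in auto)
    also have "\<dots> = l * (\<integral>\<^sup>+x. ennpow (48 * ennreal (s x)) (p / 2) \<partial>M)"
      unfolding w_def by (simp only: sum_distrib_right[symmetric] rademacher_weights finite_lessThan mult_1_left)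
    also have "(\<integral>\<^sup>+x. ennpow (48 * ennreal (s x)) (p / 2) \<partial>M) = ennreal (48 powr (p / 2)) * Y"
      using \<open>2 \<le> p\<close> ennpow_ennreal[of 48 "p / 2"] by (simp add: ennpow_mult nn_integral_cmult Y_def)
    finally show ?thesis .
  qed
  have upper_part: "(\<integral>\<^sup>+x. ennpow (b x) (p / 2) \<partial>M) \<le> \<kappa> * (ennreal ((1 / 16) powr (p / 2)) * Y)"
  proof -
    define N where "N = card (Pow {..<n})"
    obtain h where h: "bij_betw h {..<N} (Pow {..<n})"
      unfolding N_def using ex_bij_betw_nat_finite[of "Pow {..<n}"] by (auto simp: atLeast0LessThan)
    \<comment> \<open>The factor \<open>c\<close> makes the sum over the family \<open>c * H A\<close> the mean over the signs.\<close>
    define c where "c = complex_of_real (sqrt (1 / 2 ^ card {..<n}))"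
    have sq_c: "sq c = w"
      by (simp add: c_def w_def del: real_sqrt_divide of_real_divide)
    have cH: "(\<lambda>x. c * H A x) \<in> Lp_space M p" for A
      using H p_gt_1 by (intro Lp_space_cmult) auto
    have "P k (\<lambda>x. c * H A x) x = c * P k (H A) x" for k A x
      using operator_lincomb[of "{0}" "\<lambda>_. H A" k "\<lambda>_. c" x] H by simp
    then have square_sum_cH: "square_sum (\<lambda>x. c * H A x) x = w * square_sum (H A) x" for A x
      unfolding square_sum_def ennreal_suminf_cmult[symmetric] by (simp add: sq_mult sq_c)
    have reindex: "(\<Sum>i<N. \<phi> (h i)) = (\<Sum>A\<in>Pow {..<n}. \<phi> A)" for \<phi> :: "nat set \<Rightarrow> ennreal"
      by (rule sum.reindex_bij_betw[OF h])
    have "(\<integral>\<^sup>+x. ennpow (b x) (p / 2) \<partial>M) = (\<integral>\<^sup>+x. ennpow (\<Sum>i<N. square_sum (\<lambda>x. c * H (h i) x) x) (p / 2) \<partial>M)"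
      unfolding square_sum_cH b_def reindex[of "\<lambda>A. w * square_sum (H A) x" for x] ..
    also have "\<dots> \<le> \<kappa> * (\<integral>\<^sup>+x. ennpow (\<Sum>i<N. sq (c * H (h i) x)) (p / 2) \<partial>M)"
      by (rule family) (rule cH)
    also have "\<dots> = \<kappa> * (\<integral>\<^sup>+x. ennpow (\<Sum>A\<in>Pow {..<n}. w * sq (H A x)) (p / 2) \<partial>M)"
      unfolding sq_mult sq_c reindex[of "\<lambda>A. w * sq (H A x)" for x] ..
    also have "\<dots> \<le> \<kappa> * (\<integral>\<^sup>+x. ennpow (ennreal (1 / 16 * s x)) (p / 2) \<partial>M)"
    proof (intro mult_left_mono nn_integral_mono ennpow_mono)
      fix x
      have "(\<Sum>A\<in>Pow {..<n}. (norm (H A x))\<^sup>2) \<le> 2 ^ card {..<n} * (3 / 48 * s x)"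
        using rademacher_tail[of "{..<n}" 48 "\<lambda>j. f j x"]
        by (simp add: H_def F_def s_def if_distrib[of "\<lambda>z. (norm z)\<^sup>2"] cong: if_cong)
      then have "1 / 2 ^ card {..<n} * (\<Sum>A\<in>Pow {..<n}. (norm (H A x))\<^sup>2) \<le> 1 / 16 * s x"
        by (simp add: field_simps)
      then have "ennreal (1 / 2 ^ card {..<n} * (\<Sum>A\<in>Pow {..<n}. (norm (H A x))\<^sup>2)) \<le> ennreal (1 / 16 * s x)"
        by (rule ennreal_leI)
      also have "ennreal (1 / 2 ^ card {..<n} * (\<Sum>A\<in>Pow {..<n}. (norm (H A x))\<^sup>2)) = (\<Sum>A\<in>Pow {..<n}. w * sq (H A x))"
        by (subst ennreal_mult) (simp_all add: w_def sum_nonneg sum_distrib_left[symmetric])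
      finally show "(\<Sum>A\<in>Pow {..<n}. w * sq (H A x)) \<le> ennreal (1 / 16 * s x)" .
    qed (use \<open>2 \<le> p\<close> in auto)
    also have "(\<integral>\<^sup>+x. ennpow (ennreal (1 / 16 * s x)) (p / 2) \<partial>M) = (\<integral>\<^sup>+x. ennreal ((1 / 16) powr (p / 2)) * ennpow (ennreal (s x)) (p / 2) \<partial>M)"
    proof (intro nn_integral_cong)
      fix x
      have "ennpow (ennreal (1 / 16 * s x)) (p / 2) = ennpow (ennreal (1 / 16)) (p / 2) * ennpow (ennreal (s x)) (p / 2)"
        using s_nonneg \<open>2 \<le> p\<close> by (subst ennreal_mult; (subst ennpow_mult)?) simp_all
      also have "ennpow (ennreal (1 / 16)) (p / 2) = ennreal ((1 / 16) powr (p / 2))"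
        by (rule ennpow_ennreal) simp
      finally show "ennpow (ennreal (1 / 16 * s x)) (p / 2) = ennreal ((1 / 16) powr (p / 2)) * ennpow (ennreal (s x)) (p / 2)" .
    qed
    also have "\<dots> = ennreal ((1 / 16) powr (p / 2)) * Y"
      unfolding Y_def by (rule nn_integral_cmult) measurable
    finally show ?thesis .
  qed
  have constant_a: "2 powr (p - 1) * 48 powr (p / 2) \<le> 14 powr p / (2::real)"
  proof -
    have "2 powr (p - 1) * 48 powr (p / 2) = (4 powr (p / 2) * 48 powr (p / 2)) / (2::real)"
      using powr_powr[of 2 2 "p / 2"] by (simp add: powr_diff)
    also have "4 powr (p / 2) * 48 powr (p / 2) = (192::real) powr (p / 2)"
      by (subst powr_mult[symmetric]) simp_all
    also have "\<dots> \<le> (14 powr 2) powr (p / 2)"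
      using \<open>2 \<le> p\<close> by (intro powr_mono2) auto
    also have "(14 powr 2) powr (p / 2) = (14::real) powr p"
      unfolding powr_powr by simp
    finally show ?thesis by simp
  qed
  have constant_b: "2 powr (p - 1) * (1 / 16) powr (p / 2) \<le> 1 / (2::real)"
  proof -
    have "2 powr (p - 1) * (1 / 16) powr (p / 2) = (4 powr (p / 2) * (1 / 16) powr (p / 2)) / (2::real)"
      using powr_powr[of 2 2 "p / 2"] by (simp add: powr_diff)
    also have "4 powr (p / 2) * (1 / 16) powr (p / 2) = (1 / 4 :: real) powr (p / 2)"
      by (subst powr_mult[symmetric]) auto
    also have "\<dots> \<le> 1"
      using \<open>2 \<le> p\<close> by (intro powr_le1) auto
    finally show ?thesis by simp
  qed
  have "(\<integral>\<^sup>+x. ennpow (\<Sum>j<n. square_sum (f j) x) (p / 2) \<partial>M)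
      \<le> (\<integral>\<^sup>+x. ennreal (2 powr (p - 1)) * (ennpow (a x) (p / 2) + ennpow (b x) (p / 2)) \<partial>M)"
    by (intro nn_integral_mono pointwise)
  also have "\<dots> = ennreal (2 powr (p - 1)) * ((\<integral>\<^sup>+x. ennpow (a x) (p / 2) \<partial>M) + (\<integral>\<^sup>+x. ennpow (b x) (p / 2) \<partial>M))"
    by (simp add: nn_integral_cmult nn_integral_add)
  also have "\<dots> \<le> ennreal (2 powr (p - 1)) * (l * (ennreal (48 powr (p / 2)) * Y) + \<kappa> * (ennreal ((1 / 16) powr (p / 2)) * Y))"
    by (intro mult_left_mono add_mono lower_part upper_part) simp
  also have "\<dots> = (ennreal (2 powr (p - 1) * 48 powr (p / 2)) * l + ennreal (2 powr (p - 1) * (1 / 16) powr (p / 2)) * \<kappa>) * Y"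
    by (simp add: ennreal_mult algebra_simps del: powr_numeral)
  also have "\<dots> \<le> (ennreal (14 powr p / 2) * l + ennreal (1 / 2) * \<kappa>) * Y"
    using constant_a constant_b by (intro mult_right_mono add_mono ennreal_leI) auto
  finally show ?thesis
    by (simp only: Y_def s_sq)
qed

text \<open>
  The map \<open>\<kappa> \<mapsto> 14\<^sup>p l / 2 + \<kappa> / 2\<close> has the fixed point \<open>14\<^sup>p l\<close>, and its iterates converge to it from
  every finite \<open>\<kappa>\<close>. This is the place where \<open>l\<close> has to be finite.
\<close>

lemma finite_extension_ge_2:
  fixes f :: "nat \<Rightarrow> 'a \<Rightarrow> complex"
  assumes bound: "\<And>f. f \<in> Lp_space M p \<Longrightarrow>
      (\<integral>\<^sup>+x. ennpow (square_sum f x) (p / 2) \<partial>M) \<le> l * (\<integral>\<^sup>+x. ennpow (sq (f x)) (p / 2) \<partial>M)"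
    and f: "\<And>j. f j \<in> Lp_space M p" and "2 \<le> p" and "l < top"
  shows "(\<integral>\<^sup>+x. ennpow (\<Sum>j<n. square_sum (f j) x) (p / 2) \<partial>M)
    \<le> ennreal (14 powr p) * l * (\<integral>\<^sup>+x. ennpow (\<Sum>j<n. sq (f j x)) (p / 2) \<partial>M)"
proof -
  define \<kappa> where "\<kappa> = l * gaussian_moment p"
  have "\<kappa> < top"
    using \<open>l < top\<close> gaussian_moment_finite[of p] p_gt_1 by (simp add: \<kappa>_def ennreal_mult_less_top)
  have iterate: "(\<integral>\<^sup>+x. ennpow (\<Sum>j<n. square_sum (f j) x) (p / 2) \<partial>M)
    \<le> (ennreal (14 powr p) * l + ennreal ((1 / 2) ^ m) * \<kappa>) * (\<integral>\<^sup>+x. ennpow (\<Sum>j<n. sq (f j x)) (p / 2) \<partial>M)"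
    if "\<And>j. f j \<in> Lp_space M p" for m n and f :: "nat \<Rightarrow> 'a \<Rightarrow> complex"
    using that
  proof (induction m arbitrary: f n)
    case 0
    have "(\<integral>\<^sup>+x. ennpow (\<Sum>j<n. square_sum (f j) x) (p / 2) \<partial>M)
        \<le> \<kappa> * (\<integral>\<^sup>+x. ennpow (\<Sum>j<n. sq (f j x)) (p / 2) \<partial>M)"
      unfolding \<kappa>_def by (rule finite_extension_ge_2_crude[OF bound 0 \<open>2 \<le> p\<close>])
    also have "\<dots> \<le> (ennreal (14 powr p) * l + ennreal ((1 / 2) ^ 0) * \<kappa>) * (\<integral>\<^sup>+x. ennpow (\<Sum>j<n. sq (f j x)) (p / 2) \<partial>M)"
      by (intro mult_right_mono) simp_all
    finally show ?case .
  next
    case (Suc m)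
    have half: "ennreal (14 powr p / 2) + ennreal (14 powr p / 2) = ennreal (14 powr p)"
      by (subst ennreal_plus[symmetric]) auto
    have "ennreal (14 powr p / 2) * l + ennreal (1 / 2) * (ennreal (14 powr p) * l + ennreal ((1 / 2) ^ m) * \<kappa>)
        = (ennreal (14 powr p / 2) + ennreal (1 / 2) * ennreal (14 powr p)) * l + ennreal (1 / 2) * ennreal ((1 / 2) ^ m) * \<kappa>"
      by (simp only: algebra_simps)
    also have "ennreal (1 / 2) * ennreal (14 powr p) = ennreal (14 powr p / 2)"
      by (subst ennreal_mult[symmetric]) auto
    also have "ennreal (1 / 2) * ennreal ((1 / 2) ^ m) = ennreal ((1 / 2) ^ Suc m)"
      by (subst ennreal_mult[symmetric]) auto
    finally have const_eq: "ennreal (14 powr p / 2) * l + ennreal (1 / 2) * (ennreal (14 powr p) * l + ennreal ((1 / 2) ^ m) * \<kappa>)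
        = ennreal (14 powr p) * l + ennreal ((1 / 2) ^ Suc m) * \<kappa>"
      unfolding half .
    show ?case
      unfolding const_eq[symmetric] by (rule truncation_step[OF bound Suc.IH Suc.prems \<open>2 \<le> p\<close>])
  qed
  define Y where "Y = (\<integral>\<^sup>+x. ennpow (\<Sum>j<n. sq (f j x)) (p / 2) \<partial>M)"
  show ?thesis
  proof (cases "Y = 0 \<or> Y = top \<and> l \<noteq> 0")
    case True
    then show ?thesis
    proof
      assume "Y = 0"
      then show ?thesis using iterate[where f = f and n = n and m = 0, OF f] by (simp add: Y_def)
    next
      assume "Y = top \<and> l \<noteq> 0"
      then show ?thesis by (simp add: Y_def ennreal_mult_top ennreal_mult_eq_top_iff)
    qed
  next
    case False
    have "\<kappa> * Y < top"
      using False \<open>\<kappa> < top\<close> by (auto simp: ennreal_mult_less_top less_top \<kappa>_def)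
    then obtain c where c: "\<kappa> * Y = ennreal c" "0 \<le> c"
      by (cases "\<kappa> * Y") auto
    have lim: "(\<lambda>m. ennreal (14 powr p) * l * Y + ennreal ((1 / 2) ^ m * c)) \<longlonglongrightarrow> ennreal (14 powr p) * l * Y + ennreal 0"
      by (intro tendsto_intros tendsto_ennrealI) (rule tendsto_mult_left_zero, rule LIMSEQ_power_zero, simp)
    have "(\<integral>\<^sup>+x. ennpow (\<Sum>j<n. square_sum (f j) x) (p / 2) \<partial>M) \<le> ennreal (14 powr p) * l * Y + ennreal ((1 / 2) ^ m * c)" for m
    proof -
      have "ennreal ((1 / 2) ^ m) * \<kappa> * Y = ennreal ((1 / 2) ^ m * c)"
        using c by (simp add: mult.assoc ennreal_mult)
      then show ?thesis
        using iterate[where f = f and n = n and m = m, OF f] unfolding Y_def[symmetric] distrib_right by simp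
    qed
    then have "(\<integral>\<^sup>+x. ennpow (\<Sum>j<n. square_sum (f j) x) (p / 2) \<partial>M) \<le> ennreal (14 powr p) * l * Y + ennreal 0"
      using lim by (intro LIMSEQ_le_const) auto
    then show ?thesis by (simp add: Y_def)
  qed
qed

text \<open>The constant \<open>14\<^sup>p\<close> dominates \<open>5\<close> for \<open>p \<le> 2\<close> and \<open>2\<^bsup>p/2\<^esup>\<close> in the reverse case for \<open>p \<ge> 2\<close>.\<close>

theorem countable_extension:
  fixes f :: "nat \<Rightarrow> 'a \<Rightarrow> complex"
  assumes bound: "\<And>f. f \<in> Lp_space M p \<Longrightarrow>
      (\<integral>\<^sup>+x. ennpow (square_sum f x) (p / 2) \<partial>M) \<le> l * (\<integral>\<^sup>+x. ennpow (sq (f x)) (p / 2) \<partial>M)"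
    and f: "\<And>j. f j \<in> Lp_space M p" and "l < top"
  shows "(\<integral>\<^sup>+x. ennpow (\<Sum>j. square_sum (f j) x) (p / 2) \<partial>M)
    \<le> ennreal (14 powr p) * l * (\<integral>\<^sup>+x. ennpow (\<Sum>j. sq (f j x)) (p / 2) \<partial>M)"
proof (rule suminf_family_bound)
  fix n
  show "(\<integral>\<^sup>+x. ennpow (\<Sum>j<n. square_sum (f j) x) (p / 2) \<partial>M)
      \<le> ennreal (14 powr p) * l * (\<integral>\<^sup>+x. ennpow (\<Sum>j<n. sq (f j x)) (p / 2) \<partial>M)"
  proof (cases "p \<le> 2")
    case True
    have "(14::real) powr 1 \<le> 14 powr p"
      using p_gt_1 by (intro powr_mono) auto
    then have "(5::ennreal) \<le> ennreal (14 powr p)"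
      using ennreal_leI[of 5 "14 powr p"] by simp
    then show ?thesis
      by (intro order_trans[OF finite_extension_le_2[OF bound f True] mult_right_mono] mult_right_mono) auto
  qed (use finite_extension_ge_2[OF bound f _ \<open>l < top\<close>] in simp)
qed (use f p_gt_1 Lp_space_measurable[OF f] in auto)

theorem countable_reverse_extension:
  fixes f :: "nat \<Rightarrow> 'a \<Rightarrow> complex"
  assumes bound: "\<And>f. f \<in> Lp_space M p \<Longrightarrow>
      (\<integral>\<^sup>+x. ennpow (sq (f x)) (p / 2) \<partial>M) \<le> l * (\<integral>\<^sup>+x. ennpow (square_sum f x) (p / 2) \<partial>M)"
    and f: "\<And>j. f j \<in> Lp_space M p"
  shows "(\<integral>\<^sup>+x. ennpow (\<Sum>j. sq (f j x)) (p / 2) \<partial>M)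
    \<le> ennreal (14 powr p) * l * (\<integral>\<^sup>+x. ennpow (\<Sum>j. square_sum (f j) x) (p / 2) \<partial>M)"
proof (rule suminf_family_bound)
  fix n
  show "(\<integral>\<^sup>+x. ennpow (\<Sum>j<n. sq (f j x)) (p / 2) \<partial>M)
      \<le> ennreal (14 powr p) * l * (\<integral>\<^sup>+x. ennpow (\<Sum>j<n. square_sum (f j) x) (p / 2) \<partial>M)"
  proof (cases "p \<le> 2")
    case True
    have "(14::real) powr 1 \<le> 14 powr p"
      using p_gt_1 by (intro powr_mono) auto
    then have "(5::ennreal) \<le> ennreal (14 powr p)"
      using ennreal_leI[of 5 "14 powr p"] by simp
    then show ?thesis
      by (intro order_trans[OF finite_reverse_extension_le_2[OF bound f True] mult_right_mono] mult_right_mono) auto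
  next
    case False
    have "(2::real) powr (p / 2) \<le> 14 powr (p / 2)"
      using p_gt_1 by (intro powr_mono2) auto
    also have "\<dots> \<le> 14 powr p"
      using p_gt_1 by (intro powr_mono) auto
    finally show ?thesis
      using False
      by (intro order_trans[OF finite_reverse_extension_ge_2[OF bound f] mult_right_mono] mult_right_mono ennreal_leI) auto
  qed
qed (use f p_gt_1 Lp_space_measurable[OF f] in auto)

end

section \<open>Integration over the torus\<close>

lemma measurable_cis_circle:
  "(\<lambda>t::real. cis (2 * pi * t)) \<in> measurable (restrict_space lborel {0..<1}) (restrict_space borel (sphere 0 1))"
proof (rule measurable_restrict_space2)
  have "continuous_on UNIV (\<lambda>t::real. cis (2 * pi * t))"
    by (intro continuous_intros)
  then have "(\<lambda>t::real. cis (2 * pi * t)) \<in> borel_measurable borel"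
    by (rule borel_measurable_continuous_onI)
  then show "(\<lambda>t::real. cis (2 * pi * t)) \<in> borel_measurable (restrict_space lborel {0..<1})"
    by (intro measurable_restrict_space1) simp
qed (auto simp: norm_cis)

lemma space_circle_haar [simp]: "space circle_haar = sphere 0 1"
  by (simp add: circle_haar_def space_restrict_space)

lemma sets_circle_haar [measurable_cong]: "sets circle_haar = sets (restrict_space borel (sphere 0 1))"
  by (simp add: circle_haar_def)

lemma prob_space_circle_haar: "prob_space circle_haar"
proof -
  have "prob_space (restrict_space lborel {0..<1::real})"
    by (rule prob_spaceI) (simp add: emeasure_restrict_space space_restrict_space)
  then show ?thesis
    unfolding circle_haar_def using measurable_cis_circle by (rule prob_space.prob_space_distr)
qed

lemma measurable_circle_haar_borel:
  "g \<in> borel_measurable borel \<Longrightarrow> g \<in> borel_measurable circle_haar"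
  by (subst measurable_cong_sets[OF sets_circle_haar refl]) (rule measurable_restrict_space1)

lemma measurable_powi [measurable]: "(\<lambda>w::complex. w powi m) \<in> borel_measurable circle_haar"
  by (rule measurable_circle_haar_borel) (simp add: power_int_def)

interpretation circle: prob_space circle_haar
  by (rule prob_space_circle_haar)

interpretation torus: product_sigma_finite "\<lambda>_::nat. circle_haar"
  by standard

lemma prob_space_torus: "prob_space (torus d)"
  unfolding torus_def by (intro prob_space_PiM prob_space_circle_haar)

lemma space_torusD: "z \<in> space (torus d) \<Longrightarrow> i < d \<Longrightarrow> norm (z i) = 1"
  unfolding torus_def space_PiM using PiE_mem[of z "{..<d}" "\<lambda>_. sphere 0 1" i] by simp

lemma measurable_torus_component: "i < d \<Longrightarrow> (\<lambda>z. z i) \<in> measurable (torus d) circle_haar"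
  unfolding torus_def by (rule measurable_component_singleton) simp

lemma torus_Suc: "torus (Suc d) = PiM (insert d {..<d}) (\<lambda>_. circle_haar)"
  by (simp add: torus_def lessThan_Suc)

lemma measurable_torus_fun_upd [measurable]:
  "(\<lambda>(z, u). z(d := u)) \<in> measurable (torus d \<Otimes>\<^sub>M circle_haar) (torus (Suc d))"
  unfolding torus_Suc unfolding torus_def by (rule measurable_add_dim)

lemma measurable_torus_fun_upd_same [measurable]:
  "(\<lambda>(z, u). z(d := u)) \<in> measurable (torus (Suc d) \<Otimes>\<^sub>M circle_haar) (torus (Suc d))"
  unfolding split_beta' unfolding torus_Suc
  by (rule measurable_fun_upd[where J = "insert d {..<d}"]) auto

lemma nn_integral_torus_Suc:
  assumes "f \<in> borel_measurable (torus (Suc d))"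
  shows "(\<integral>\<^sup>+z. f z \<partial>torus (Suc d)) = (\<integral>\<^sup>+z. \<integral>\<^sup>+u. f (z(d := u)) \<partial>circle_haar \<partial>torus d)"
    and "(\<integral>\<^sup>+z. f z \<partial>torus (Suc d)) = (\<integral>\<^sup>+u. \<integral>\<^sup>+z. f (z(d := u)) \<partial>torus d \<partial>circle_haar)"
  using torus.product_nn_integral_insert[of "{..<d}" d f] torus.product_nn_integral_insert_rev[of "{..<d}" d f] assms
  unfolding torus_Suc unfolding torus_def by simp_all

lemma nn_integral_torus_0: "(\<integral>\<^sup>+z. f z \<partial>torus 0) = f (\<lambda>_. undefined)"
  by (simp add: torus_def PiM_empty nn_integral_count_space_finite)

lemma integral_torus_0:
  fixes f :: "(nat \<Rightarrow> complex) \<Rightarrow> complex"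
  shows "(\<integral>z. f z \<partial>torus 0) = f (\<lambda>_. undefined)"
  by (simp add: torus_def PiM_empty lebesgue_integral_count_space_finite)

lemma nn_integral_torus_1:
  assumes "f \<in> borel_measurable (torus 1)"
  shows "(\<integral>\<^sup>+z. f z \<partial>torus 1) = (\<integral>\<^sup>+u. f ((\<lambda>_. undefined)(0 := u)) \<partial>circle_haar)"
  using nn_integral_torus_Suc(1)[of f 0] assms by (simp add: nn_integral_torus_0)

lemma (in prob_space) Lp_space_integrable:
  assumes "f \<in> Lp_space M p" "1 \<le> p"
  shows "integrable M f"
proof (rule integrableI_bounded)
  have [measurable]: "f \<in> borel_measurable M"
    using assms by (simp add: Lp_space_def)
  then show "f \<in> borel_measurable M" .
  have "ennpow (\<integral>\<^sup>+x. ennreal (norm (f x)) \<partial>M) p \<le> (\<integral>\<^sup>+x. ennpow (ennreal (norm (f x))) p \<partial>M)"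
    using assms by (intro jensen_ennpow) auto
  also have "\<dots> < top"
    using assms by (simp add: Lp_space_iff ennpow_sq)
  finally show "(\<integral>\<^sup>+x. ennreal (norm (f x)) \<partial>M) < \<infinity>"
    by (simp add: ennpow_le_top_iff)
qed

lemma AE_torus_slice_Lp:
  assumes "f \<in> Lp_space (torus (Suc d)) p" "0 < p"
  shows "AE z in torus d. (\<lambda>u. f (z(d := u))) \<in> Lp_space circle_haar p"
proof -
  have [measurable]: "f \<in> borel_measurable (torus (Suc d))"
    using assms by (simp add: Lp_space_def)
  have "(\<integral>\<^sup>+z. \<integral>\<^sup>+u. ennpow (sq (f (z(d := u)))) (p / 2) \<partial>circle_haar \<partial>torus d) \<noteq> \<infinity>"
    using assms nn_integral_torus_Suc(1)[of "\<lambda>z. ennpow (sq (f z)) (p / 2)" d] by (simp add: Lp_space_iff less_top)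
  then have "AE z in torus d. (\<integral>\<^sup>+u. ennpow (sq (f (z(d := u)))) (p / 2) \<partial>circle_haar) \<noteq> \<infinity>"
    by (rule nn_integral_PInf_AE[rotated]) measurable
  moreover have "AE z in torus d. (\<lambda>u. f (z(d := u))) \<in> borel_measurable circle_haar"
    by (rule AE_I2) measurable
  ultimately show ?thesis
    by eventually_elim (use assms in \<open>simp add: Lp_space_iff less_top\<close>)
qed

section \<open>Dyadic pieces of Fourier series\<close>

definition circle_coeff :: "(complex \<Rightarrow> complex) \<Rightarrow> int \<Rightarrow> complex" where
  "circle_coeff h m = (\<integral>w. h w * cnj (w powi m) \<partial>circle_haar)"

lemma dyadic_intervals_finite_nonempty: "I \<in> dyadic_intervals \<Longrightarrow> finite I \<and> I \<noteq> {}"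
  by (auto simp: dyadic_intervals_def)

lemma countable_dyadic_intervals: "countable dyadic_intervals"
proof -
  have "dyadic_intervals \<subseteq> insert {0} (range (\<lambda>k. {2 ^ (k - 1)..<2 ^ k}) \<union> range (\<lambda>k. {- (2 ^ k)<..- (2 ^ (k - 1))}))"
    by (auto simp: dyadic_intervals_def)
  then show ?thesis
    by (rule countable_subset) simp
qed

lemma infinite_dyadic_intervals: "infinite dyadic_intervals"
proof
  assume "finite dyadic_intervals"
  moreover have "range (\<lambda>k. {2 ^ k..<2 ^ Suc k} :: int set) \<subseteq> dyadic_intervals"
  proof
    fix I assume "I \<in> range (\<lambda>k. {2 ^ k..<2 ^ Suc k} :: int set)"
    then obtain k where "I = {2 ^ (Suc k - 1)..<2 ^ Suc k}" by auto
    then show "I \<in> dyadic_intervals"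
      unfolding dyadic_intervals_def by (intro UnI1 UnI2 CollectI exI[of _ "Suc k"]) simp
  qed
  moreover have "inj (\<lambda>k. {2 ^ k..<2 ^ Suc k} :: int set)"
    by (rule injI) (simp add: Ico_eq_Ico)
  ultimately show False
    using finite_subset range_inj_infinite by blast
qed

text \<open>An enumeration turns sums over the dyadic intervals into series.\<close>

definition dyadic :: "nat \<Rightarrow> int set" where
  "dyadic = from_nat_into dyadic_intervals"

lemma bij_betw_dyadic: "bij_betw dyadic UNIV dyadic_intervals"
  unfolding dyadic_def
  by (rule bij_betw_from_nat_into[OF countable_dyadic_intervals infinite_dyadic_intervals])

lemma dyadic_in: "dyadic k \<in> dyadic_intervals"
  using bij_betw_dyadic by (auto simp: bij_betw_def)

lemma finite_dyadic [simp]: "finite (dyadic k)" and dyadic_nonempty: "dyadic k \<noteq> {}"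
  using dyadic_intervals_finite_nonempty[OF dyadic_in] by auto

definition dyadic_piece :: "nat \<Rightarrow> (complex \<Rightarrow> complex) \<Rightarrow> complex \<Rightarrow> complex" where
  "dyadic_piece k h w = (\<Sum>m\<in>dyadic k. circle_coeff h m * w powi m)"

lemma measurable_cnj_powi [measurable]: "(\<lambda>w. cnj (w powi m)) \<in> borel_measurable circle_haar"
proof -
  have "cnj \<in> borel_measurable borel"
    by (rule borel_measurable_continuous_onI) (intro continuous_intros)
  then show ?thesis
    by (rule measurable_compose[OF measurable_powi])
qed

lemma integrable_circle_coeff:
  assumes "integrable circle_haar h"
  shows "integrable circle_haar (\<lambda>w. h w * cnj (w powi m))"
proof (rule Bochner_Integration.integrable_bound[OF assms])
  have [measurable]: "h \<in> borel_measurable circle_haar"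
    using assms by simp
  show "(\<lambda>w. h w * cnj (w powi m)) \<in> borel_measurable circle_haar"
    by measurable
  show "AE w in circle_haar. norm (h w * cnj (w powi m)) \<le> norm (h w)"
    by (rule AE_I2) (simp add: norm_mult norm_power_int)
qed

lemma circle_coeff_lincomb:
  assumes "finite J" "\<And>j. j \<in> J \<Longrightarrow> integrable circle_haar (f j)"
  shows "circle_coeff (\<lambda>x. \<Sum>j\<in>J. c j * f j x) m = (\<Sum>j\<in>J. c j * circle_coeff (f j) m)"
  unfolding circle_coeff_def sum_distrib_right mult.assoc
  using assms
  by (subst Bochner_Integration.integral_sum)
     (intro integrable_mult_right integrable_circle_coeff, simp, simp del: complex_cnj_power_int)

lemma lp_operator_sequence_dyadic:
  assumes "1 < p"
  shows "lp_operator_sequence circle_haar p dyadic_piece"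
proof
  fix k :: nat and J :: "nat set" and c f x
  assume J: "finite J" and f: "\<And>j. j \<in> J \<Longrightarrow> f j \<in> Lp_space circle_haar p"
  have "integrable circle_haar (f j)" if "j \<in> J" for j
    using circle.Lp_space_integrable[OF f[OF that]] assms by simp
  then have "circle_coeff (\<lambda>x. \<Sum>j\<in>J. c j * f j x) m = (\<Sum>j\<in>J. c j * circle_coeff (f j) m)" for m
    by (intro circle_coeff_lincomb J)
  then have "dyadic_piece k (\<lambda>x. \<Sum>j\<in>J. c j * f j x) x = (\<Sum>m\<in>dyadic k. \<Sum>j\<in>J. c j * circle_coeff (f j) m * x powi m)"
    by (simp add: dyadic_piece_def sum_distrib_right)
  also have "\<dots> = (\<Sum>j\<in>J. c j * dyadic_piece k (f j) x)"
    by (subst sum.swap) (simp add: dyadic_piece_def sum_distrib_left mult.assoc)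
  finally show "dyadic_piece k (\<lambda>x. \<Sum>j\<in>J. c j * f j x) x = (\<Sum>j\<in>J. c j * dyadic_piece k (f j) x)" .
next
  show "dyadic_piece k f \<in> borel_measurable circle_haar" for k f
    unfolding dyadic_piece_def by measurable
qed (use assms in auto)

lemma character_Suc: "character (Suc d) (n(d := m)) z = character d n z * z d powi m"
  unfolding character_def by (simp add: lessThan_Suc mult.commute)

lemma character_fun_upd: "character d n (z(d := u)) = character d n z"
  unfolding character_def by simp

lemma norm_character: "z \<in> space (torus d) \<Longrightarrow> norm (character d n z) = 1"
  unfolding character_def by (simp add: prod_norm[symmetric] norm_power_int space_torusD)

lemma measurable_character [measurable]: "character d n \<in> borel_measurable (torus d)"
proof -
  have "(\<lambda>z. z i powi n i) \<in> borel_measurable (torus d)" if "i \<in> {..<d}" for i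
    using that by (intro measurable_compose[OF measurable_torus_component measurable_powi]) simp
  then show ?thesis
    unfolding character_def by (rule borel_measurable_prod)
qed

lemma integrable_fourier_coeff:
  assumes "integrable (torus d) f"
  shows "integrable (torus d) (\<lambda>z. f z * cnj (character d n z))"
proof (rule Bochner_Integration.integrable_bound[OF assms])
  have [measurable]: "f \<in> borel_measurable (torus d)"
    using assms by simp
  have "cnj \<in> borel_measurable borel"
    by (rule borel_measurable_continuous_onI) (intro continuous_intros)
  then have [measurable]: "(\<lambda>z. cnj (character d n z)) \<in> borel_measurable (torus d)"
    by (rule measurable_compose[OF measurable_character])
  show "(\<lambda>z. f z * cnj (character d n z)) \<in> borel_measurable (torus d)"
    by measurable
  show "AE z in torus d. norm (f z * cnj (character d n z)) \<le> norm (f z)"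
    by (rule AE_I2) (simp add: norm_mult norm_character)
qed

lemma fourier_coeff_lincomb:
  assumes "finite J" "\<And>j. j \<in> J \<Longrightarrow> integrable (torus d) (f j)"
  shows "fourier_coeff d (\<lambda>z. \<Sum>j\<in>J. f j z * c j) n = (\<Sum>j\<in>J. fourier_coeff d (f j) n * c j)"
proof -
  have "fourier_coeff d (\<lambda>z. \<Sum>j\<in>J. f j z * c j) n = (\<integral>z. (\<Sum>j\<in>J. (f j z * cnj (character d n z)) * c j) \<partial>torus d)"
    unfolding fourier_coeff_def sum_distrib_right by (simp only: ac_simps)
  also have "\<dots> = (\<Sum>j\<in>J. fourier_coeff d (f j) n * c j)"
    unfolding fourier_coeff_def using assms
    by (subst Bochner_Integration.integral_sum) (auto intro!: integrable_mult_left integrable_fourier_coeff)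
  finally show ?thesis .
qed

text \<open>Fubini's theorem: a Fourier coefficient on the torus can be formed one variable at a time.\<close>

lemma fourier_coeff_Suc:
  assumes "integrable (torus (Suc d)) f"
  shows "fourier_coeff (Suc d) f (n(d := m)) = fourier_coeff d (\<lambda>z. circle_coeff (\<lambda>u. f (z(d := u))) m) n"
proof -
  have "integrable (PiM (insert d {..<d}) (\<lambda>_. circle_haar)) (\<lambda>z. f z * cnj (character (Suc d) (n(d := m)) z))"
    using integrable_fourier_coeff[OF assms, of "n(d := m)"] by (simp only: torus_Suc)
  then have "fourier_coeff (Suc d) f (n(d := m))
      = (\<integral>z. \<integral>u. f (z(d := u)) * cnj (character (Suc d) (n(d := m)) (z(d := u))) \<partial>circle_haar \<partial>torus d)"
    unfolding fourier_coeff_def torus_Suc unfolding torus_def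
    by (intro torus.product_integral_insert) auto
  also have "\<dots> = (\<integral>z. \<integral>u. (f (z(d := u)) * cnj (u powi m)) * cnj (character d n z) \<partial>circle_haar \<partial>torus d)"
    by (simp only: character_Suc character_fun_upd fun_upd_same complex_cnj_mult ac_simps)
  also have "\<dots> = fourier_coeff d (\<lambda>z. circle_coeff (\<lambda>u. f (z(d := u))) m) n"
    unfolding fourier_coeff_def circle_coeff_def by (simp only: integral_mult_left_zero)
  finally show ?thesis .
qed

lemma measurable_circle_coeff_slice [measurable]:
  assumes [measurable]: "f \<in> borel_measurable (torus (Suc d))"
  shows "(\<lambda>z. circle_coeff (\<lambda>u. f (z(d := u))) m) \<in> borel_measurable (torus d)"
    and "(\<lambda>z. circle_coeff (\<lambda>u. f (z(d := u))) m) \<in> borel_measurable (torus (Suc d))"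
  unfolding circle_coeff_def by measurable

lemma norm_circle_coeff_le: "ennreal (norm (circle_coeff h m)) \<le> (\<integral>\<^sup>+u. ennreal (norm (h u)) \<partial>circle_haar)"
proof (cases "integrable circle_haar (\<lambda>w. h w * cnj (w powi m))")
  case True
  then have "ennreal (norm (circle_coeff h m)) \<le> (\<integral>\<^sup>+w. ennreal (norm (h w * cnj (w powi m))) \<partial>circle_haar)"
    unfolding circle_coeff_def by (rule integral_norm_bound_ennreal)
  also have "\<dots> = (\<integral>\<^sup>+w. ennreal (norm (h w)) \<partial>circle_haar)"
    by (intro nn_integral_cong) (simp add: norm_mult norm_power_int)
  finally show ?thesis .
next
  case False
  then show ?thesis by (simp add: circle_coeff_def not_integrable_integral_eq)
qed

lemma circle_coeff_slice_Lp:
  assumes f: "f \<in> Lp_space (torus (Suc d)) p" and "1 \<le> p"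
  shows "(\<lambda>z. circle_coeff (\<lambda>u. f (z(d := u))) m) \<in> Lp_space (torus d) p"
proof -
  have [measurable]: "f \<in> borel_measurable (torus (Suc d))"
    using f by (simp add: Lp_space_def)
  have "(\<integral>\<^sup>+z. ennpow (sq (circle_coeff (\<lambda>u. f (z(d := u))) m)) (p / 2) \<partial>torus d)
      \<le> (\<integral>\<^sup>+z. \<integral>\<^sup>+u. ennpow (ennreal (norm (f (z(d := u))))) p \<partial>circle_haar \<partial>torus d)"
  proof (rule nn_integral_mono)
    fix z assume [measurable]: "z \<in> space (torus d)"
    have "ennpow (sq (circle_coeff (\<lambda>u. f (z(d := u))) m)) (p / 2)
        \<le> ennpow (\<integral>\<^sup>+u. ennreal (norm (f (z(d := u)))) \<partial>circle_haar) p"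
      unfolding ennpow_sq using \<open>1 \<le> p\<close> by (intro ennpow_mono norm_circle_coeff_le) simp
    also have "\<dots> \<le> (\<integral>\<^sup>+u. ennpow (ennreal (norm (f (z(d := u))))) p \<partial>circle_haar)"
      using \<open>1 \<le> p\<close> by (intro circle.jensen_ennpow) measurable
    finally show "ennpow (sq (circle_coeff (\<lambda>u. f (z(d := u))) m)) (p / 2)
        \<le> (\<integral>\<^sup>+u. ennpow (ennreal (norm (f (z(d := u))))) p \<partial>circle_haar)" .
  qed
  also have "\<dots> = (\<integral>\<^sup>+z. ennpow (ennreal (norm (f z))) p \<partial>torus (Suc d))"
    by (rule nn_integral_torus_Suc(1)[symmetric]) measurable
  also have "\<dots> < top"
    using f \<open>1 \<le> p\<close> by (simp add: Lp_space_iff ennpow_sq)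
  finally show ?thesis
    using \<open>1 \<le> p\<close> by (simp add: Lp_space_iff)
qed

text \<open>
  The iteration over the coordinates stays within \<open>L\<^sub>p\<close>, for every value \<open>w\<close> of the last one, since a
  dyadic piece is a finite sum and its coefficients are controlled by Jensen's inequality.
\<close>

lemma dyadic_piece_slice_Lp:
  assumes f: "f \<in> Lp_space (torus (Suc d)) p" and "1 \<le> p"
  shows "(\<lambda>z. dyadic_piece k (\<lambda>u. f (z(d := u))) w) \<in> Lp_space (torus d) p"
proof -
  have "(\<lambda>z. \<Sum>m\<in>dyadic k. w powi m * circle_coeff (\<lambda>u. f (z(d := u))) m) \<in> Lp_space (torus d) p"
    by (intro Lp_space_lincomb circle_coeff_slice_Lp f \<open>1 \<le> p\<close>) simp
  then show ?thesis
    by (simp add: dyadic_piece_def mult.commute)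
qed

subsection \<open>The dyadic partition in one more dimension\<close>

text \<open>
  A member of the dyadic partition in dimension \<open>d + 1\<close> is the product of a member \<open>R\<close> in dimension
  \<open>d\<close> and a dyadic interval for the coordinate \<open>d\<close>.
\<close>

definition dyadic_product :: "nat \<Rightarrow> (nat \<Rightarrow> int) set \<times> nat \<Rightarrow> (nat \<Rightarrow> int) set" where
  "dyadic_product d = (\<lambda>(R, k). (\<lambda>(m, n). n(d := m)) ` (dyadic k \<times> R))"

lemma dyadic_partition_extensional: "R \<in> dyadic_partition d \<Longrightarrow> n \<in> R \<Longrightarrow> n d = undefined"
  by (auto simp: dyadic_partition_def PiE_def extensional_def)

lemma dyadic_partition_nonempty: "R \<in> dyadic_partition d \<Longrightarrow> R \<noteq> {}"
  using dyadic_intervals_finite_nonempty by (auto simp: dyadic_partition_def PiE_eq_empty_iff)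

lemma bij_betw_dyadic_product:
  "bij_betw (dyadic_product d) (dyadic_partition d \<times> UNIV) (dyadic_partition (Suc d))"
proof (rule bij_betwI')
  fix x y assume "x \<in> dyadic_partition d \<times> (UNIV :: nat set)" "y \<in> dyadic_partition d \<times> (UNIV :: nat set)"
  then obtain R k R' k' where xy: "x = (R, k)" "y = (R', k')"
    and R: "R \<in> dyadic_partition d" "R' \<in> dyadic_partition d" by auto
  have last: "(\<lambda>n. n d) ` dyadic_product d (R, k) = dyadic k" if "R \<in> dyadic_partition d" for R k
  proof (rule equalityI)
    obtain n where "n \<in> R"
      using dyadic_partition_nonempty[OF \<open>R \<in> dyadic_partition d\<close>] by auto
    show "dyadic k \<subseteq> (\<lambda>n. n d) ` dyadic_product d (R, k)"
    proof
      fix m assume "m \<in> dyadic k"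
      then have "n(d := m) \<in> dyadic_product d (R, k)"
        unfolding dyadic_product_def prod.case using \<open>n \<in> R\<close> by (intro image_eqI[of _ _ "(m, n)"]) simp_all
      then show "m \<in> (\<lambda>n. n d) ` dyadic_product d (R, k)"
        by (rule image_eqI[rotated]) simp
    qed
  qed (auto simp: dyadic_product_def)
  have initial: "(\<lambda>n. n(d := undefined)) ` dyadic_product d (R, k) = R" if "R \<in> dyadic_partition d" for R k
  proof -
    have restore: "(n(d := m))(d := undefined) = n" if "n \<in> R" for n m
      using dyadic_partition_extensional[OF \<open>R \<in> dyadic_partition d\<close> that] by (simp add: fun_upd_idem)
    obtain m where "m \<in> dyadic k"
      using dyadic_nonempty[of k] by auto
    show ?thesis
    proof (rule equalityI)
      show "R \<subseteq> (\<lambda>n. n(d := undefined)) ` dyadic_product d (R, k)"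
      proof
        fix n assume "n \<in> R"
        then have "n(d := m) \<in> dyadic_product d (R, k)"
          unfolding dyadic_product_def prod.case using \<open>m \<in> dyadic k\<close> by (intro image_eqI[of _ _ "(m, n)"]) simp_all
        then show "n \<in> (\<lambda>n. n(d := undefined)) ` dyadic_product d (R, k)"
          by (rule image_eqI[rotated]) (simp only: restore[OF \<open>n \<in> R\<close>])
      qed
    next
      show "(\<lambda>n. n(d := undefined)) ` dyadic_product d (R, k) \<subseteq> R"
      proof
        fix n' assume "n' \<in> (\<lambda>n. n(d := undefined)) ` dyadic_product d (R, k)"
        then obtain n m where "n \<in> R" "n' = (n(d := m))(d := undefined)"
          by (auto simp: dyadic_product_def)
        then show "n' \<in> R"
          using restore[of n m] by simp
      qed
    qed
  qed
  show "dyadic_product d x = dyadic_product d y \<longleftrightarrow> x = y"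
  proof
    assume eq: "dyadic_product d x = dyadic_product d y"
    have "dyadic k = dyadic k'"
      using last[OF R(1), of k] last[OF R(2), of k'] eq unfolding xy by simp
    then have "k = k'"
      using bij_betw_dyadic by (auto simp: bij_betw_def inj_def)
    moreover have "R = R'"
      using initial[OF R(1), of k] initial[OF R(2), of k'] eq unfolding xy by simp
    ultimately show "x = y"
      by (simp add: xy)
  qed simp
next
  fix x assume "x \<in> dyadic_partition d \<times> (UNIV :: nat set)"
  then obtain R k I where x: "x = (R, k)" and R: "R = PiE {..<d} I" and I: "\<forall>i<d. I i \<in> dyadic_intervals"
    by (auto simp: dyadic_partition_def)
  have "PiE {..<d} (I(d := dyadic k)) = PiE {..<d} I"
    by (rule PiE_cong) simp
  then have "dyadic_product d x = PiE (insert d {..<d}) (I(d := dyadic k))"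
    unfolding PiE_insert_eq x dyadic_product_def R by simp
  moreover have "\<forall>i<Suc d. (I(d := dyadic k)) i \<in> dyadic_intervals"
    using I dyadic_in by (auto simp: less_Suc_eq)
  ultimately show "dyadic_product d x \<in> dyadic_partition (Suc d)"
    unfolding dyadic_partition_def lessThan_Suc by blast
next
  fix S assume "S \<in> dyadic_partition (Suc d)"
  then obtain I where S: "S = PiE (insert d {..<d}) I" and I: "\<forall>i<Suc d. I i \<in> dyadic_intervals"
    by (auto simp: dyadic_partition_def lessThan_Suc)
  obtain k where k: "dyadic k = I d"
    using I bij_betw_dyadic unfolding bij_betw_def by (metis imageE lessI)
  have "S = dyadic_product d (PiE {..<d} I, k)"
    unfolding S PiE_insert_eq dyadic_product_def by (simp add: k)
  moreover have "PiE {..<d} I \<in> dyadic_partition d"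
    unfolding dyadic_partition_def by (intro CollectI exI[of _ I] conjI refl) (use I in simp)
  ultimately show "\<exists>x\<in>dyadic_partition d \<times> UNIV. S = dyadic_product d x"
    by blast
qed

lemma dyadic_partition_0: "dyadic_partition 0 = {{\<lambda>_. undefined}}"
  by (auto simp: dyadic_partition_def)

lemma countable_dyadic_partition: "countable (dyadic_partition d)"
proof (induction d)
  case (Suc d)
  have "dyadic_partition (Suc d) = dyadic_product d ` (dyadic_partition d \<times> UNIV)"
    using bij_betw_dyadic_product by (simp add: bij_betw_def)
  then show ?case using Suc by simp
qed (simp add: dyadic_partition_0)

lemma partial_sum_dyadic_product:
  assumes f: "f \<in> Lp_space (torus (Suc d)) p" and "1 \<le> p" and R: "R \<in> dyadic_partition d"
  shows "partial_sum (Suc d) (dyadic_product d (R, k)) f z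
    = partial_sum d R (\<lambda>z'. dyadic_piece k (\<lambda>u. f (z'(d := u))) (z d)) z"
proof -
  interpret torus_d: prob_space "torus d" by (rule prob_space_torus)
  interpret torus_Suc: prob_space "torus (Suc d)" by (rule prob_space_torus)
  have inj: "inj_on (\<lambda>(m, n). n(d := m)) (dyadic k \<times> R)"
  proof (rule inj_onI)
    fix x y assume "x \<in> dyadic k \<times> R" "y \<in> dyadic k \<times> R"
      and eq: "(case x of (m, n) \<Rightarrow> n(d := m)) = (case y of (m, n) \<Rightarrow> n(d := m))"
    then obtain m n m' n' where xy: "x = (m, n)" "y = (m', n')" and "n \<in> R" "n' \<in> R"
      by (metis mem_Sigma_iff surj_pair)
    have eq': "n(d := m) = n'(d := m')"
      using eq by (simp add: xy)
    have "n = (n(d := m))(d := undefined)"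
      using dyadic_partition_extensional[OF R \<open>n \<in> R\<close>] by (simp add: fun_upd_idem)
    also have "\<dots> = n'"
      unfolding eq' using dyadic_partition_extensional[OF R \<open>n' \<in> R\<close>] by (simp add: fun_upd_idem)
    finally show "x = y"
      using fun_cong[OF eq', of d] by (simp add: xy)
  qed
  have "partial_sum (Suc d) (dyadic_product d (R, k)) f z
      = (\<Sum>(m, n)\<in>dyadic k \<times> R. fourier_coeff (Suc d) f (n(d := m)) * character (Suc d) (n(d := m)) z)"
    unfolding partial_sum_def dyadic_product_def prod.case
    by (subst sum.reindex[OF inj]) (simp add: split_beta')
  also have "\<dots> = (\<Sum>(m, n)\<in>dyadic k \<times> R.
      fourier_coeff d (\<lambda>z. circle_coeff (\<lambda>u. f (z(d := u))) m) n * z d powi m * character d n z)"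
    using torus_Suc.Lp_space_integrable[OF f \<open>1 \<le> p\<close>]
    by (simp only: fourier_coeff_Suc character_Suc ac_simps)
  also have "\<dots> = (\<Sum>n\<in>R. (\<Sum>m\<in>dyadic k. fourier_coeff d (\<lambda>z. circle_coeff (\<lambda>u. f (z(d := u))) m) n * z d powi m) * character d n z)"
    by (simp add: sum.cartesian_product[symmetric] sum_distrib_right) (rule sum.swap)
  also have "\<dots> = (\<Sum>n\<in>R. fourier_coeff d (\<lambda>z'. \<Sum>m\<in>dyadic k. circle_coeff (\<lambda>u. f (z'(d := u))) m * z d powi m) n * character d n z)"
    by (subst fourier_coeff_lincomb) (auto intro: torus_d.Lp_space_integrable[OF circle_coeff_slice_Lp[OF f \<open>1 \<le> p\<close>] \<open>1 \<le> p\<close>])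
  also have "\<dots> = partial_sum d R (\<lambda>z'. dyadic_piece k (\<lambda>u. f (z'(d := u))) (z d)) z"
    by (simp add: partial_sum_def dyadic_piece_def)
  finally show ?thesis .
qed

definition dyadic_square_sum :: "nat \<Rightarrow> ((nat \<Rightarrow> complex) \<Rightarrow> complex) \<Rightarrow> (nat \<Rightarrow> complex) \<Rightarrow> ennreal" where
  "dyadic_square_sum d f z = (\<Sum>\<^sub>\<infinity>R\<in>dyadic_partition d. sq (partial_sum d R f z))"

lemma infsum_ennreal_eq_nn_integral:
  fixes f :: "'i \<Rightarrow> ennreal"
  assumes "countable A"
  shows "infsum f A = (\<integral>\<^sup>+x. f x \<partial>count_space A)"
proof (cases "finite A")
  case True
  then show ?thesis by (simp add: nn_integral_count_space_finite)
next
  case False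
  have nat: "infsum g UNIV = (\<Sum>k. g k)" for g :: "nat \<Rightarrow> ennreal"
  proof (rule antisym)
    show "infsum g UNIV \<le> (\<Sum>k. g k)"
      by (subst nonneg_infsum_complete) (auto intro!: SUP_least sum_le_suminf)
    show "(\<Sum>k. g k) \<le> infsum g UNIV"
      by (subst nonneg_infsum_complete) (auto simp: suminf_eq_SUP intro!: SUP_mono)
  qed
  have e: "bij_betw (from_nat_into A) UNIV A"
    by (rule bij_betw_from_nat_into[OF assms False])
  show ?thesis
    using infsum_reindex_bij_betw[OF e, of f] nn_integral_bij_count_space[OF e, of f]
    by (simp add: nat nn_integral_count_space_nat)
qed

lemma dyadic_square_sum_0: "dyadic_square_sum 0 f z = sq (f (\<lambda>_. undefined))"
  by (simp add: dyadic_square_sum_def dyadic_partition_0 partial_sum_def fourier_coeff_def integral_torus_0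
      character_def)

text \<open>
  The recursion behind the iteration: the square sum in dimension \<open>d + 1\<close> is that of the family of
  dyadic pieces in the last variable.
\<close>

lemma dyadic_square_sum_Suc:
  assumes f: "f \<in> Lp_space (torus (Suc d)) p" and "1 \<le> p"
  shows "dyadic_square_sum (Suc d) f z
    = (\<Sum>k. dyadic_square_sum d (\<lambda>z'. dyadic_piece k (\<lambda>u. f (z'(d := u))) (z d)) z)"
proof -
  define \<phi> where "\<phi> R k = sq (partial_sum d R (\<lambda>z'. dyadic_piece k (\<lambda>u. f (z'(d := u))) (z d)) z)" for R k
  interpret A: sigma_finite_measure "count_space (dyadic_partition d)"
    by (rule sigma_finite_measure_count_space_countable[OF countable_dyadic_partition])
  interpret B: sigma_finite_measure "count_space (UNIV :: nat set)"
    by (rule sigma_finite_measure_count_space_countable) simp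
  interpret AB: pair_sigma_finite "count_space (dyadic_partition d)" "count_space (UNIV :: nat set)" ..
  have pair: "count_space (dyadic_partition d) \<Otimes>\<^sub>M count_space (UNIV :: nat set) = count_space (dyadic_partition d \<times> UNIV)"
    by (rule pair_measure_countable[OF countable_dyadic_partition]) simp
  have "dyadic_square_sum (Suc d) f z = (\<integral>\<^sup>+S. sq (partial_sum (Suc d) S f z) \<partial>count_space (dyadic_partition (Suc d)))"
    unfolding dyadic_square_sum_def by (rule infsum_ennreal_eq_nn_integral[OF countable_dyadic_partition])
  also have "\<dots> = (\<integral>\<^sup>+x. sq (partial_sum (Suc d) (dyadic_product d x) f z) \<partial>count_space (dyadic_partition d \<times> UNIV))"
    by (rule nn_integral_bij_count_space[OF bij_betw_dyadic_product, symmetric])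
  also have "\<dots> = (\<integral>\<^sup>+x. (case x of (R, k) \<Rightarrow> \<phi> R k) \<partial>count_space (dyadic_partition d \<times> UNIV))"
    by (rule nn_integral_cong) (auto simp: partial_sum_dyadic_product[OF f \<open>1 \<le> p\<close>] \<phi>_def)
  also have "\<dots> = (\<integral>\<^sup>+k. \<integral>\<^sup>+R. \<phi> R k \<partial>count_space (dyadic_partition d) \<partial>count_space UNIV)"
    unfolding pair[symmetric] by (subst AB.nn_integral_snd[symmetric]) (simp_all add: pair)
  also have "\<dots> = (\<Sum>k. dyadic_square_sum d (\<lambda>z'. dyadic_piece k (\<lambda>u. f (z'(d := u))) (z d)) z)"
    unfolding dyadic_square_sum_def infsum_ennreal_eq_nn_integral[OF countable_dyadic_partition] \<phi>_def
    by (rule nn_integral_count_space_nat)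
  finally show ?thesis .
qed

lemma measurable_dyadic_square_sum [measurable]: "dyadic_square_sum d f \<in> borel_measurable (torus d)"
proof -
  have [measurable]: "partial_sum d R f \<in> borel_measurable (torus d)" for R
    unfolding partial_sum_def by measurable
  interpret sigma_finite_measure "count_space (dyadic_partition d)"
    by (rule sigma_finite_measure_count_space_countable[OF countable_dyadic_partition])
  have "(\<lambda>(R, z). sq (partial_sum d R f z)) \<in> borel_measurable (count_space (dyadic_partition d) \<Otimes>\<^sub>M torus d)"
    by (rule measurable_pair_measure_countable1[OF countable_dyadic_partition]) simp
  then have "(\<lambda>(z, R). sq (partial_sum d R f z)) \<in> borel_measurable (torus d \<Otimes>\<^sub>M count_space (dyadic_partition d))"
    by (rule measurable_pair_swap[THEN measurable_cong[THEN iffD1, rotated]]) auto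
  then show ?thesis
    unfolding dyadic_square_sum_def infsum_ennreal_eq_nn_integral[OF countable_dyadic_partition]
    by (rule borel_measurable_nn_integral)
qed

lemma dyadic_square_sum_fun_upd: "dyadic_square_sum d f (z(d := u)) = dyadic_square_sum d f z"
  by (simp add: dyadic_square_sum_def partial_sum_def character_fun_upd)

lemma dyadic_square_sum_zero: "dyadic_square_sum d (\<lambda>_. 0) z = 0"
  by (simp add: dyadic_square_sum_def partial_sum_def fourier_coeff_def)

lemma dyadic_square_sum_cmult: "dyadic_square_sum d (\<lambda>z. f z * c) w = sq c * dyadic_square_sum d f w"
proof -
  have "fourier_coeff d (\<lambda>z. f z * c) n = c * fourier_coeff d f n" for n
  proof -
    have "(f z * c) * cnj (character d n z) = c * (f z * cnj (character d n z))" for z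
      by simp
    then show ?thesis
      unfolding fourier_coeff_def by (simp only: integral_mult_right_zero)
  qed
  then have "partial_sum d R (\<lambda>z. f z * c) w = c * partial_sum d R f w" for R
    by (simp add: partial_sum_def sum_distrib_left mult.assoc)
  then show ?thesis
    unfolding dyadic_square_sum_def infsum_ennreal_eq_nn_integral[OF countable_dyadic_partition]
    by (simp only: sq_mult) (rule nn_integral_cmult, simp)
qed

section \<open>Iteration over the coordinates\<close>

abbreviation circle_square_sum :: "(complex \<Rightarrow> complex) \<Rightarrow> complex \<Rightarrow> ennreal" where
  "circle_square_sum \<equiv> lp_operator_sequence.square_sum dyadic_piece"

lemma circle_square_sum_eq: "circle_square_sum h w = (\<Sum>k. sq (dyadic_piece k h w))"
  by (rule lp_operator_sequence.square_sum_def[OF lp_operator_sequence_dyadic[of 2]]) simp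

text \<open>
  The pieces of the functions \<open>f j\<close> in the last variable, at a fixed value \<open>w\<close> of it, form a countable
  family of functions of the remaining variables. It is indexed by \<open>nat\<close> again, so that the induction
  over the dimension can be formulated for families of one fixed type.
\<close>

definition slice_family :: "nat \<Rightarrow> (nat \<Rightarrow> (nat \<Rightarrow> complex) \<Rightarrow> complex) \<Rightarrow> complex \<Rightarrow> nat \<Rightarrow> (nat \<Rightarrow> complex) \<Rightarrow> complex" where
  "slice_family d f w i z = (case prod_decode i of (j, k) \<Rightarrow> dyadic_piece k (\<lambda>u. f j (z(d := u))) w)"

lemma slice_family_Lp:
  assumes "\<And>j. f j \<in> Lp_space (torus (Suc d)) p" "1 < p"
  shows "slice_family d f w i \<in> Lp_space (torus d) p"
  using dyadic_piece_slice_Lp[OF assms(1)[of "fst (prod_decode i)"], where k = "snd (prod_decode i)" and w = w] assms(2)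
  unfolding slice_family_def by (simp add: split_beta')

lemma suminf_prod_decode:
  fixes \<phi> :: "nat \<Rightarrow> nat \<Rightarrow> ennreal"
  shows "(\<Sum>i. case prod_decode i of (j, k) \<Rightarrow> \<phi> j k) = (\<Sum>j. \<Sum>k. \<phi> j k)"
  by (rule suminf_ennreal_2dimen[where f = "\<lambda>(j, k). \<phi> j k"]) simp

lemma measurable_torus_partial_integral:
  fixes \<Phi> :: "(nat \<Rightarrow> complex) \<Rightarrow> ennreal"
  assumes [measurable]: "\<Phi> \<in> borel_measurable (torus (Suc d))"
  shows "(\<lambda>w. \<integral>\<^sup>+z. \<Phi> (z(d := w)) \<partial>torus d) \<in> borel_measurable circle_haar"
    and "(\<lambda>z. \<integral>\<^sup>+w. \<Phi> (z(d := w)) \<partial>circle_haar) \<in> borel_measurable (torus d)"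
proof -
  interpret torus_d: prob_space "torus d" by (rule prob_space_torus)
  have "(\<lambda>(z, w). \<Phi> (z(d := w))) \<in> borel_measurable (torus d \<Otimes>\<^sub>M circle_haar)"
    by measurable
  then have "(\<lambda>(w, z). \<Phi> (z(d := w))) \<in> borel_measurable (circle_haar \<Otimes>\<^sub>M torus d)"
    using measurable_pair_swap by fastforce
  then show "(\<lambda>w. \<integral>\<^sup>+z. \<Phi> (z(d := w)) \<partial>torus d) \<in> borel_measurable circle_haar"
    by (rule torus_d.borel_measurable_nn_integral)
qed measurable

lemma dyadic_square_sum_fun_upd_Suc:
  assumes f: "\<And>j. f j \<in> Lp_space (torus (Suc d)) p" and p: "1 < p"
  shows "(\<Sum>j. dyadic_square_sum (Suc d) (f j) (z(d := w))) = (\<Sum>i. dyadic_square_sum d (slice_family d f w i) z)"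
proof -
  have "(\<Sum>j. dyadic_square_sum (Suc d) (f j) (z(d := w)))
      = (\<Sum>j. \<Sum>k. dyadic_square_sum d (\<lambda>z'. dyadic_piece k (\<lambda>u. f j (z'(d := u))) w) z)"
    using p by (simp add: dyadic_square_sum_Suc[OF f] dyadic_square_sum_fun_upd)
  also have "\<dots> = (\<Sum>i. dyadic_square_sum d (slice_family d f w i) z)"
    unfolding suminf_prod_decode[symmetric] slice_family_def[abs_def] by (simp add: split_beta')
  finally show ?thesis .
qed

text \<open>
  The next three lemmas express the two sides of the inequality in dimension \<open>d + 1\<close>, and the quantity
  that links dimension \<open>d\<close> to the circle, as iterated integrals. Both extension theorems on the torus
  chain them, in opposite directions.
\<close>

lemma square_sums_Suc:
  assumes f: "\<And>j. f j \<in> Lp_space (torus (Suc d)) p" and p: "1 < p"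
  shows "(\<integral>\<^sup>+z. ennpow (\<Sum>j. dyadic_square_sum (Suc d) (f j) z) (p / 2) \<partial>torus (Suc d))
    = (\<integral>\<^sup>+w. \<integral>\<^sup>+z. ennpow (\<Sum>i. dyadic_square_sum d (slice_family d f w i) z) (p / 2) \<partial>torus d \<partial>circle_haar)"
    and "(\<lambda>w. \<integral>\<^sup>+z. ennpow (\<Sum>i. dyadic_square_sum d (slice_family d f w i) z) (p / 2) \<partial>torus d)
      \<in> borel_measurable circle_haar"
  using nn_integral_torus_Suc(2)[of "\<lambda>z. ennpow (\<Sum>j. dyadic_square_sum (Suc d) (f j) z) (p / 2)" d]
    measurable_torus_partial_integral(1)[of "\<lambda>z. ennpow (\<Sum>j. dyadic_square_sum (Suc d) (f j) z) (p / 2)" d]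
  by (simp_all add: dyadic_square_sum_fun_upd_Suc[OF f p])

lemma circle_square_sums:
  assumes f: "\<And>j. f j \<in> Lp_space (torus (Suc d)) p" and p: "1 < p"
  shows "(\<integral>\<^sup>+w. \<integral>\<^sup>+z. ennpow (\<Sum>i. sq (slice_family d f w i z)) (p / 2) \<partial>torus d \<partial>circle_haar)
    = (\<integral>\<^sup>+z. \<integral>\<^sup>+w. ennpow (\<Sum>j. circle_square_sum (\<lambda>u. f j (z(d := u))) w) (p / 2) \<partial>circle_haar \<partial>torus d)"
    and "(\<lambda>w. \<integral>\<^sup>+z. ennpow (\<Sum>i. sq (slice_family d f w i z)) (p / 2) \<partial>torus d) \<in> borel_measurable circle_haar"
    and "(\<lambda>z. \<integral>\<^sup>+w. ennpow (\<Sum>j. circle_square_sum (\<lambda>u. f j (z(d := u))) w) (p / 2) \<partial>circle_haar)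
      \<in> borel_measurable (torus d)"
proof -
  define \<Phi> where "\<Phi> z = ennpow (\<Sum>j. \<Sum>k. sq (dyadic_piece k (\<lambda>u. f j (z(d := u))) (z d))) (p / 2)" for z
  note [measurable] = Lp_space_measurable[OF f]
  have [measurable]: "(\<lambda>z. z d powi m) \<in> borel_measurable (torus (Suc d))" for m
    by (intro measurable_compose[OF measurable_torus_component measurable_powi]) simp
  have [measurable]: "\<Phi> \<in> borel_measurable (torus (Suc d))"
    unfolding \<Phi>_def[abs_def] dyadic_piece_def by measurable
  have "(\<Sum>i. sq (slice_family d f w i z)) = (\<Sum>j. \<Sum>k. sq (dyadic_piece k (\<lambda>u. f j (z(d := u))) w))" for w z
    unfolding suminf_prod_decode[symmetric] slice_family_def by (simp add: split_beta')
  then have 1: "ennpow (\<Sum>i. sq (slice_family d f w i z)) (p / 2) = \<Phi> (z(d := w))" for w z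
    by (simp add: \<Phi>_def)
  have 2: "ennpow (\<Sum>j. circle_square_sum (\<lambda>u. f j (z(d := u))) w) (p / 2) = \<Phi> (z(d := w))" for w z
    by (simp add: \<Phi>_def circle_square_sum_eq)
  show "(\<integral>\<^sup>+w. \<integral>\<^sup>+z. ennpow (\<Sum>i. sq (slice_family d f w i z)) (p / 2) \<partial>torus d \<partial>circle_haar)
      = (\<integral>\<^sup>+z. \<integral>\<^sup>+w. ennpow (\<Sum>j. circle_square_sum (\<lambda>u. f j (z(d := u))) w) (p / 2) \<partial>circle_haar \<partial>torus d)"
    unfolding 1 2 using nn_integral_torus_Suc[of \<Phi> d] by simp
  show "(\<lambda>w. \<integral>\<^sup>+z. ennpow (\<Sum>i. sq (slice_family d f w i z)) (p / 2) \<partial>torus d) \<in> borel_measurable circle_haar"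
    unfolding 1 by (rule measurable_torus_partial_integral) measurable
  show "(\<lambda>z. \<integral>\<^sup>+w. ennpow (\<Sum>j. circle_square_sum (\<lambda>u. f j (z(d := u))) w) (p / 2) \<partial>circle_haar)
      \<in> borel_measurable (torus d)"
    unfolding 2 by (rule measurable_torus_partial_integral) measurable
qed

lemma norms_Suc:
  assumes f: "\<And>j. f j \<in> Lp_space (torus (Suc d)) p"
  shows "(\<integral>\<^sup>+z. ennpow (\<Sum>j. sq (f j z)) (p / 2) \<partial>torus (Suc d))
    = (\<integral>\<^sup>+z. \<integral>\<^sup>+w. ennpow (\<Sum>j. sq (f j (z(d := w)))) (p / 2) \<partial>circle_haar \<partial>torus d)"
    and "(\<lambda>z. \<integral>\<^sup>+w. ennpow (\<Sum>j. sq (f j (z(d := w)))) (p / 2) \<partial>circle_haar) \<in> borel_measurable (torus d)"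
proof -
  note [measurable] = Lp_space_measurable[OF f]
  have [measurable]: "(\<lambda>z. ennpow (\<Sum>j. sq (f j z)) (p / 2)) \<in> borel_measurable (torus (Suc d))"
    by measurable
  show "(\<integral>\<^sup>+z. ennpow (\<Sum>j. sq (f j z)) (p / 2) \<partial>torus (Suc d))
      = (\<integral>\<^sup>+z. \<integral>\<^sup>+w. ennpow (\<Sum>j. sq (f j (z(d := w)))) (p / 2) \<partial>circle_haar \<partial>torus d)"
    by (rule nn_integral_torus_Suc(1)) measurable
  show "(\<lambda>z. \<integral>\<^sup>+w. ennpow (\<Sum>j. sq (f j (z(d := w)))) (p / 2) \<partial>circle_haar) \<in> borel_measurable (torus d)"
    by (rule measurable_torus_partial_integral(2)[of "\<lambda>z. ennpow (\<Sum>j. sq (f j z)) (p / 2)"]) measurable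
qed

lemma AE_torus_slices_Lp:
  fixes f :: "nat \<Rightarrow> (nat \<Rightarrow> complex) \<Rightarrow> complex"
  assumes "\<And>j. f j \<in> Lp_space (torus (Suc d)) p" "1 < p"
  shows "AE z in torus d. \<forall>j. (\<lambda>u. f j (z(d := u))) \<in> Lp_space circle_haar p"
  using assms AE_torus_slice_Lp[of "f j" d p for j] by (simp add: AE_all_countable)

text \<open>
  The Hilbert space valued inequality on the circle is applied in the last variable, and the induction
  hypothesis in the remaining ones; the constants multiply.
\<close>

lemma torus_extension:
  fixes f :: "nat \<Rightarrow> (nat \<Rightarrow> complex) \<Rightarrow> complex"
  assumes p: "1 < p" and "l < top"
    and bound: "\<And>h. h \<in> Lp_space circle_haar p \<Longrightarrow>
      (\<integral>\<^sup>+w. ennpow (circle_square_sum h w) (p / 2) \<partial>circle_haar) \<le> l * (\<integral>\<^sup>+w. ennpow (sq (h w)) (p / 2) \<partial>circle_haar)"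
    and "\<And>j. f j \<in> Lp_space (torus d) p"
  shows "(\<integral>\<^sup>+z. ennpow (\<Sum>j. dyadic_square_sum d (f j) z) (p / 2) \<partial>torus d)
    \<le> (ennreal (14 powr p) * l) ^ d * (\<integral>\<^sup>+z. ennpow (\<Sum>j. sq (f j z)) (p / 2) \<partial>torus d)"
  using assms(4)
proof (induction d arbitrary: f)
  case 0
  show ?case unfolding nn_integral_torus_0 dyadic_square_sum_0 by simp
next
  case (Suc d)
  define K where "K = ennreal (14 powr p) * l"
  interpret lp_operator_sequence circle_haar p dyadic_piece
    by (rule lp_operator_sequence_dyadic[OF p])
  note [measurable] = Lp_space_measurable[OF slice_family_Lp[OF Suc.prems p]] Lp_space_measurable[OF Suc.prems]
  have "(\<integral>\<^sup>+z. ennpow (\<Sum>j. dyadic_square_sum (Suc d) (f j) z) (p / 2) \<partial>torus (Suc d))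
      = (\<integral>\<^sup>+w. \<integral>\<^sup>+z. ennpow (\<Sum>i. dyadic_square_sum d (slice_family d f w i) z) (p / 2) \<partial>torus d \<partial>circle_haar)"
    by (rule square_sums_Suc(1)[OF Suc.prems p])
  also have "\<dots> \<le> (\<integral>\<^sup>+w. K ^ d * (\<integral>\<^sup>+z. ennpow (\<Sum>i. sq (slice_family d f w i z)) (p / 2) \<partial>torus d) \<partial>circle_haar)"
    unfolding K_def by (intro nn_integral_mono Suc.IH slice_family_Lp[OF Suc.prems p])
  also have "\<dots> = K ^ d * (\<integral>\<^sup>+w. \<integral>\<^sup>+z. ennpow (\<Sum>i. sq (slice_family d f w i z)) (p / 2) \<partial>torus d \<partial>circle_haar)"
    by (rule nn_integral_cmult) (rule circle_square_sums(2)[OF Suc.prems p])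
  also have "\<dots> = K ^ d * (\<integral>\<^sup>+z. \<integral>\<^sup>+w. ennpow (\<Sum>j. circle_square_sum (\<lambda>u. f j (z(d := u))) w) (p / 2) \<partial>circle_haar \<partial>torus d)"
    unfolding circle_square_sums(1)[OF Suc.prems p] ..
  also have "\<dots> \<le> K ^ d * (\<integral>\<^sup>+z. K * (\<integral>\<^sup>+w. ennpow (\<Sum>j. sq (f j (z(d := w)))) (p / 2) \<partial>circle_haar) \<partial>torus d)"
  proof (intro mult_left_mono nn_integral_mono_AE)
    have "AE z in torus d. \<forall>j. (\<lambda>u. f j (z(d := u))) \<in> Lp_space circle_haar p"
      by (rule AE_torus_slices_Lp[OF Suc.prems p])
    then show "AE z in torus d. (\<integral>\<^sup>+w. ennpow (\<Sum>j. circle_square_sum (\<lambda>u. f j (z(d := u))) w) (p / 2) \<partial>circle_haar)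
        \<le> K * (\<integral>\<^sup>+w. ennpow (\<Sum>j. sq (f j (z(d := w)))) (p / 2) \<partial>circle_haar)"
    proof (rule eventually_mono)
      fix z assume "\<forall>j. (\<lambda>u. f j (z(d := u))) \<in> Lp_space circle_haar p"
      then show "(\<integral>\<^sup>+w. ennpow (\<Sum>j. circle_square_sum (\<lambda>u. f j (z(d := u))) w) (p / 2) \<partial>circle_haar)
        \<le> K * (\<integral>\<^sup>+w. ennpow (\<Sum>j. sq (f j (z(d := w)))) (p / 2) \<partial>circle_haar)"
        unfolding K_def by (intro countable_extension[OF bound _ \<open>l < top\<close>]) auto
    qed
  qed simp
  also have "\<dots> = K ^ d * (K * (\<integral>\<^sup>+z. \<integral>\<^sup>+w. ennpow (\<Sum>j. sq (f j (z(d := w)))) (p / 2) \<partial>circle_haar \<partial>torus d))"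
    by (subst nn_integral_cmult) (rule norms_Suc(2)[OF Suc.prems], simp)
  also have "\<dots> = K ^ Suc d * (\<integral>\<^sup>+z. ennpow (\<Sum>j. sq (f j z)) (p / 2) \<partial>torus (Suc d))"
    unfolding norms_Suc(1)[OF Suc.prems] by (simp only: power_Suc2 mult.assoc)
  finally show ?case
    by (simp only: K_def)
qed

lemma torus_reverse_extension:
  fixes f :: "nat \<Rightarrow> (nat \<Rightarrow> complex) \<Rightarrow> complex"
  assumes p: "1 < p"
    and bound: "\<And>h. h \<in> Lp_space circle_haar p \<Longrightarrow>
      (\<integral>\<^sup>+w. ennpow (sq (h w)) (p / 2) \<partial>circle_haar) \<le> l * (\<integral>\<^sup>+w. ennpow (circle_square_sum h w) (p / 2) \<partial>circle_haar)"
    and "\<And>j. f j \<in> Lp_space (torus d) p"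
  shows "(\<integral>\<^sup>+z. ennpow (\<Sum>j. sq (f j z)) (p / 2) \<partial>torus d)
    \<le> (ennreal (14 powr p) * l) ^ d * (\<integral>\<^sup>+z. ennpow (\<Sum>j. dyadic_square_sum d (f j) z) (p / 2) \<partial>torus d)"
  using assms(3)
proof (induction d arbitrary: f)
  case 0
  show ?case unfolding nn_integral_torus_0 dyadic_square_sum_0 by simp
next
  case (Suc d)
  define K where "K = ennreal (14 powr p) * l"
  interpret lp_operator_sequence circle_haar p dyadic_piece
    by (rule lp_operator_sequence_dyadic[OF p])
  have "(\<integral>\<^sup>+z. ennpow (\<Sum>j. sq (f j z)) (p / 2) \<partial>torus (Suc d))
      = (\<integral>\<^sup>+z. \<integral>\<^sup>+w. ennpow (\<Sum>j. sq (f j (z(d := w)))) (p / 2) \<partial>circle_haar \<partial>torus d)"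
    by (rule norms_Suc(1)[OF Suc.prems])
  also have "\<dots> \<le> (\<integral>\<^sup>+z. K * (\<integral>\<^sup>+w. ennpow (\<Sum>j. circle_square_sum (\<lambda>u. f j (z(d := u))) w) (p / 2) \<partial>circle_haar) \<partial>torus d)"
  proof (intro nn_integral_mono_AE)
    have "AE z in torus d. \<forall>j. (\<lambda>u. f j (z(d := u))) \<in> Lp_space circle_haar p"
      by (rule AE_torus_slices_Lp[OF Suc.prems p])
    then show "AE z in torus d. (\<integral>\<^sup>+w. ennpow (\<Sum>j. sq (f j (z(d := w)))) (p / 2) \<partial>circle_haar)
        \<le> K * (\<integral>\<^sup>+w. ennpow (\<Sum>j. circle_square_sum (\<lambda>u. f j (z(d := u))) w) (p / 2) \<partial>circle_haar)"
    proof (rule eventually_mono)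
      fix z assume "\<forall>j. (\<lambda>u. f j (z(d := u))) \<in> Lp_space circle_haar p"
      then show "(\<integral>\<^sup>+w. ennpow (\<Sum>j. sq (f j (z(d := w)))) (p / 2) \<partial>circle_haar)
        \<le> K * (\<integral>\<^sup>+w. ennpow (\<Sum>j. circle_square_sum (\<lambda>u. f j (z(d := u))) w) (p / 2) \<partial>circle_haar)"
        unfolding K_def by (intro countable_reverse_extension[OF bound]) auto
    qed
  qed
  also have "\<dots> = K * (\<integral>\<^sup>+z. \<integral>\<^sup>+w. ennpow (\<Sum>j. circle_square_sum (\<lambda>u. f j (z(d := u))) w) (p / 2) \<partial>circle_haar \<partial>torus d)"
    by (rule nn_integral_cmult) (rule circle_square_sums(3)[OF Suc.prems p])
  also have "\<dots> = K * (\<integral>\<^sup>+w. \<integral>\<^sup>+z. ennpow (\<Sum>i. sq (slice_family d f w i z)) (p / 2) \<partial>torus d \<partial>circle_haar)"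
    unfolding circle_square_sums(1)[OF Suc.prems p] ..
  also have "\<dots> \<le> K * (\<integral>\<^sup>+w. K ^ d * (\<integral>\<^sup>+z. ennpow (\<Sum>i. dyadic_square_sum d (slice_family d f w i) z) (p / 2) \<partial>torus d) \<partial>circle_haar)"
    unfolding K_def by (intro mult_left_mono nn_integral_mono Suc.IH slice_family_Lp[OF Suc.prems p]) simp
  also have "\<dots> = K * (K ^ d * (\<integral>\<^sup>+w. \<integral>\<^sup>+z. ennpow (\<Sum>i. dyadic_square_sum d (slice_family d f w i) z) (p / 2) \<partial>torus d \<partial>circle_haar))"
    by (subst nn_integral_cmult) (rule square_sums_Suc(2)[OF Suc.prems p], simp)
  also have "\<dots> = K ^ Suc d * (\<integral>\<^sup>+z. ennpow (\<Sum>j. dyadic_square_sum (Suc d) (f j) z) (p / 2) \<partial>torus (Suc d))"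
    unfolding square_sums_Suc(1)[OF Suc.prems p] by (simp only: power_Suc mult.assoc)
  finally show ?case
    by (simp only: K_def)
qed

section \<open>Tensor powers\<close>

lemma dyadic_piece_cmult: "dyadic_piece k (\<lambda>u. c * h u) w = c * dyadic_piece k h w"
proof -
  have "circle_coeff (\<lambda>u. c * h u) m = c * circle_coeff h m" for m
    unfolding circle_coeff_def mult.assoc by (rule integral_mult_right_zero)
  then show ?thesis
    by (simp add: dyadic_piece_def sum_distrib_left mult.assoc)
qed

definition tensor_power :: "nat \<Rightarrow> (complex \<Rightarrow> complex) \<Rightarrow> (nat \<Rightarrow> complex) \<Rightarrow> complex" where
  "tensor_power d h z = (\<Prod>i<d. h (z i))"

lemma tensor_power_fun_upd: "tensor_power (Suc d) h (z(d := u)) = tensor_power d h z * h u"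
  by (simp add: tensor_power_def lessThan_Suc mult.commute)

lemma tensor_power_norm:
  assumes h: "h \<in> Lp_space circle_haar p" and "1 < p"
  shows "(\<integral>\<^sup>+z. ennpow (sq (tensor_power d h z)) (p / 2) \<partial>torus d) = (\<integral>\<^sup>+w. ennpow (sq (h w)) (p / 2) \<partial>circle_haar) ^ d"
proof -
  have [measurable]: "h \<in> borel_measurable circle_haar"
    using h by (rule Lp_space_measurable)
  have "ennpow (sq (tensor_power d h z)) (p / 2) = (\<Prod>i<d. ennpow (sq (h (z i))) (p / 2))" for z
    using \<open>1 < p\<close>
    by (induction d) (simp_all add: tensor_power_def lessThan_Suc sq_mult ennpow_mult)
  then have "(\<integral>\<^sup>+z. ennpow (sq (tensor_power d h z)) (p / 2) \<partial>torus d)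
      = (\<integral>\<^sup>+z. (\<Prod>i<d. ennpow (sq (h (z i))) (p / 2)) \<partial>torus d)"
    by simp
  also have "\<dots> = (\<Prod>i<d. \<integral>\<^sup>+w. ennpow (sq (h w)) (p / 2) \<partial>circle_haar)"
    unfolding torus_def by (rule torus.product_nn_integral_prod) auto
  finally show ?thesis by simp
qed

lemma tensor_power_Lp:
  assumes h: "h \<in> Lp_space circle_haar p" and "1 < p"
  shows "tensor_power d h \<in> Lp_space (torus d) p"
proof -
  have "(\<lambda>z. h (z i)) \<in> borel_measurable (torus d)" if "i \<in> {..<d}" for i
    using that by (intro measurable_compose[OF measurable_torus_component Lp_space_measurable[OF h]]) simp
  then have "tensor_power d h \<in> borel_measurable (torus d)"
    unfolding tensor_power_def[abs_def] by (rule borel_measurable_prod)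
  moreover have "(\<integral>\<^sup>+w. ennpow (sq (h w)) (p / 2) \<partial>circle_haar) ^ d < top"
    using h \<open>1 < p\<close> by (simp add: Lp_space_iff power_less_top_ennreal)
  ultimately show ?thesis
    using \<open>1 < p\<close> tensor_power_norm[OF assms, of d] by (simp add: Lp_space_iff)
qed

lemma dyadic_square_sum_tensor_power:
  assumes h: "h \<in> Lp_space circle_haar p" and "1 < p"
  shows "dyadic_square_sum d (tensor_power d h) z = (\<Prod>i<d. circle_square_sum h (z i))"
proof (induction d)
  case 0
  show ?case unfolding dyadic_square_sum_0 by (simp add: tensor_power_def)
next
  case (Suc d)
  have "dyadic_square_sum (Suc d) (tensor_power (Suc d) h) z
      = (\<Sum>k. dyadic_square_sum d (\<lambda>z'. tensor_power d h z' * dyadic_piece k h (z d)) z)"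
    using \<open>1 < p\<close>
    by (simp add: dyadic_square_sum_Suc[OF tensor_power_Lp[OF assms]] tensor_power_fun_upd dyadic_piece_cmult)
  also have "\<dots> = (\<Sum>k. sq (dyadic_piece k h (z d)) * dyadic_square_sum d (tensor_power d h) z)"
    unfolding dyadic_square_sum_cmult ..
  also have "\<dots> = circle_square_sum h (z d) * dyadic_square_sum d (tensor_power d h) z"
    unfolding circle_square_sum_eq by (rule ennreal_suminf_multc)
  finally show ?case
    using Suc by (simp add: lessThan_Suc)
qed

lemma tensor_power_square_sum:
  assumes h: "h \<in> Lp_space circle_haar p" and "1 < p"
  shows "(\<integral>\<^sup>+z. ennpow (dyadic_square_sum d (tensor_power d h) z) (p / 2) \<partial>torus d)
    = (\<integral>\<^sup>+w. ennpow (circle_square_sum h w) (p / 2) \<partial>circle_haar) ^ d"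
proof -
  have [measurable]: "circle_square_sum h \<in> borel_measurable circle_haar"
    by (rule lp_operator_sequence.square_sum_measurable[OF lp_operator_sequence_dyadic[OF \<open>1 < p\<close>] h])
  have "ennpow (\<Prod>i<d. circle_square_sum h (z i)) (p / 2) = (\<Prod>i<d. ennpow (circle_square_sum h (z i)) (p / 2))" for z
    using \<open>1 < p\<close> by (induction d) (simp_all add: lessThan_Suc ennpow_mult)
  then have "(\<integral>\<^sup>+z. ennpow (dyadic_square_sum d (tensor_power d h) z) (p / 2) \<partial>torus d)
      = (\<integral>\<^sup>+z. (\<Prod>i<d. ennpow (circle_square_sum h (z i)) (p / 2)) \<partial>torus d)"
    by (simp add: dyadic_square_sum_tensor_power[OF assms])
  also have "\<dots> = (\<Prod>i<d. \<integral>\<^sup>+w. ennpow (circle_square_sum h w) (p / 2) \<partial>circle_haar)"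
    unfolding torus_def by (rule torus.product_nn_integral_prod) auto
  finally show ?thesis by simp
qed

section \<open>Best constants\<close>

lemma Lp_norm_le_iff:
  assumes "0 < p"
  shows "Lp_norm M p g \<le> L * Lp_norm M p f
    \<longleftrightarrow> (\<integral>\<^sup>+x. ennpow (g x) p \<partial>M) \<le> ennpow L p * (\<integral>\<^sup>+x. ennpow (f x) p \<partial>M)"
    and "L * Lp_norm M p f \<le> Lp_norm M p g
    \<longleftrightarrow> ennpow L p * (\<integral>\<^sup>+x. ennpow (f x) p \<partial>M) \<le> (\<integral>\<^sup>+x. ennpow (g x) p \<partial>M)"
  unfolding Lp_norm_def
  using assms ennpow_mono_iff[of p "ennpow (\<integral>\<^sup>+x. ennpow (g x) p \<partial>M) (1 / p)" "L * ennpow (\<integral>\<^sup>+x. ennpow (f x) p \<partial>M) (1 / p)"]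
    ennpow_mono_iff[of p "L * ennpow (\<integral>\<^sup>+x. ennpow (f x) p \<partial>M) (1 / p)" "ennpow (\<integral>\<^sup>+x. ennpow (g x) p \<partial>M) (1 / p)"]
  by (simp_all add: ennpow_mult ennpow_ennpow)

lemma square_function_eq: "ennpow (square_function d f z) p = ennpow (dyadic_square_sum d f z) (p / 2)"
  by (simp add: square_function_def dyadic_square_sum_def ennpow_ennpow)

text \<open>Admissibility in terms of the \<open>p\<close>-th powers of the norms, which can be compared without roots.\<close>

definition admissible_c :: "real \<Rightarrow> nat \<Rightarrow> ennreal \<Rightarrow> bool" where
  "admissible_c p d L \<longleftrightarrow> (\<forall>f\<in>Lp_space (torus d) p.
    (\<integral>\<^sup>+z. ennpow (dyadic_square_sum d f z) (p / 2) \<partial>torus d) \<le> ennpow L p * (\<integral>\<^sup>+z. ennpow (sq (f z)) (p / 2) \<partial>torus d))"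

definition admissible_t :: "real \<Rightarrow> nat \<Rightarrow> ennreal \<Rightarrow> bool" where
  "admissible_t p d L \<longleftrightarrow> (\<forall>f\<in>Lp_space (torus d) p.
    ennpow (inverse L) p * (\<integral>\<^sup>+z. ennpow (sq (f z)) (p / 2) \<partial>torus d) \<le> (\<integral>\<^sup>+z. ennpow (dyadic_square_sum d f z) (p / 2) \<partial>torus d))"

lemma best_eq_Inf:
  assumes "1 < p"
  shows "best_c p d = Inf {L. admissible_c p d L}" and "best_t p d = Inf {L. admissible_t p d L}"
  using assms
  by (simp_all add: best_c_def best_t_def admissible_c_def admissible_t_def Lp_norm_le_iff square_function_eq ennpow_sq)

text \<open>Functions on the one-dimensional torus are functions on the circle.\<close>

lemma torus_1_to_circle:
  assumes f: "f \<in> Lp_space (torus 1) p" and p: "1 < p"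
  defines "h \<equiv> \<lambda>u. f ((\<lambda>_. undefined)(0 := u))"
  shows "h \<in> Lp_space circle_haar p"
    and "(\<integral>\<^sup>+z. ennpow (sq (f z)) (p / 2) \<partial>torus 1) = (\<integral>\<^sup>+w. ennpow (sq (h w)) (p / 2) \<partial>circle_haar)"
    and "(\<integral>\<^sup>+z. ennpow (dyadic_square_sum 1 f z) (p / 2) \<partial>torus 1)
      = (\<integral>\<^sup>+w. ennpow (circle_square_sum h w) (p / 2) \<partial>circle_haar)"
proof -
  have [measurable]: "f \<in> borel_measurable (torus 1)"
    using f by (rule Lp_space_measurable)
  have "(\<lambda>_. undefined) \<in> space (torus 0)"
    by (simp add: torus_def space_PiM)
  then have "(\<lambda>u. (\<lambda>_. undefined)(0 := u)) \<in> measurable circle_haar (torus (Suc 0))"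
    using measurable_Pair2[OF measurable_torus_fun_upd[of 0], of "\<lambda>_. undefined"] by simp
  then have h: "h \<in> borel_measurable circle_haar"
    unfolding h_def by (rule measurable_compose) (use Lp_space_measurable[OF f] in simp)
  show norm: "(\<integral>\<^sup>+z. ennpow (sq (f z)) (p / 2) \<partial>torus 1) = (\<integral>\<^sup>+w. ennpow (sq (h w)) (p / 2) \<partial>circle_haar)"
    unfolding h_def by (rule nn_integral_torus_1) measurable
  then show "h \<in> Lp_space circle_haar p"
    using f h p by (simp add: Lp_space_iff)
  have "f \<in> Lp_space (torus (Suc 0)) p"
    using f by simp
  then have S: "dyadic_square_sum 1 f z = circle_square_sum h (z 0)" for z
    unfolding One_nat_def h_def circle_square_sum_eq using p
    by (subst dyadic_square_sum_Suc[where p = p]) (simp_all only: dyadic_square_sum_0 less_imp_le)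
  have "(\<integral>\<^sup>+z. ennpow (dyadic_square_sum 1 f z) (p / 2) \<partial>torus 1)
      = (\<integral>\<^sup>+u. ennpow (dyadic_square_sum 1 f ((\<lambda>_. undefined)(0 := u))) (p / 2) \<partial>circle_haar)"
    by (rule nn_integral_torus_1) measurable
  then show "(\<integral>\<^sup>+z. ennpow (dyadic_square_sum 1 f z) (p / 2) \<partial>torus 1)
      = (\<integral>\<^sup>+w. ennpow (circle_square_sum h w) (p / 2) \<partial>circle_haar)"
    unfolding S fun_upd_same .
qed

lemma circle_to_torus_1:
  assumes h: "h \<in> Lp_space circle_haar p" and p: "1 < p"
  shows "(\<lambda>z. h (z 0)) \<in> Lp_space (torus 1) p"
  using tensor_power_Lp[OF assms, of 1] unfolding tensor_power_def[abs_def] by simp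

lemma circle_admissible_c:
  assumes "1 < p"
  shows "admissible_c p 1 L \<longleftrightarrow> (\<forall>h\<in>Lp_space circle_haar p.
    (\<integral>\<^sup>+w. ennpow (circle_square_sum h w) (p / 2) \<partial>circle_haar) \<le> ennpow L p * (\<integral>\<^sup>+w. ennpow (sq (h w)) (p / 2) \<partial>circle_haar))"
    (is "?L \<longleftrightarrow> ?R")
proof
  assume ?L
  show ?R
  proof
    fix h assume "h \<in> Lp_space circle_haar p"
    note H = circle_to_torus_1[OF this assms]
    show "(\<integral>\<^sup>+w. ennpow (circle_square_sum h w) (p / 2) \<partial>circle_haar) \<le> ennpow L p * (\<integral>\<^sup>+w. ennpow (sq (h w)) (p / 2) \<partial>circle_haar)"
      using bspec[OF \<open>?L\<close>[unfolded admissible_c_def] H] unfolding torus_1_to_circle(2,3)[OF H assms] by simp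
  qed
next
  assume ?R
  show ?L
    unfolding admissible_c_def
  proof
    fix f assume f: "f \<in> Lp_space (torus 1) p"
    show "(\<integral>\<^sup>+z. ennpow (dyadic_square_sum 1 f z) (p / 2) \<partial>torus 1) \<le> ennpow L p * (\<integral>\<^sup>+z. ennpow (sq (f z)) (p / 2) \<partial>torus 1)"
      unfolding torus_1_to_circle(2,3)[OF f assms]
      by (rule bspec[OF \<open>?R\<close> torus_1_to_circle(1)[OF f assms]])
  qed
qed

lemma circle_admissible_t:
  assumes "1 < p"
  shows "admissible_t p 1 L \<longleftrightarrow> (\<forall>h\<in>Lp_space circle_haar p.
    ennpow (inverse L) p * (\<integral>\<^sup>+w. ennpow (sq (h w)) (p / 2) \<partial>circle_haar) \<le> (\<integral>\<^sup>+w. ennpow (circle_square_sum h w) (p / 2) \<partial>circle_haar))"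
    (is "?L \<longleftrightarrow> ?R")
proof
  assume ?L
  show ?R
  proof
    fix h assume "h \<in> Lp_space circle_haar p"
    note H = circle_to_torus_1[OF this assms]
    show "ennpow (inverse L) p * (\<integral>\<^sup>+w. ennpow (sq (h w)) (p / 2) \<partial>circle_haar) \<le> (\<integral>\<^sup>+w. ennpow (circle_square_sum h w) (p / 2) \<partial>circle_haar)"
      using bspec[OF \<open>?L\<close>[unfolded admissible_t_def] H] unfolding torus_1_to_circle(2,3)[OF H assms] by simp
  qed
next
  assume ?R
  show ?L
    unfolding admissible_t_def
  proof
    fix f assume f: "f \<in> Lp_space (torus 1) p"
    show "ennpow (inverse L) p * (\<integral>\<^sup>+z. ennpow (sq (f z)) (p / 2) \<partial>torus 1) \<le> (\<integral>\<^sup>+z. ennpow (dyadic_square_sum 1 f z) (p / 2) \<partial>torus 1)"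
      unfolding torus_1_to_circle(2,3)[OF f assms]
      by (rule bspec[OF \<open>?R\<close> torus_1_to_circle(1)[OF f assms]])
  qed
qed

lemma power_le_power_iff_ennreal:
  fixes x y :: ennreal
  assumes "0 < d"
  shows "x ^ d \<le> y ^ d \<longleftrightarrow> x \<le> y"
  using ennpow_mono_iff[of "real d" x y] assms by (simp add: ennpow_of_nat)

lemma ennpow_root_power:
  assumes "0 < d"
  shows "ennpow L (1 / real d) ^ d = L"
  using ennpow_of_nat[OF assms, of "ennpow L (1 / real d)"] assms by (simp add: ennpow_ennpow)

lemma ennpow_power: "0 < d \<Longrightarrow> ennpow (L ^ d) p = ennpow L p ^ d"
  by (simp add: ennpow_of_nat[symmetric] ennpow_ennpow mult.commute)

text \<open>
  The strict inequality \<open>L < L'\<close> makes \<open>L'\<close> positive. This allows for \<open>L = 0\<close>, whose inverse is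
  infinite.
\<close>

lemma le_power_Inf:
  fixes B :: ennreal
  assumes "\<And>L L'. L \<in> A \<Longrightarrow> L < L' \<Longrightarrow> B \<le> (ennreal C * L') ^ d" and "0 < d" "0 < C"
  shows "B \<le> (ennreal C * Inf A) ^ d"
proof -
  define y where "y = ennpow B (1 / real d)"
  have y: "y ^ d = B"
    unfolding y_def by (rule ennpow_root_power[OF \<open>0 < d\<close>])
  have inv: "ennreal C * ennreal (1 / C) = 1"
    using \<open>0 < C\<close> by (simp flip: ennreal_mult)
  have "ennreal (1 / C) * y \<le> L" if "L \<in> A" for L
  proof (rule dense_ge)
    fix L' assume "L < L'"
    then have "y \<le> ennreal C * L'"
      using assms(1)[OF that] power_le_power_iff_ennreal[OF \<open>0 < d\<close>] y by metis
    then have "ennreal (1 / C) * y \<le> ennreal (1 / C) * (ennreal C * L')"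
      by (rule mult_left_mono) simp
    also have "\<dots> = L'"
      using inv by (metis mult.assoc mult.commute mult_1)
    finally show "ennreal (1 / C) * y \<le> L'" .
  qed
  then have "ennreal (1 / C) * y \<le> Inf A"
    by (rule Inf_greatest)
  then have "ennreal C * (ennreal (1 / C) * y) \<le> ennreal C * Inf A"
    by (rule mult_left_mono) simp
  then have "y \<le> ennreal C * Inf A"
    using inv by (simp only: mult.assoc[symmetric] mult_1)
  then show ?thesis
    unfolding y[symmetric] by (simp add: power_le_power_iff_ennreal[OF \<open>0 < d\<close>])
qed

lemma power_Inf_le:
  fixes A :: "ennreal set"
  assumes "\<And>L. L \<in> A' \<Longrightarrow> ennpow L (1 / real d) \<in> A" and "0 < d"
  shows "Inf A ^ d \<le> Inf A'"
proof (rule Inf_greatest)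
  fix L assume "L \<in> A'"
  then have "Inf A ^ d \<le> ennpow L (1 / real d) ^ d"
    using assms by (subst power_le_power_iff_ennreal) (auto intro: Inf_lower)
  then show "Inf A ^ d \<le> L"
    by (simp add: ennpow_root_power[OF \<open>0 < d\<close>])
qed

text \<open>Testing an admissible constant on tensor powers, whose norms and square sums are \<open>d\<close>-th powers.\<close>

lemma admissible_c_root:
  assumes "admissible_c p d L" "1 < p" "0 < d"
  shows "admissible_c p 1 (ennpow L (1 / real d))"
  unfolding circle_admissible_c[OF \<open>1 < p\<close>]
proof
  fix h assume h: "h \<in> Lp_space circle_haar p"
  have "ennpow L p = ennpow (ennpow L (1 / real d)) p ^ d"
    using ennpow_power[OF \<open>0 < d\<close>, of "ennpow L (1 / real d)" p] ennpow_root_power[OF \<open>0 < d\<close>, of L] by simp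
  then show "(\<integral>\<^sup>+w. ennpow (circle_square_sum h w) (p / 2) \<partial>circle_haar)
      \<le> ennpow (ennpow L (1 / real d)) p * (\<integral>\<^sup>+w. ennpow (sq (h w)) (p / 2) \<partial>circle_haar)"
    using assms(1) tensor_power_Lp[OF h \<open>1 < p\<close>, of d] tensor_power_norm[OF h \<open>1 < p\<close>, of d]
      tensor_power_square_sum[OF h \<open>1 < p\<close>, of d]
    unfolding admissible_c_def by (metis power_le_power_iff_ennreal[OF \<open>0 < d\<close>] power_mult_distrib)
qed

lemma admissible_t_root:
  assumes "admissible_t p d L" "1 < p" "0 < d"
  shows "admissible_t p 1 (ennpow L (1 / real d))"
  unfolding circle_admissible_t[OF \<open>1 < p\<close>]
proof
  fix h assume h: "h \<in> Lp_space circle_haar p"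
  have "inverse (ennpow L (1 / real d)) ^ d = inverse L"
    using ennpow_inverse[of "1 / real d" L] ennpow_root_power[OF \<open>0 < d\<close>, of "inverse L"] \<open>0 < d\<close> by simp
  then have "ennpow (inverse L) p = ennpow (inverse (ennpow L (1 / real d))) p ^ d"
    using ennpow_power[OF \<open>0 < d\<close>, of "inverse (ennpow L (1 / real d))" p] by simp
  then show "ennpow (inverse (ennpow L (1 / real d))) p * (\<integral>\<^sup>+w. ennpow (sq (h w)) (p / 2) \<partial>circle_haar)
      \<le> (\<integral>\<^sup>+w. ennpow (circle_square_sum h w) (p / 2) \<partial>circle_haar)"
    using assms(1) tensor_power_Lp[OF h \<open>1 < p\<close>, of d] tensor_power_norm[OF h \<open>1 < p\<close>, of d]
      tensor_power_square_sum[OF h \<open>1 < p\<close>, of d]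
    unfolding admissible_t_def by (metis power_le_power_iff_ennreal[OF \<open>0 < d\<close>] power_mult_distrib)
qed

text \<open>A single function is a family whose other members vanish.\<close>

lemma suminf_single_family:
  fixes \<phi> :: "('a \<Rightarrow> complex) \<Rightarrow> ennreal"
  assumes "\<phi> (\<lambda>_. 0) = 0"
  shows "(\<Sum>j::nat. \<phi> (if j = 0 then f else (\<lambda>_. 0))) = \<phi> f"
  using suminf_finite[of "{0}" "\<lambda>j::nat. \<phi> (if j = 0 then f else (\<lambda>_. 0))"] assms by auto

lemma admissible_c_power:
  assumes "admissible_c p 1 L" "1 < p" "0 < d" "L < top"
  shows "admissible_c p d ((ennreal 14 * L) ^ d)"
  unfolding admissible_c_def
proof
  fix f assume f: "f \<in> Lp_space (torus d) p"
  define F where "F j = (if j = 0 then f else (\<lambda>_. 0))" for j :: nat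
  have F: "F j \<in> Lp_space (torus d) p" for j
    using f \<open>1 < p\<close> by (simp add: F_def Lp_space_zero)
  have "(\<integral>\<^sup>+z. ennpow (\<Sum>j. dyadic_square_sum d (F j) z) (p / 2) \<partial>torus d)
      \<le> (ennreal (14 powr p) * ennpow L p) ^ d * (\<integral>\<^sup>+z. ennpow (\<Sum>j. sq (F j z)) (p / 2) \<partial>torus d)"
  proof (rule torus_extension[OF \<open>1 < p\<close> _ _ F])
    show "ennpow L p < top"
      using \<open>L < top\<close> by (simp add: ennpow_le_top_iff)
  qed (rule bspec[OF assms(1)[unfolded circle_admissible_c[OF \<open>1 < p\<close>]]])
  moreover have "(\<Sum>j. dyadic_square_sum d (F j) z) = dyadic_square_sum d f z" for z
    unfolding F_def by (rule suminf_single_family[of "\<lambda>f. dyadic_square_sum d f z"]) (rule dyadic_square_sum_zero)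
  moreover have "(\<Sum>j. sq (F j z)) = sq (f z)" for z
    unfolding F_def by (rule suminf_single_family[of "\<lambda>f. sq (f z)"]) simp
  moreover have "ennpow ((ennreal 14 * L) ^ d) p = (ennreal (14 powr p) * ennpow L p) ^ d"
    using \<open>1 < p\<close> ennpow_ennreal[of 14 p] by (simp only: ennpow_power[OF \<open>0 < d\<close>]) (simp add: ennpow_mult)
  ultimately show "(\<integral>\<^sup>+z. ennpow (dyadic_square_sum d f z) (p / 2) \<partial>torus d)
      \<le> ennpow ((ennreal 14 * L) ^ d) p * (\<integral>\<^sup>+z. ennpow (sq (f z)) (p / 2) \<partial>torus d)"
    by simp
qed

lemma inverse_mult_le_iff:
  fixes K a b :: ennreal
  assumes "K \<noteq> 0" "K < top"
  shows "inverse K * a \<le> b \<longleftrightarrow> a \<le> K * b"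
proof -
  have inv: "K * inverse K = 1"
    using ennreal_divide_self[OF assms] by (simp add: divide_ennreal_def)
  show ?thesis
  proof
    assume "inverse K * a \<le> b"
    then have "K * (inverse K * a) \<le> K * b"
      by (rule mult_left_mono) simp
    then show "a \<le> K * b"
      using inv by (simp only: mult.assoc[symmetric] mult_1)
  next
    assume "a \<le> K * b"
    then have "inverse K * a \<le> inverse K * (K * b)"
      by (rule mult_left_mono) simp
    then show "inverse K * a \<le> b"
      using inv by (simp only: mult.assoc[symmetric] mult.commute[of "inverse K"] mult_1)
  qed
qed

lemma admissible_t_power:
  assumes "admissible_t p 1 L" "1 < p" "0 < d" "L < top" "L \<noteq> 0"
  shows "admissible_t p d ((ennreal 14 * L) ^ d)"
  unfolding admissible_t_def
proof
  fix f assume f: "f \<in> Lp_space (torus d) p"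
  define F where "F j = (if j = 0 then f else (\<lambda>_. 0))" for j :: nat
  have F: "F j \<in> Lp_space (torus d) p" for j
    using f \<open>1 < p\<close> by (simp add: F_def Lp_space_zero)
  have pos: "ennpow K p \<noteq> 0" if "K \<noteq> 0" for K
    using that \<open>1 < p\<close> ennpow_le_iff[of p K 0] by auto
  define M where "M = (ennreal 14 * L) ^ d"
  have M: "M \<noteq> 0" "M < top"
    using assms by (simp_all add: M_def power_less_top_ennreal ennreal_mult_less_top)
  have "(\<integral>\<^sup>+z. ennpow (\<Sum>j. sq (F j z)) (p / 2) \<partial>torus d)
      \<le> (ennreal (14 powr p) * ennpow L p) ^ d * (\<integral>\<^sup>+z. ennpow (\<Sum>j. dyadic_square_sum d (F j) z) (p / 2) \<partial>torus d)"
  proof (rule torus_reverse_extension[OF \<open>1 < p\<close> _ F])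
    show "(\<integral>\<^sup>+w. ennpow (sq (h w)) (p / 2) \<partial>circle_haar) \<le> ennpow L p * (\<integral>\<^sup>+w. ennpow (circle_square_sum h w) (p / 2) \<partial>circle_haar)"
      if "h \<in> Lp_space circle_haar p" for h
      using bspec[OF assms(1)[unfolded circle_admissible_t[OF \<open>1 < p\<close>]] that] assms(2,4,5) pos
      by (simp add: ennpow_inverse inverse_mult_le_iff ennpow_le_top_iff)
  qed
  moreover have "(\<Sum>j. dyadic_square_sum d (F j) z) = dyadic_square_sum d f z" for z
    unfolding F_def by (rule suminf_single_family[of "\<lambda>f. dyadic_square_sum d f z"]) (rule dyadic_square_sum_zero)
  moreover have "(\<Sum>j. sq (F j z)) = sq (f z)" for z
    unfolding F_def by (rule suminf_single_family[of "\<lambda>f. sq (f z)"]) simp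
  moreover have "(ennreal (14 powr p) * ennpow L p) ^ d = ennpow M p"
    using \<open>1 < p\<close> ennpow_ennreal[of 14 p] unfolding M_def
    by (simp only: ennpow_power[OF \<open>0 < d\<close>]) (simp add: ennpow_mult)
  ultimately show "ennpow (inverse ((ennreal 14 * L) ^ d)) p * (\<integral>\<^sup>+z. ennpow (sq (f z)) (p / 2) \<partial>torus d)
      \<le> (\<integral>\<^sup>+z. ennpow (dyadic_square_sum d f z) (p / 2) \<partial>torus d)"
    unfolding M_def[symmetric] using \<open>1 < p\<close> M pos
    by (simp add: ennpow_inverse inverse_mult_le_iff ennpow_le_top_iff)
qed

lemma admissible_c_mono:
  assumes "admissible_c p d L" "L \<le> L'" "0 \<le> p"
  shows "admissible_c p d L'"
  using assms unfolding admissible_c_def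
  by (auto intro: order_trans[OF _ mult_right_mono[OF ennpow_mono]])

lemma admissible_t_mono:
  assumes "admissible_t p d L" "L \<le> L'" "0 \<le> p"
  shows "admissible_t p d L'"
proof -
  have "inverse L' \<le> inverse L"
  proof (cases "L = 0")
    case False
    then show ?thesis
      using assms(2)
      by (cases L; cases L') (auto simp: inverse_ennreal less_le top_unique intro!: le_imp_inverse_le ennreal_leI)
  qed simp
  then show ?thesis
    using assms unfolding admissible_t_def
    by (auto intro: order_trans[OF mult_right_mono[OF ennpow_mono]])
qed

theorem theorem10:
  shows "\<exists>C::real. C > 0 \<and>
    (\<forall>(p::real) (d::nat). 1 < p \<longrightarrow> 1 \<le> d \<longrightarrow>
       best_c p 1 ^ d \<le> best_c p d \<and> best_c p d \<le> (ennreal C * best_c p 1) ^ d \<and>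
       best_t p 1 ^ d \<le> best_t p d \<and> best_t p d \<le> (ennreal C * best_t p 1) ^ d)"
proof (intro exI[of _ 14] conjI allI impI)
  fix p :: real and d :: nat
  assume p: "1 < p" and "1 \<le> d"
  then have d: "0 < d" by simp
  show "best_c p 1 ^ d \<le> best_c p d"
    unfolding best_eq_Inf[OF p] by (rule power_Inf_le) (use admissible_c_root p d in auto)
  show "best_t p 1 ^ d \<le> best_t p d"
    unfolding best_eq_Inf[OF p] by (rule power_Inf_le) (use admissible_t_root p d in auto)
  show "best_c p d \<le> (ennreal 14 * best_c p 1) ^ d"
    unfolding best_eq_Inf(1)[OF p, of 1]
  proof (rule le_power_Inf)
    fix L L' assume "L \<in> {L. admissible_c p 1 L}" "L < L'"
    then have L': "admissible_c p 1 L'"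
      using admissible_c_mono[of p 1 L L'] p by simp
    show "best_c p d \<le> (ennreal 14 * L') ^ d"
    proof (cases "L' < top")
      case True
      then show ?thesis
        unfolding best_eq_Inf[OF p] using admissible_c_power[OF L' p d] by (intro Inf_lower) simp
    next
      case False
      then have "ennreal 14 * L' = top"
        using ennreal_mult_top[of "ennreal 14"] by (auto simp: less_top[symmetric])
      then have "(ennreal 14 * L') ^ d = top"
        using d by (simp only: power_eq_top_ennreal simp_thms)
      then show ?thesis
        by (simp only: top_greatest)
    qed
  qed (use d in simp_all)
  show "best_t p d \<le> (ennreal 14 * best_t p 1) ^ d"
    unfolding best_eq_Inf(2)[OF p, of 1]
  proof (rule le_power_Inf)
    fix L L' assume "L \<in> {L. admissible_t p 1 L}" "L < L'"
    then have L': "admissible_t p 1 L'" "L' \<noteq> 0"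
      using admissible_t_mono[of p 1 L L'] p by auto
    show "best_t p d \<le> (ennreal 14 * L') ^ d"
    proof (cases "L' < top")
      case True
      then show ?thesis
        unfolding best_eq_Inf[OF p] using admissible_t_power[OF L'(1) p d _ L'(2)] by (intro Inf_lower) simp
    next
      case False
      then have "ennreal 14 * L' = top"
        using ennreal_mult_top[of "ennreal 14"] by (auto simp: less_top[symmetric])
      then have "(ennreal 14 * L') ^ d = top"
        using d by (simp only: power_eq_top_ennreal simp_thms)
      then show ?thesis
        by (simp only: top_greatest)
    qed
  qed (use d in simp_all)
qed simp

end
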